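(* Let $\Omega$, $\mathcal A$, $u_0$ be as in the context. Let $f:\Omega\times\mathbb R^N\to[0,\infty)$ be a continuous integrand such that $f(x,\cdot)$ is convex for all $x\in\Omega$ and, for some $M>0$, $$\tfrac1M(|z|-1)\le|f(x,z)|\le M(1+|z|)\qquad\text{for all }(x,z)\in\Omega\times\mathbb R^N.$$ Assume further that there exists a modulus of continuity $\omega$ such that $$|f(x,z)-f(y,z)|\le\omega(|x-y|)(1+|z|)\qquad\text{for all }x,y\in\Omega,\ z\in\mathbb R^N.$$ Then the relaxation $$\overline{\mathcal F}[\mu]:=\inf\Big\{\liminf_{j\to\infty}\mathcal F[u_j]\;:\;u_j\in u_0+\ker\mathcal A,\ u_j\mathcal L^d\overset{*}{\rightharpoonup}\mu\Big\}$$ of the functional $\mathcal F[u]:=\int_\Omega f(x,u(x))\,dx$, $u\in u_0+\ker\mathcal A$, is given, for every $\mu$ in the affine space $u_0+\ker_{\mathcal M}\mathcal A$, by $$\overline{\mathcal F}[\mu]=\int_\Omega f\Big(x,\frac{d\mu}{d\mathcal L^d}(x)\Big)\,dx+\int_\Omega f^\infty\Big(x,\frac{d\mu^s}{d|\mu^s|}(x)\Big)\,d|\mu^s|(x),$$ where $\ker_{\mathcal M}\mathcal A=\{\mu\in\mathcal M(\Omega;\mathbb R^N):\mathcal A\mu=0\text{ in the sense of distributions}\}$, $\mu=\frac{d\mu}{d\mathcal L^d}\mathcal L^d+\mu^s$ is the Radon-Nikodým decomposition of $\mu$ with respect to $\mathcal L^d$, and $$f^\infty(x,z):=\lim_{x'\to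 x,\ t\to\infty}\frac{f(x',tz)}{t},\qquad(x,z)\in\Omega\times\mathbb R^N,$$ is the recession function of $f$.
   Context: $\Omega\subset\mathbb R^d$ is an open set with $\mathcal L^d(\partial\Omega)=0$, where $\mathcal L^d$ is Lebesgue measure. A modulus of continuity is a function $\omega:[0,\infty)\to[0,\infty)$ with $\omega(s)\to0=\omega(0)$ as $s\downarrow0$. Measures: $\mathcal M(\Omega;\mathbb R^N)$ is the space of finite $\mathbb R^N$-valued Radon measures on $\Omega$; $\mu_j\overset{*}{\rightharpoonup}\mu$ means $\int\varphi\cdot d\mu_j\to\int\varphi\cdot d\mu$ for all $\varphi\in C_b(\Omega;\mathbb R^N)$. The area functional is $\langle\mu\rangle(A)=\int_A\sqrt{1+|\frac{d\mu}{d\mathcal L^d}|^2}\,dx+|\mu^s|(A)$. $\mu_j\to\mu$ area-strictly means $\mu_j\overset{*}{\rightharpoonup}\mu$ and $\langle\mu_j\rangle(\Omega)\to\langle\mu\rangle(\Omega)$. A function $u\in L^1$ is identified with the measure $u\mathcal L^d$. Operator: $\mathcal A$ is a linear partial differential operator of arbitrary order on $\Omega$, taking $\mathbb R^N$-valued fields to $\mathbb R^n$-valued ones, with coefficients such that $\mathcal A\mu$ is defined in the sense of distributions for $\mu\in\mathcal M(\Omega;\mathbb R^N)$. Put $W^{\mathcal A,1}(\Omega)=\{u\in L^1(\Omega;\mathbb R^N):\mathcal A u\in L^1(\Omega;\mathbb R^n)\}$ and $\ker\mathcal A=\{u\in L^1(\Omega;\mathbb R^N):\mathcal A u=0\}$.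 Assumptions: (H1) $\operatorname{Im}\mathcal A=\{\mathcal A u:u\in W^{\mathcal A,1}(\Omega)\}$ is strongly closed in $L^1(\Omega;\mathbb R^n)$; (H2) for every $\mu\in\mathcal M(\Omega;\mathbb R^N)$ with $\mathcal A\mu=0$ in the sense of distributions there is a sequence $(u_j)\subset L^1(\Omega;\mathbb R^N)\cap\ker\mathcal A$ with $u_j\to\mu$ area-strictly. $u_0\in W^{\mathcal A,1}(\Omega)$ is fixed.
   Formalization: If Ω has infinite Lebesgue measure, area-strict convergence in (H2) also requires convergence of the area minus L^d(Ω), i.e. of ∫(√(1+|dμ/dL^d|²)−1)dx+|μ^s|(Ω), since all areas are then infinite and the claim fails without it. *)

theory Defs
  imports "HOL-Analysis.Analysis"
begin

section \<open>Finite vector-valued Radon measures on an open set\<close>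

text \<open>Functions and measures on \<open>\<Omega>\<close> live on the Borel subsets of \<open>\<Omega>\<close>; an element of \<open>L\<^sup>1(\<Omega>)\<close> is
  given by a Borel representative, and its values outside \<open>\<Omega>\<close> are irrelevant.\<close>

abbreviation leb_on :: "'a::euclidean_space set \<Rightarrow> 'a measure" where
  "leb_on \<Omega> \<equiv> restrict_space lborel \<Omega>"

abbreviation borel_on :: "'a::euclidean_space set \<Rightarrow> 'a set set" where
  "borel_on \<Omega> \<equiv> sets (restrict_space borel \<Omega>)"

definition variation ::
    "'a::euclidean_space set \<Rightarrow> ('a set \<Rightarrow> 'b::euclidean_space) \<Rightarrow> 'a set \<Rightarrow> ennreal" where
  "variation \<Omega> \<mu> A =
     (SUP P \<in> {P :: nat \<Rightarrow> 'a set. range P \<subseteq> borel_on \<Omega> \<and> disjoint_family P \<and> (\<Union>i. P i) = A}.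
        \<Sum>i. ennreal (norm (\<mu> (P i))))"

text \<open>On an open subset of a Euclidean space every finite Borel measure is a Radon measure, so no
  separate regularity requirement appears. A vector measure is a set function; it is set to \<open>0\<close>
  on non-Borel sets so that equality of measures is equality of functions.\<close>

definition radon_measures ::
    "'a::euclidean_space set \<Rightarrow> ('a set \<Rightarrow> 'b::euclidean_space) set" where
  "radon_measures \<Omega> =
     {\<mu>. (\<forall>P :: nat \<Rightarrow> 'a set. range P \<subseteq> borel_on \<Omega> \<and> disjoint_family P \<longrightarrow>
              (\<lambda>i. \<mu> (P i)) sums \<mu> (\<Union>i. P i)) \<and>
         (\<forall>A. A \<notin> borel_on \<Omega> \<longrightarrow> \<mu> A = 0) \<and>
         variation \<Omega> \<mu> \<Omega> < \<infinity>}"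

definition tv :: "'a::euclidean_space set \<Rightarrow> ('a set \<Rightarrow> 'b::euclidean_space) \<Rightarrow> 'a measure" where
  "tv \<Omega> \<mu> = measure_of \<Omega> (borel_on \<Omega>) (variation \<Omega> \<mu>)"

text \<open>The Radon-Nikodym derivative of a vector measure with respect to a positive measure
  \<open>L\<close>. It is meaningful if \<open>\<mu>\<close> is absolutely continuous with respect to \<open>L\<close>, and is then determined
  \<open>L\<close>-almost everywhere.\<close>

definition vec_density ::
    "'a measure \<Rightarrow> ('a set \<Rightarrow> 'b::euclidean_space) \<Rightarrow> 'a \<Rightarrow> 'b" where
  "vec_density L \<mu> =
     (SOME g. integrable L g \<and> (\<forall>A\<in>sets L. \<mu> A = set_lebesgue_integral L A g))"

definition polar ::
    "'a::euclidean_space set \<Rightarrow> ('a set \<Rightarrow> 'b::euclidean_space) \<Rightarrow> 'a \<Rightarrow> 'b" where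
  "polar \<Omega> \<mu> = vec_density (tv \<Omega> \<mu>) \<mu>"

definition vec_integral ::
    "'a::euclidean_space set \<Rightarrow> ('a \<Rightarrow> 'b::euclidean_space) \<Rightarrow> ('a set \<Rightarrow> 'b) \<Rightarrow> real" where
  "vec_integral \<Omega> \<phi> \<mu> = (\<integral>x. \<phi> x \<bullet> polar \<Omega> \<mu> x \<partial>tv \<Omega> \<mu>)"

definition sing_part ::
    "'a::euclidean_space set \<Rightarrow> ('a set \<Rightarrow> 'b::euclidean_space) \<Rightarrow> 'a set \<Rightarrow> 'b" where
  "sing_part \<Omega> \<mu> =
     (THE \<nu>. \<nu> \<in> radon_measures \<Omega> \<and>
        (\<exists>N\<in>borel_on \<Omega>. emeasure lborel N = 0 \<and> (\<forall>A\<in>borel_on \<Omega>. \<nu> A = \<nu> (A \<inter> N))) \<and>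
        (\<forall>A\<in>borel_on \<Omega>. emeasure lborel A = 0 \<longrightarrow> \<mu> A - \<nu> A = 0))"

definition ac_density ::
    "'a::euclidean_space set \<Rightarrow> ('a set \<Rightarrow> 'b::euclidean_space) \<Rightarrow> 'a \<Rightarrow> 'b" where
  "ac_density \<Omega> \<mu> = vec_density (leb_on \<Omega>) (\<lambda>A. \<mu> A - sing_part \<Omega> \<mu> A)"

definition L1 :: "'a::euclidean_space set \<Rightarrow> ('a \<Rightarrow> 'b::euclidean_space) set" where
  "L1 \<Omega> = {u. integrable (leb_on \<Omega>) u}"

definition leb_measure ::
    "'a::euclidean_space set \<Rightarrow> ('a \<Rightarrow> 'b::euclidean_space) \<Rightarrow> 'a set \<Rightarrow> 'b" where
  "leb_measure \<Omega> u = (\<lambda>A. if A \<in> borel_on \<Omega> then set_lebesgue_integral (leb_on \<Omega>) A u else 0)"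


section \<open>Weak* and area-strict convergence\<close>

definition weak_star ::
    "'a::euclidean_space set \<Rightarrow> (nat \<Rightarrow> 'a set \<Rightarrow> 'b::euclidean_space) \<Rightarrow> ('a set \<Rightarrow> 'b) \<Rightarrow> bool" where
  "weak_star \<Omega> \<mu>s \<mu> \<longleftrightarrow>
     (\<forall>\<phi> :: 'a \<Rightarrow> 'b. continuous_on \<Omega> \<phi> \<and> bounded (\<phi> ` \<Omega>) \<longrightarrow>
        (\<lambda>j. vec_integral \<Omega> \<phi> (\<mu>s j)) \<longlonglongrightarrow> vec_integral \<Omega> \<phi> \<mu>)"

definition area ::
    "'a::euclidean_space set \<Rightarrow> ('a set \<Rightarrow> 'b::euclidean_space) \<Rightarrow> 'a set \<Rightarrow> ennreal" where
  "area \<Omega> \<mu> A =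
     (\<integral>\<^sup>+x\<in>A. ennreal (sqrt (1 + (norm (ac_density \<Omega> \<mu> x))\<^sup>2)) \<partial>leb_on \<Omega>)
     + emeasure (tv \<Omega> (sing_part \<Omega> \<mu>)) A"

text \<open>The area of \<open>\<Omega>\<close> under \<open>\<mu>\<close> minus the Lebesgue measure of \<open>\<Omega>\<close>, which is finite for every \<open>\<Omega>\<close>.\<close>

definition area_excess ::
    "'a::euclidean_space set \<Rightarrow> ('a set \<Rightarrow> 'b::euclidean_space) \<Rightarrow> ennreal" where
  "area_excess \<Omega> \<mu> =
     (\<integral>\<^sup>+x. ennreal (sqrt (1 + (norm (ac_density \<Omega> \<mu> x))\<^sup>2) - 1) \<partial>leb_on \<Omega>)
     + emeasure (tv \<Omega> (sing_part \<Omega> \<mu>)) \<Omega>"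

text \<open>If \<open>\<Omega>\<close> has infinite Lebesgue measure, every measure has infinite area and convergence of the
  areas says nothing; in that case the convergence is required after subtraction of the (common)
  infinite part. If \<open>\<Omega>\<close> has finite measure, the last clause is void.\<close>

definition area_strict ::
    "'a::euclidean_space set \<Rightarrow> (nat \<Rightarrow> 'a set \<Rightarrow> 'b::euclidean_space) \<Rightarrow> ('a set \<Rightarrow> 'b) \<Rightarrow> bool" where
  "area_strict \<Omega> \<mu>s \<mu> \<longleftrightarrow>
     weak_star \<Omega> \<mu>s \<mu> \<and>
     (\<lambda>j. area \<Omega> (\<mu>s j) \<Omega>) \<longlonglongrightarrow> area \<Omega> \<mu> \<Omega> \<and>
     (emeasure lborel \<Omega> = \<infinity> \<longrightarrow> (\<lambda>j. area_excess \<Omega> (\<mu>s j)) \<longlonglongrightarrow> area_excess \<Omega> \<mu>)"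


section \<open>Linear partial differential operators\<close>

text \<open>A derivative \<open>\<partial>\<^sup>\<alpha>\<close> is encoded by a word \<open>w\<close> of coordinate directions in which the index \<open>i\<close>
  occurs \<open>\<alpha> i\<close> times; its length is the order of the derivative.\<close>

definition partial_deriv ::
    "'d::finite \<Rightarrow> (real^'d \<Rightarrow> 'b::real_normed_vector) \<Rightarrow> real^'d \<Rightarrow> 'b" where
  "partial_deriv i f x = frechet_derivative f (at x) (axis i 1)"

primrec iter_deriv ::
    "'d::finite list \<Rightarrow> (real^'d \<Rightarrow> 'b::real_normed_vector) \<Rightarrow> real^'d \<Rightarrow> 'b" where
  "iter_deriv [] f = f"
| "iter_deriv (i # w) f = partial_deriv i (iter_deriv w f)"

definition test_functions ::
    "(real^'d::finite) set \<Rightarrow> (real^'d \<Rightarrow> real^'n::finite) set" where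
  "test_functions \<Omega> =
     {\<phi>. (\<forall>w x. iter_deriv w \<phi> differentiable (at x)) \<and>
         compact (closure {x. \<phi> x \<noteq> 0}) \<and> closure {x. \<phi> x \<noteq> 0} \<subseteq> \<Omega>}"

text \<open>An operator of order at most \<open>2 k\<close> is
  \<open>\<A> u = (\<Sum>v w. \<partial>\<^sub>v (A v w \<cdot> \<partial>\<^sub>w u))\<close> with \<open>v\<close>, \<open>w\<close> of length at most \<open>k\<close>. Taking
  \<open>A v w = 0\<close> unless \<open>v = []\<close> gives the operators \<open>\<Sum>w. A w \<cdot> \<partial>\<^sub>w u\<close> in nondivergence form, and taking
  \<open>A v w = 0\<close> unless \<open>w = []\<close> those in divergence form, both of arbitrary order as \<open>k\<close> is
  arbitrary.\<close>

type_synonym ('d, 'N, 'n) pdo_coeffs = "'d list \<Rightarrow> 'd list \<Rightarrow> real^'d \<Rightarrow> real^'N^'n"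

definition words :: "nat \<Rightarrow> 'd list set" where
  "words k = {w. length w \<le> k}"

text \<open>\<open>\<A> \<mu>\<close> is defined in the sense of distributions for all finite measures \<open>\<mu>\<close> when the derivatives
  of \<open>A v w\<close> up to the order \<open>length w\<close> exist everywhere and are Borel and locally bounded. This
  includes \<open>A v w\<close> of class \<open>C\<^sup>m\<close> with \<open>m = length w\<close>, and in particular smooth or constant
  coefficients.\<close>

definition admissible_coeffs ::
    "(real^'d::finite) set \<Rightarrow> nat \<Rightarrow> ('d, 'N::finite, 'n::finite) pdo_coeffs \<Rightarrow> bool" where
  "admissible_coeffs \<Omega> k A \<longleftrightarrow>
     (\<forall>v\<in>words k. \<forall>w\<in>words k. \<forall>r.
        (length r < length w \<longrightarrow> (\<forall>x\<in>\<Omega>. iter_deriv r (A v w) differentiable (at x))) \<and>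
        (length r \<le> length w \<longrightarrow>
           iter_deriv r (A v w) \<in> borel_measurable (restrict_space borel \<Omega>) \<and>
           (\<forall>K. compact K \<and> K \<subseteq> \<Omega> \<longrightarrow> bounded (iter_deriv r (A v w) ` K))))"

definition formal_adjoint ::
    "nat \<Rightarrow> ('d::finite, 'N::finite, 'n::finite) pdo_coeffs \<Rightarrow> (real^'d \<Rightarrow> real^'n) \<Rightarrow> real^'d \<Rightarrow> real^'N"
  where
  "formal_adjoint k A \<phi> x =
     (\<Sum>v\<in>words k. \<Sum>w\<in>words k. (-1) ^ (length v + length w) *\<^sub>R
        iter_deriv w (\<lambda>y. transpose (A v w y) *v iter_deriv v \<phi> y) x)"

definition pdo_dist ::
    "(real^'d::finite) set \<Rightarrow> nat \<Rightarrow> ('d, 'N::finite, 'n::finite) pdo_coeffs \<Rightarrow>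
     ((real^'d) set \<Rightarrow> real^'N) \<Rightarrow> (real^'d \<Rightarrow> real^'n) \<Rightarrow> real" where
  "pdo_dist \<Omega> k A \<mu> \<phi> = vec_integral \<Omega> (formal_adjoint k A \<phi>) \<mu>"

definition pdo_eq ::
    "(real^'d::finite) set \<Rightarrow> nat \<Rightarrow> ('d, 'N::finite, 'n::finite) pdo_coeffs \<Rightarrow>
     (real^'d \<Rightarrow> real^'N) \<Rightarrow> (real^'d \<Rightarrow> real^'n) \<Rightarrow> bool" where
  "pdo_eq \<Omega> k A u v \<longleftrightarrow>
     (\<forall>\<phi>\<in>test_functions \<Omega>. pdo_dist \<Omega> k A (leb_measure \<Omega> u) \<phi> = (\<integral>x. v x \<bullet> \<phi> x \<partial>leb_on \<Omega>))"

definition WA1 ::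
    "(real^'d::finite) set \<Rightarrow> nat \<Rightarrow> ('d, 'N::finite, 'n::finite) pdo_coeffs \<Rightarrow>
     (real^'d \<Rightarrow> real^'N) set" where
  "WA1 \<Omega> k A = {u \<in> L1 \<Omega>. \<exists>v\<in>L1 \<Omega>. pdo_eq \<Omega> k A u v}"

definition im_pdo ::
    "(real^'d::finite) set \<Rightarrow> nat \<Rightarrow> ('d, 'N::finite, 'n::finite) pdo_coeffs \<Rightarrow>
     (real^'d \<Rightarrow> real^'n) set" where
  "im_pdo \<Omega> k A = {v \<in> L1 \<Omega>. \<exists>u\<in>WA1 \<Omega> k A. pdo_eq \<Omega> k A u v}"

definition ker_meas ::
    "(real^'d::finite) set \<Rightarrow> nat \<Rightarrow> ('d, 'N::finite, 'n::finite) pdo_coeffs \<Rightarrow>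
     ((real^'d) set \<Rightarrow> real^'N) set" where
  "ker_meas \<Omega> k A = {\<mu> \<in> radon_measures \<Omega>. \<forall>\<phi>\<in>test_functions \<Omega>. pdo_dist \<Omega> k A \<mu> \<phi> = 0}"

definition ker_L1 ::
    "(real^'d::finite) set \<Rightarrow> nat \<Rightarrow> ('d, 'N::finite, 'n::finite) pdo_coeffs \<Rightarrow>
     (real^'d \<Rightarrow> real^'N) set" where
  "ker_L1 \<Omega> k A = {u \<in> L1 \<Omega>. pdo_eq \<Omega> k A u (\<lambda>x. 0)}"

definition L1_closed :: "'a::euclidean_space set \<Rightarrow> ('a \<Rightarrow> 'b::euclidean_space) set \<Rightarrow> bool" where
  "L1_closed \<Omega> S \<longleftrightarrow>
     (\<forall>vs v. (\<forall>j::nat. vs j \<in> S) \<and> v \<in> L1 \<Omega> \<and>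
        (\<lambda>j. \<integral>x. norm (vs j x - v x) \<partial>leb_on \<Omega>) \<longlonglongrightarrow> 0 \<longrightarrow> v \<in> S)"


section \<open>Integrands and relaxation\<close>

definition modulus_of_continuity :: "(real \<Rightarrow> real) \<Rightarrow> bool" where
  "modulus_of_continuity \<omega> \<longleftrightarrow> (\<forall>s\<ge>0. \<omega> s \<ge> 0) \<and> \<omega> 0 = 0 \<and> (\<omega> \<longlongrightarrow> 0) (at_right 0)"

definition recession :: "('a::euclidean_space \<Rightarrow> 'b::euclidean_space \<Rightarrow> real) \<Rightarrow> 'a \<Rightarrow> 'b \<Rightarrow> real" where
  "recession f x z = Lim (nhds x \<times>\<^sub>F at_top) (\<lambda>(x', t). f x' (t *\<^sub>R z) / t)"

definition functional ::
    "'a::euclidean_space set \<Rightarrow> ('a \<Rightarrow> 'b::euclidean_space \<Rightarrow> real) \<Rightarrow> ('a \<Rightarrow> 'b) \<Rightarrow> ennreal" where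
  "functional \<Omega> f u = (\<integral>\<^sup>+x. ennreal (f x (u x)) \<partial>leb_on \<Omega>)"

definition relaxation ::
    "(real^'d::finite) set \<Rightarrow> nat \<Rightarrow> ('d, 'N::finite, 'n::finite) pdo_coeffs \<Rightarrow>
     (real^'d \<Rightarrow> real^'N) \<Rightarrow> (real^'d \<Rightarrow> real^'N \<Rightarrow> real) \<Rightarrow> ((real^'d) set \<Rightarrow> real^'N) \<Rightarrow> ennreal" where
  "relaxation \<Omega> k A u\<^sub>0 f \<mu> =
     Inf {liminf (\<lambda>j. functional \<Omega> f (u j)) | u :: nat \<Rightarrow> real^'d \<Rightarrow> real^'N.
            (\<forall>j. \<exists>v\<in>ker_L1 \<Omega> k A. u j = (\<lambda>x. u\<^sub>0 x + v x)) \<and>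
            weak_star \<Omega> (\<lambda>j. leb_measure \<Omega> (u j)) \<mu>}"

end

theory Submission
  imports Defs
begin

text \<open>The recovery sequence is \<open>u\<^sub>0 + v\<^sub>j\<close>, where \<open>v\<^sub>j\<close> in the kernel of the operator converges
  area-strictly to \<open>\<nu> = \<mu> - u\<^sub>0\<close>.

  Lower bound: by convexity and coercivity, \<open>f\<close> is the supremum of countably many functions
  \<open>\<alpha> x + \<beta> x \<bullet> z\<close> with continuous \<open>\<alpha>\<close>, \<open>\<beta>\<close>, and the functions \<open>\<beta> x \<bullet> z\<close> then have supremum \<open>f\<^sup>\<infinity>\<close>.
  Such affine integrands pass to the weak* limit, and they are closed under continuous convex
  combinations, which approximate the pointwise maximum of finitely many of them in \<open>L\<^sup>1\<close>.

  Upper bound: let \<open>E z = sqrt (1 + (norm z)\<^sup>2)\<close>. For small \<open>\<eta>\<close> and large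
  \<open>C\<close>, the integrand \<open>(C + \<eta>) E - f\<close> lies above the multiples \<open>C - f x y / E y\<close> of the tangents of \<open>E\<close>
  at all points \<open>y\<close>, whose supremum is at least \<open>C E - f\<close>. The same lower semicontinuity argument
  together with the convergence of the areas bounds the integrals of \<open>f\<close> from above. The function
  \<open>u\<^sub>0\<close> is replaced by a continuous one. Away from a compact subset of \<open>\<Omega>\<close> a gliding hump argument
  shows that the \<open>v\<^sub>j\<close> carry little mass; this is what handles sets \<open>\<Omega>\<close> of infinite measure, where the
  area does not control small values of \<open>v\<^sub>j\<close>.\<close>

section \<open>The total variation measure\<close>

text \<open>The upper bound is a continuity theorem of Reshetnyak type. The obstacle is that
  \<open>(C + \<eta>) E - f\<close> need not be convex, hence need not be a supremum of affine
  functions. Homogeneity helps: send \<open>z\<close> to the point \<open>(z, 1) / E z\<close> of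
  the unit upper hemisphere. There \<open>f / E\<close> becomes a function that extends continuously
  to the equator by \<open>f\<^sup>\<infinity>\<close>, and the tangent of \<open>E\<close> at
  \<open>y\<close>, divided by \<open>E z\<close>, becomes the cosine of the angle between the
  points of \<open>y\<close> and \<open>z\<close>. By compactness, nearby points change
  \<open>f / E\<close> by less than \<eta>; at distant points the loss of cosine, multiplied by
  \<open>C\<close>, outweighs any oscillation of \<open>f / E\<close>. The minorants stay below one
  integrand and reach only a slightly smaller one; the gap \<open>\<eta> E\<close> matters only
  where the cutoff lives, and there the limit has finite area.

  Infinite measure dictates the rest. Constants are not integrable, so minorants get cut-off offsets
  and \<open>E - 1\<close> replaces \<open>E\<close> away from the compact set. There
  \<open>f\<close> is compared, by its Lipschitz constant, with its value at the limit density, as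
  \<open>f x 0\<close> need not be integrable.\<close>

lemma sigma_algebra_borel_on: "sigma_algebra \<Omega> (borel_on \<Omega>)"
  using sets.sigma_algebra_axioms[of "restrict_space borel \<Omega>"] by (simp add: space_restrict_space)

lemma borel_on_subset: "A \<in> borel_on \<Omega> \<Longrightarrow> A \<subseteq> \<Omega>"
  using sets.sets_into_space[of A "restrict_space borel \<Omega>"] by (simp add: space_restrict_space)

lemma top_in_borel_on: "\<Omega> \<in> borel_on \<Omega>"
  using sets.top[of "restrict_space borel \<Omega>"] by (simp add: space_restrict_space)

lemma sets_leb_on: "sets (leb_on \<Omega>) = borel_on \<Omega>"
  by (simp add: sets_restrict_space)

lemma space_leb_on: "space (leb_on \<Omega>) = \<Omega>"
  by (simp add: space_restrict_space)

lemma radon_sums: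
  assumes "\<mu> \<in> radon_measures \<Omega>" "range P \<subseteq> borel_on \<Omega>" "disjoint_family P"
  shows "(\<lambda>i. \<mu> (P i)) sums \<mu> (\<Union>i. P i)"
  using assms by (simp add: radon_measures_def)

lemma radon_notin: "\<mu> \<in> radon_measures \<Omega> \<Longrightarrow> A \<notin> borel_on \<Omega> \<Longrightarrow> \<mu> A = 0"
  by (simp add: radon_measures_def)

text \<open>A convergent series of constant terms has term 0. Only additivity is assumed, so that
  the lemma also serves \<open>Radon_Nikodym_vector\<close>, whose set function need not lie in
  \<open>radon_measures\<close>.\<close>

lemma countably_additive_empty:
  assumes "\<And>P. range P \<subseteq> borel_on \<Omega> \<Longrightarrow> disjoint_family P \<Longrightarrow> (\<lambda>i. \<mu> (P i)) sums \<mu> (\<Union>i. P i :: 'a::euclidean_space set)"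
  shows "\<mu> {} = (0::'b::euclidean_space)"
proof -
  have "(\<lambda>i::nat. \<mu> {}) sums \<mu> (\<Union>i::nat. {})"
    by (rule assms) (auto simp: disjoint_family_on_def)
  then have "(\<lambda>i::nat. \<mu> {}) \<longlonglongrightarrow> 0" by (auto dest: sums_summable summable_LIMSEQ_zero)
  then show ?thesis by (simp add: LIMSEQ_const_iff)
qed

lemma radon_empty: "\<mu> \<in> radon_measures \<Omega> \<Longrightarrow> \<mu> {} = 0"
  by (rule countably_additive_empty[of \<Omega>]) (rule radon_sums)

lemma radon_add:
  assumes "\<mu> \<in> radon_measures \<Omega>" "A \<in> borel_on \<Omega>" "B \<in> borel_on \<Omega>" "A \<inter> B = {}"
  shows "\<mu> (A \<union> B) = \<mu> A + \<mu> B"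
proof -
  have "(\<lambda>i. \<mu> (binaryset A B i)) sums \<mu> (\<Union>i. binaryset A B i)"
    using assms by (intro radon_sums[OF assms(1)])
      (auto simp: binaryset_def disjoint_family_on_def split: if_splits)
  moreover have "(\<lambda>i. \<mu> (binaryset A B i)) sums (\<mu> A + \<mu> B)"
    using radon_empty[OF assms(1)] by (intro binaryset_sums) auto
  ultimately show ?thesis by (simp add: UN_binaryset_eq sums_unique2)
qed

lemma variation_upper:
  assumes "range P \<subseteq> borel_on \<Omega>" "disjoint_family P" "(\<Union>i. P i) = A"
  shows "(\<Sum>i. ennreal (norm (\<mu> (P i)))) \<le> variation \<Omega> \<mu> A"
  unfolding variation_def using assms by (intro SUP_upper) auto

lemma norm_le_variation:
  assumes "\<mu> \<in> radon_measures \<Omega>" "A \<in> borel_on \<Omega>"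
  shows "ennreal (norm (\<mu> A)) \<le> variation \<Omega> \<mu> A"
proof -
  have "(\<lambda>i. ennreal (norm (\<mu> (binaryset A {} i)))) sums (ennreal (norm (\<mu> A)) + ennreal (norm (\<mu> {})))"
    by (rule binaryset_sums) (simp add: radon_empty[OF assms(1)])
  then have "(\<Sum>i. ennreal (norm (\<mu> (binaryset A {} i)))) = ennreal (norm (\<mu> A))"
    by (simp add: sums_iff radon_empty[OF assms(1)])
  moreover have "(\<Sum>i. ennreal (norm (\<mu> (binaryset A {} i)))) \<le> variation \<Omega> \<mu> A"
    using assms(2) by (intro variation_upper)
      (auto simp: binaryset_def disjoint_family_on_def UN_binaryset_eq split: if_splits)
  ultimately show ?thesis by simp
qed

lemma variation_mono:
  assumes "\<mu> \<in> radon_measures \<Omega>" "A \<in> borel_on \<Omega>" "B \<in> borel_on \<Omega>" "A \<subseteq> B"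
  shows "variation \<Omega> \<mu> A \<le> variation \<Omega> \<mu> B"
  unfolding variation_def[of _ _ A]
proof (rule SUP_least, clarsimp)
  interpret sigma_algebra \<Omega> "borel_on \<Omega>" by (rule sigma_algebra_borel_on)
  fix P :: "nat \<Rightarrow> 'a set" assume P: "range P \<subseteq> borel_on \<Omega>" "disjoint_family P" and A: "A = (\<Union>i. P i)"
  \<comment> \<open>Prepending \<open>B - A\<close> to a partition of \<open>A\<close> partitions
    \<open>B\<close>, and the extra term only enlarges the sum.\<close>
  define Q where "Q i = (case i of 0 \<Rightarrow> B - A | Suc j \<Rightarrow> P j)" for i
  have "(\<Sum>i. ennreal (norm (\<mu> (Q i)))) = ennreal (norm (\<mu> (Q 0))) + (\<Sum>i. ennreal (norm (\<mu> (Q (Suc i)))))"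
    by (subst suminf_offset[of _ 1]) auto
  then have "(\<Sum>i. ennreal (norm (\<mu> (P i)))) \<le> (\<Sum>i. ennreal (norm (\<mu> (Q i))))"
    by (simp add: Q_def)
  also have "\<dots> \<le> variation \<Omega> \<mu> B"
  proof (rule variation_upper)
    have "Q i \<in> borel_on \<Omega>" for i
    proof (cases i)
      case 0 then show ?thesis using assms by (simp add: Q_def Diff)
    next
      case (Suc j) then show ?thesis using P(1) by (auto simp: Q_def)
    qed
    then show "range Q \<subseteq> borel_on \<Omega>" by blast
    show "disjoint_family Q"
    proof -
      have "Q m \<inter> Q n = {}" if "m < n" for m n
      proof -
        have "n = Suc (n - 1)" using that by simp
        then obtain j where n: "n = Suc j" by blast
        show ?thesis
        proof (cases m)
          case 0
          then show ?thesis using n A by (auto simp: Q_def)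
        next
          case (Suc i)
          then have "P i \<inter> P j = {}" using P(2) that n by (auto simp: disjoint_family_on_def)
          then show ?thesis using n Suc by (simp add: Q_def)
        qed
      qed
      then show ?thesis unfolding disjoint_family_on_def 
      proof clarify
        fix m n :: nat assume "m \<noteq> n"
        then show "Q m \<inter> Q n = {}"
        proof (cases "m < n")
          case True then show ?thesis by (rule \<open>\<And>m n. m < n \<Longrightarrow> Q m \<inter> Q n = {}\<close>)
        next
          case False
          with \<open>m \<noteq> n\<close> have "n < m" by simp
          then have "Q n \<inter> Q m = {}" by (rule \<open>\<And>m n. m < n \<Longrightarrow> Q m \<inter> Q n = {}\<close>)
          then show ?thesis by blast
        qed
      qed
    qed
    show "(\<Union>i. Q i) = B"
    proof
      show "(\<Union>i. Q i) \<subseteq> B" 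
      proof (rule UN_least)
        fix i
        show "Q i \<subseteq> B" using A assms(4) by (cases i) (auto simp: Q_def)
      qed
      show "B \<subseteq> (\<Union>i. Q i)"
      proof
        fix x assume "x \<in> B"
        show "x \<in> (\<Union>i. Q i)"
        proof (cases "x \<in> A")
          case True
          then obtain j where "x \<in> P j" using A by blast
          then have "x \<in> Q (Suc j)" by (simp add: Q_def)
          then show ?thesis by blast
        next
          case False
          then have "x \<in> Q 0" using \<open>x \<in> B\<close> by (simp add: Q_def)
          then show ?thesis by blast
        qed
      qed
    qed
  qed
  finally show "(\<Sum>i. ennreal (norm (\<mu> (P i)))) \<le> variation \<Omega> \<mu> B" .
qed

lemma norm_le_suminf_ennreal:
  fixes f :: "nat \<Rightarrow> 'b::real_normed_vector"
  assumes "f sums s"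
  shows "ennreal (norm s) \<le> (\<Sum>i. ennreal (norm (f i)))"
proof (rule LIMSEQ_le_const2)
  show "(\<lambda>n. ennreal (norm (\<Sum>i<n. f i))) \<longlonglongrightarrow> ennreal (norm s)"
    using assms unfolding sums_def by (intro tendsto_intros) 
  have "ennreal (norm (\<Sum>i<n. f i)) \<le> (\<Sum>i. ennreal (norm (f i)))" for n
  proof -
    have "ennreal (norm (\<Sum>i<n. f i)) \<le> ennreal (\<Sum>i<n. norm (f i))" by (intro ennreal_leI norm_sum)
    also have "\<dots> = (\<Sum>i<n. ennreal (norm (f i)))" by simp
    also have "\<dots> \<le> (\<Sum>i. ennreal (norm (f i)))" by (intro sum_le_suminf) auto
    finally show ?thesis .
  qed
  then show "\<exists>N. \<forall>n\<ge>N. ennreal (norm (\<Sum>i<n. f i)) \<le> (\<Sum>i. ennreal (norm (f i)))" by blast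
qed

lemma ennreal_suminf_swap:
  fixes f :: "nat \<Rightarrow> nat \<Rightarrow> ennreal"
  shows "(\<Sum>i. \<Sum>j. f i j) = (\<Sum>j. \<Sum>i. f i j)"
  using nn_integral_suminf[of "\<lambda>i j. f i j" "count_space UNIV"]
  by (simp add: nn_integral_count_space_nat)

text \<open>Serves to merge a sequence of partitions, one for each \<open>A i\<close>, into a single
  partition of the union.\<close>

lemma suminf_double_encode:
  fixes f :: "nat \<Rightarrow> nat \<Rightarrow> ennreal"
  shows "(\<Sum>i. \<Sum>j. f i j) = (\<Sum>n. case prod_decode n of (i, j) \<Rightarrow> f i j)"
  using suminf_ennreal_2dimen[of "\<lambda>n. \<Sum>j. f n j" "\<lambda>(i,j). f i j"] by (simp add: case_prod_beta comp_def)

text \<open>Both inequalities compare partitions. A partition of the union is refined by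
  intersecting it with every \<open>A i\<close>, and the order of summation is exchanged;
  conversely, nearly optimal partitions of the \<open>A i\<close> with errors
  \<open>e / 2^(i+1)\<close> are merged into one partition of the union.\<close>

lemma variation_countably_additive:
  assumes \<mu>: "\<mu> \<in> radon_measures \<Omega>"
  shows "countably_additive (borel_on \<Omega>) (variation \<Omega> \<mu>)"
proof (rule countably_additiveI)
  interpret sigma_algebra \<Omega> "borel_on \<Omega>" by (rule sigma_algebra_borel_on)
  fix A :: "nat \<Rightarrow> 'a set"
  assume A: "range A \<subseteq> borel_on \<Omega>" and dA: "disjoint_family A" and "(\<Union>i. A i) \<in> borel_on \<Omega>"
  show "(\<Sum>i. variation \<Omega> \<mu> (A i)) = variation \<Omega> \<mu> (\<Union>i. A i)"
  proof (rule antisym)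
    show "variation \<Omega> \<mu> (\<Union>i. A i) \<le> (\<Sum>i. variation \<Omega> \<mu> (A i))"
      unfolding variation_def[of _ _ "\<Union>i. A i"]
    proof (rule SUP_least, clarsimp)
      fix P :: "nat \<Rightarrow> 'a set" assume P: "range P \<subseteq> borel_on \<Omega>" "disjoint_family P" and U: "(\<Union>i. P i) = (\<Union>i. A i)"
      have PA: "P n \<inter> A i \<in> borel_on \<Omega>" for n i using A P by (intro Int) auto
      have "(\<lambda>i. \<mu> (P n \<inter> A i)) sums \<mu> (P n)" for n
      proof -
        have "(\<Union>i. P n \<inter> A i) = P n"
        proof -
          have "P n \<subseteq> (\<Union>i. A i)" unfolding U[symmetric] by blast
          then show ?thesis by blast
        qed
        moreover have "(\<lambda>i. \<mu> (P n \<inter> A i)) sums \<mu> (\<Union>i. P n \<inter> A i)"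
        proof (rule radon_sums[OF \<mu>])
          show "range (\<lambda>i. P n \<inter> A i) \<subseteq> borel_on \<Omega>" using PA by auto
          show "disjoint_family (\<lambda>i. P n \<inter> A i)" unfolding disjoint_family_on_def
          proof clarify
            fix i j :: nat assume "i \<noteq> j"
            then have "A i \<inter> A j = {}" using dA by (simp add: disjoint_family_on_def)
            then show "P n \<inter> A i \<inter> (P n \<inter> A j) = {}" by blast
          qed
        qed
        ultimately show ?thesis by simp
      qed
      then have "(\<Sum>n. ennreal (norm (\<mu> (P n)))) \<le> (\<Sum>n. \<Sum>i. ennreal (norm (\<mu> (P n \<inter> A i))))"
        by (intro suminf_le norm_le_suminf_ennreal) auto
      also have "\<dots> = (\<Sum>i. \<Sum>n. ennreal (norm (\<mu> (P n \<inter> A i))))" by (rule ennreal_suminf_swap)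
      also have "\<dots> \<le> (\<Sum>i. variation \<Omega> \<mu> (A i))"
      proof (intro suminf_le variation_upper)
        fix i
        show "range (\<lambda>n. P n \<inter> A i) \<subseteq> borel_on \<Omega>" using PA by auto
        show "disjoint_family (\<lambda>n. P n \<inter> A i)" using P(2) by (auto simp: disjoint_family_on_def)
        have "A i \<subseteq> (\<Union>n. P n)" unfolding U by blast
        then show "(\<Union>n. P n \<inter> A i) = A i" by blast
      qed auto
      finally show "(\<Sum>i. ennreal (norm (\<mu> (P i)))) \<le> (\<Sum>i. variation \<Omega> \<mu> (A i))" .
    qed
    show "(\<Sum>i. variation \<Omega> \<mu> (A i)) \<le> variation \<Omega> \<mu> (\<Union>i. A i)"
    proof (rule ennreal_le_epsilon)
      fix e :: real assume "0 < e"
      \<comment> \<open>Finiteness is what allows a supremum to be attained up to a positive error;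
        here bounded total variation enters.\<close>
      have fin: "variation \<Omega> \<mu> (A i) \<noteq> \<infinity>" for i
      proof -
        have "variation \<Omega> \<mu> (A i) \<le> variation \<Omega> \<mu> \<Omega>"
          using A by (intro variation_mono[OF \<mu>]) (auto simp: top_in_borel_on dest: borel_on_subset)
        also have "\<dots> < \<infinity>" using \<mu> by (simp add: radon_measures_def)
        finally show ?thesis by simp
      qed
      define good where "good i P \<longleftrightarrow> range P \<subseteq> borel_on \<Omega> \<and> disjoint_family P \<and> (\<Union>n. P n) = A i \<and>
          variation \<Omega> \<mu> (A i) < (\<Sum>n. ennreal (norm (\<mu> (P n)))) + ennreal (e * (1/2)^Suc i)" for i and P :: "nat \<Rightarrow> 'a set"
      have "\<exists>P. good i P" for i
      proof -
        let ?S = "{P. range P \<subseteq> borel_on \<Omega> \<and> disjoint_family P \<and> (\<Union>n::nat. P n) = A i}"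
        have "binaryset (A i) {} \<in> ?S"
          using A by (auto simp: binaryset_def disjoint_family_on_def split: if_splits)
        then have ne: "?S \<noteq> {}" by blast
        have e: "0 < e * (1/2)^Suc i" using \<open>0 < e\<close> by simp
        show ?thesis
          using SUP_approx_ennreal[OF e ne variation_def fin] unfolding good_def by blast
      qed
      then obtain P where "\<And>i. good i (P i)" by metis
      then have P: "range (P i) \<subseteq> borel_on \<Omega>" "disjoint_family (P i)" "(\<Union>n. P i n) = A i"
          "variation \<Omega> \<mu> (A i) \<le> (\<Sum>n. ennreal (norm (\<mu> (P i n)))) + ennreal (e * (1/2)^Suc i)" for i
        unfolding good_def by (blast, blast, blast, blast intro: less_imp_le)
      have "(\<Sum>i. variation \<Omega> \<mu> (A i)) \<le> (\<Sum>i. (\<Sum>n. ennreal (norm (\<mu> (P i n)))) + ennreal (e * (1/2)^Suc i))"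
        using P(4) by (intro suminf_le) auto
      also have "\<dots> = (\<Sum>i. \<Sum>n. ennreal (norm (\<mu> (P i n)))) + (\<Sum>i. ennreal (e * (1/2)^Suc i))"
        by (simp add: suminf_add)
      also have "(\<Sum>i. ennreal (e * (1/2)^Suc i)) = ennreal e"
        using sums_mult[OF power_half_series, of e] \<open>0 < e\<close> by (intro suminf_ennreal_eq) auto
      also have "(\<Sum>i. \<Sum>n. ennreal (norm (\<mu> (P i n)))) \<le> variation \<Omega> \<mu> (\<Union>i. A i)"
      proof -
        have "(\<Sum>i. \<Sum>n. ennreal (norm (\<mu> (P i n))))
            = (\<Sum>m. ennreal (norm (\<mu> (case prod_decode m of (i, n) \<Rightarrow> P i n))))"
          by (subst suminf_double_encode) (simp add: case_prod_beta)
        also have "\<dots> \<le> variation \<Omega> \<mu> (\<Union>i. A i)"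
        proof (rule variation_upper)
          show "range (\<lambda>m. case prod_decode m of (i, n) \<Rightarrow> P i n) \<subseteq> borel_on \<Omega>"
            using P(1) by (auto simp: case_prod_beta)
          have disj: "P i n \<inter> P i' n' = {}" if "(i, n) \<noteq> (i', n')" for i n i' n'
          proof (cases "i = i'")
            case True then show ?thesis using P(2)[of i] that by (auto simp: disjoint_family_on_def)
          next
            case False
            then have "A i \<inter> A i' = {}" using dA by (auto simp: disjoint_family_on_def)
            then show ?thesis using P(3)[of i] P(3)[of i'] by blast
          qed
          then show "disjoint_family (\<lambda>m. case prod_decode m of (i, n) \<Rightarrow> P i n)"
            unfolding disjoint_family_on_def
          proof clarify
            fix m m' :: nat assume "m \<noteq> m'"
            then have "(fst (prod_decode m), snd (prod_decode m)) \<noteq> (fst (prod_decode m'), snd (prod_decode m'))"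
              by (simp add: prod_decode_eq)
            from disj[OF this]
            show "(case prod_decode m of (i, n) \<Rightarrow> P i n) \<inter> (case prod_decode m' of (i, n) \<Rightarrow> P i n) = {}"
              by (simp add: case_prod_beta)
          qed
          show "(\<Union>m. case prod_decode m of (i, n) \<Rightarrow> P i n) = (\<Union>i. A i)"
          proof
            show "(\<Union>m. case prod_decode m of (i, n) \<Rightarrow> P i n) \<subseteq> (\<Union>i. A i)"
            proof (rule UN_least)
              fix m
              have "P (fst (prod_decode m)) (snd (prod_decode m)) \<subseteq> A (fst (prod_decode m))"
                using P(3)[of "fst (prod_decode m)"] by blast
              then show "(case prod_decode m of (i, n) \<Rightarrow> P i n) \<subseteq> (\<Union>i. A i)"
                by (auto simp: case_prod_beta)
            qed
            show "(\<Union>i. A i) \<subseteq> (\<Union>m. case prod_decode m of (i, n) \<Rightarrow> P i n)"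
            proof
              fix x assume "x \<in> (\<Union>i. A i)"
              then obtain i n where "x \<in> P i n" using P(3) by blast
              then have "x \<in> (case prod_decode (prod_encode (i, n)) of (i, n) \<Rightarrow> P i n)" by simp
              then show "x \<in> (\<Union>m. case prod_decode m of (i, n) \<Rightarrow> P i n)" by (rule UN_I[OF UNIV_I])
            qed
          qed
        qed
        finally show ?thesis .
      qed
      finally show "(\<Sum>i. variation \<Omega> \<mu> (A i)) \<le> variation \<Omega> \<mu> (\<Union>i. A i) + ennreal e" by (simp add: add_mono)
    qed
  qed
qed

lemma sets_tv: "sets (tv \<Omega> \<mu>) = borel_on \<Omega>"
proof -
  interpret sigma_algebra \<Omega> "borel_on \<Omega>" by (rule sigma_algebra_borel_on)
  show ?thesis by (simp add: tv_def sets_measure_of space_closed sigma_sets_eq)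
qed

lemma space_tv: "space (tv \<Omega> \<mu>) = \<Omega>"
  using borel_on_subset by (auto simp: tv_def space_measure_of_conv)

text \<open>\<open>measure_of\<close> keeps the given set function only if it is positive and
  countably additive; otherwise \<open>tv\<close> would be the null measure.\<close>

lemma emeasure_tv:
  assumes "\<mu> \<in> radon_measures \<Omega>" "A \<in> borel_on \<Omega>"
  shows "emeasure (tv \<Omega> \<mu>) A = variation \<Omega> \<mu> A"
proof -
  interpret sigma_algebra \<Omega> "borel_on \<Omega>" by (rule sigma_algebra_borel_on)
  have "variation \<Omega> \<mu> {} = 0"
    unfolding variation_def
    by (rule antisym, rule SUP_least) (auto simp: radon_empty[OF assms(1)])
  then show ?thesis
    unfolding tv_def using variation_countably_additive[OF assms(1)] assms(2)
    by (intro emeasure_measure_of_sigma sigma_algebra_axioms) (auto simp: positive_def)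
qed

lemma finite_tv:
  assumes "\<mu> \<in> radon_measures \<Omega>"
  shows "finite_measure (tv \<Omega> \<mu>)"
  using assms by (intro finite_measureI) (auto simp: space_tv emeasure_tv top_in_borel_on radon_measures_def)

lemma norm_le_tv:
  assumes "\<mu> \<in> radon_measures \<Omega>" "A \<in> borel_on \<Omega>"
  shows "norm (\<mu> A) \<le> measure (tv \<Omega> \<mu>) A"
  using norm_le_variation[OF assms] finite_measure.emeasure_eq_measure[OF finite_tv[OF assms(1)], of A]
  by (simp add: emeasure_tv[OF assms, symmetric])

section \<open>Polar decomposition\<close>

lemma set_integrable_of_integrable:
  fixes g :: "'a \<Rightarrow> 'b::{banach, second_countable_topology}"
  assumes "integrable L g" "A \<in> sets L"
  shows "set_integrable L A g"
  unfolding set_integrable_def using integrable_mult_indicator[OF assms(2,1)] .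

lemma set_integral_sums:
  fixes g :: "'a \<Rightarrow> 'b::{banach, second_countable_topology}"
  assumes g: "integrable L g" and P: "range P \<subseteq> sets L" and d: "disjoint_family P"
  shows "(\<lambda>i::nat. set_lebesgue_integral L (P i) g) sums set_lebesgue_integral L (\<Union>i. P i) g"
proof -
  have Pi: "P i \<in> sets L" for i using P by blast
  have "(\<Sum>i<n. set_lebesgue_integral L (P i) g) = set_lebesgue_integral L (\<Union>i<n. P i) g" for n
    using d Pi by (intro set_integral_finite_Union[symmetric] set_integrable_of_integrable g)
      (auto simp: disjoint_family_on_def)
  moreover have "(\<lambda>n. set_lebesgue_integral L (\<Union>i<n. P i) g) \<longlonglongrightarrow> set_lebesgue_integral L (\<Union>n. \<Union>i<n. P i) g"
  proof (intro set_integral_cont_up set_integrable_of_integrable g)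
    show "incseq (\<lambda>n. \<Union>i<n. P i)" by (intro monoI UN_mono) auto
  qed (use Pi in auto)
  moreover have "(\<Union>n. \<Union>i<n. P i) = (\<Union>i. P i)" by auto
  ultimately show ?thesis by (simp add: sums_def)
qed

lemma norm_set_integral_le:
  fixes g :: "'a \<Rightarrow> 'b::{banach, second_countable_topology}"
  assumes "integrable L g" "A \<in> sets L"
  shows "ennreal (norm (set_lebesgue_integral L A g)) \<le> (\<integral>\<^sup>+x\<in>A. ennreal (norm (g x)) \<partial>L)"
proof -
  have "ennreal (norm (set_lebesgue_integral L A g)) \<le> (\<integral>\<^sup>+x. ennreal (norm (indicator A x *\<^sub>R g x)) \<partial>L)"
    unfolding set_lebesgue_integral_def
    using integrable_mult_indicator[OF assms(2,1)] by (rule integral_norm_bound_ennreal)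
  also have "\<dots> = (\<integral>\<^sup>+x\<in>A. ennreal (norm (g x)) \<partial>L)"
    by (intro nn_integral_cong) (auto simp: indicator_def)
  finally show ?thesis .
qed

text \<open>One half of the identity \<open>|g L| = |g| L\<close>. It gives the finite variation in
  \<open>radon_density\<close> and, applied to the polar factor itself, the bound from below in
  \<open>norm_polar\<close>.\<close>

lemma variation_density_le:
  fixes g :: "'a::euclidean_space \<Rightarrow> 'b::euclidean_space"
  assumes g: "integrable L g" and L: "sets L = borel_on \<Omega>"
    and \<mu>: "\<And>B. B \<in> borel_on \<Omega> \<Longrightarrow> \<mu> B = set_lebesgue_integral L B g"
  shows "variation \<Omega> \<mu> A \<le> (\<integral>\<^sup>+x\<in>A. ennreal (norm (g x)) \<partial>L)"
  unfolding variation_def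
proof (rule SUP_least, clarsimp)
  fix P :: "nat \<Rightarrow> 'a set" assume P: "range P \<subseteq> borel_on \<Omega>" "disjoint_family P" and A: "A = (\<Union>i. P i)"
  have Pi: "P i \<in> sets L" for i using P(1) L by blast
  have [measurable]: "g \<in> borel_measurable L" using g by simp
  have "(\<Sum>i. ennreal (norm (\<mu> (P i)))) \<le> (\<Sum>i. \<integral>\<^sup>+x\<in>P i. ennreal (norm (g x)) \<partial>L)"
    using norm_set_integral_le[OF g Pi] Pi L by (intro suminf_le) (auto simp: \<mu>)
  also have "\<dots> = (\<integral>\<^sup>+x\<in>(\<Union>i. P i). ennreal (norm (g x)) \<partial>L)"
    using P(2) Pi by (intro nn_integral_disjoint_family[symmetric]) auto
  finally show "(\<Sum>i. ennreal (norm (\<mu> (P i)))) \<le> (\<integral>\<^sup>+x\<in>(\<Union>i. P i). ennreal (norm (g x)) \<partial>L)" .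
qed

lemma radon_density:
  fixes g :: "'a::euclidean_space \<Rightarrow> 'b::euclidean_space"
  assumes g: "integrable L g" and L: "sets L = borel_on \<Omega>"
  shows "(\<lambda>A. if A \<in> borel_on \<Omega> then set_lebesgue_integral L A g else 0) \<in> radon_measures \<Omega>" (is "?\<mu> \<in> _")
  unfolding radon_measures_def
proof (intro CollectI conjI allI impI)
  interpret sigma_algebra \<Omega> "borel_on \<Omega>" by (rule sigma_algebra_borel_on)
  fix P :: "nat \<Rightarrow> 'a set" assume P: "range P \<subseteq> borel_on \<Omega> \<and> disjoint_family P"
  then have "(\<Union>i. P i) \<in> borel_on \<Omega>" by (intro countable_UN) auto
  moreover have "P i \<in> borel_on \<Omega>" for i using P by blast
  moreover have "(\<lambda>i. set_lebesgue_integral L (P i) g) sums set_lebesgue_integral L (\<Union>i. P i) g"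
    using P L by (intro set_integral_sums[OF g]) auto
  ultimately show "(\<lambda>i. ?\<mu> (P i)) sums ?\<mu> (\<Union>i. P i)" by simp
next
  show "variation \<Omega> ?\<mu> \<Omega> < \<infinity>"
  proof -
    have "variation \<Omega> ?\<mu> \<Omega> \<le> (\<integral>\<^sup>+x\<in>\<Omega>. ennreal (norm (g x)) \<partial>L)"
      by (rule variation_density_le[OF g L]) simp
    also have "\<dots> \<le> (\<integral>\<^sup>+x. ennreal (norm (g x)) \<partial>L)"
      by (intro nn_integral_mono) (auto simp: indicator_def)
    also have "\<dots> < \<infinity>" using g by (simp add: integrable_iff_bounded)
    finally show ?thesis .
  qed
qed simp

lemma radon_leb_measure: "u \<in> L1 \<Omega> \<Longrightarrow> leb_measure \<Omega> u \<in> radon_measures \<Omega>"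
  unfolding leb_measure_def L1_def by (intro radon_density) (auto simp: sets_leb_on)

lemma radon_measuresI:
  assumes "\<And>P :: nat \<Rightarrow> 'a set. range P \<subseteq> borel_on \<Omega> \<Longrightarrow> disjoint_family P \<Longrightarrow> (\<lambda>i. \<mu> (P i)) sums \<mu> (\<Union>i. P i)"
    and "\<And>A. A \<notin> borel_on \<Omega> \<Longrightarrow> \<mu> A = 0" and "variation \<Omega> \<mu> \<Omega> < \<infinity>"
  shows "\<mu> \<in> radon_measures (\<Omega> :: 'a::euclidean_space set)"
  using assms by (simp add: radon_measures_def)

lemma radon_add_measure:
  assumes "\<mu> \<in> radon_measures \<Omega>" "\<nu> \<in> radon_measures \<Omega>"
  shows "(\<lambda>A. \<mu> A + \<nu> A) \<in> radon_measures \<Omega>"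
proof (rule radon_measuresI)
  show "(\<lambda>i. \<mu> (P i) + \<nu> (P i)) sums (\<mu> (\<Union>i. P i) + \<nu> (\<Union>i. P i))"
    if "range P \<subseteq> borel_on \<Omega>" "disjoint_family P" for P :: "nat \<Rightarrow> _"
    using that by (intro sums_add radon_sums[OF assms(1)] radon_sums[OF assms(2)])
  show "\<mu> A + \<nu> A = 0" if "A \<notin> borel_on \<Omega>" for A using that assms by (simp add: radon_notin)
  have "variation \<Omega> (\<lambda>A. \<mu> A + \<nu> A) \<Omega> \<le> variation \<Omega> \<mu> \<Omega> + variation \<Omega> \<nu> \<Omega>"
    unfolding variation_def[of _ "\<lambda>A. \<mu> A + \<nu> A"]
  proof (rule SUP_least)
    fix P assume "P \<in> {P. range P \<subseteq> borel_on \<Omega> \<and> disjoint_family P \<and> (\<Union>i::nat. P i) = \<Omega>}"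
    then have P: "range P \<subseteq> borel_on \<Omega>" "disjoint_family P" "(\<Union>i. P i) = \<Omega>" by auto
    have "(\<Sum>i. ennreal (norm (\<mu> (P i) + \<nu> (P i)))) \<le> (\<Sum>i. ennreal (norm (\<mu> (P i))) + ennreal (norm (\<nu> (P i))))"
      by (intro suminf_le) (auto simp: ennreal_plus[symmetric] norm_triangle_ineq simp del: ennreal_plus)
    also have "\<dots> = (\<Sum>i. ennreal (norm (\<mu> (P i)))) + (\<Sum>i. ennreal (norm (\<nu> (P i))))"
      by (simp add: suminf_add)
    also have "\<dots> \<le> variation \<Omega> \<mu> \<Omega> + variation \<Omega> \<nu> \<Omega>"
      using P by (intro add_mono variation_upper) auto
    finally show "(\<Sum>i. ennreal (norm (\<mu> (P i) + \<nu> (P i)))) \<le> variation \<Omega> \<mu> \<Omega> + variation \<Omega> \<nu> \<Omega>" .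
  qed
  then show "variation \<Omega> (\<lambda>A. \<mu> A + \<nu> A) \<Omega> < \<infinity>"
    using assms by (auto simp: radon_measures_def intro: le_less_trans)
qed

lemma radon_restrict:
  assumes "\<mu> \<in> radon_measures \<Omega>" "N \<in> borel_on \<Omega>"
  shows "(\<lambda>A. if A \<in> borel_on \<Omega> then \<mu> (A \<inter> N) else 0) \<in> radon_measures \<Omega>" (is "?\<nu> \<in> _")
proof (rule radon_measuresI)
  interpret sigma_algebra \<Omega> "borel_on \<Omega>" by (rule sigma_algebra_borel_on)
  show "(\<lambda>i. ?\<nu> (P i)) sums ?\<nu> (\<Union>i. P i)"
    if P: "range P \<subseteq> borel_on \<Omega>" "disjoint_family P" for P :: "nat \<Rightarrow> _"
  proof -
    have 1: "(\<Union>i. P i) \<in> borel_on \<Omega>" "\<And>i. P i \<in> borel_on \<Omega>" using P(1) by auto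
    have "(\<lambda>i. \<mu> (P i \<inter> N)) sums \<mu> (\<Union>i. P i \<inter> N)"
      using P(2) 1 assms(2) by (intro radon_sums[OF assms(1)]) (auto simp: disjoint_family_on_def)
    then show ?thesis using 1 by simp
  qed
  have "variation \<Omega> ?\<nu> \<Omega> \<le> variation \<Omega> \<mu> N"
    unfolding variation_def[of _ ?\<nu>]
  proof (rule SUP_least)
    fix P assume "P \<in> {P. range P \<subseteq> borel_on \<Omega> \<and> disjoint_family P \<and> (\<Union>i::nat. P i) = \<Omega>}"
    then have P: "range P \<subseteq> borel_on \<Omega>" "disjoint_family P" "(\<Union>i. P i) = \<Omega>" by auto
    have Pi: "P i \<in> borel_on \<Omega>" for i using P(1) by auto
    have "N \<subseteq> (\<Union>i. P i)" unfolding P(3) using assms(2) by (rule borel_on_subset)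
    then have U: "(\<Union>i. P i \<inter> N) = N" by blast
    have "(\<Sum>i. ennreal (norm (?\<nu> (P i)))) = (\<Sum>i. ennreal (norm (\<mu> (P i \<inter> N))))"
      using Pi by simp
    also have "\<dots> \<le> variation \<Omega> \<mu> N"
      using P(2) Pi assms(2) U by (intro variation_upper) (auto simp: disjoint_family_on_def)
    finally show "(\<Sum>i. ennreal (norm (?\<nu> (P i)))) \<le> variation \<Omega> \<mu> N" .
  qed
  also have "\<dots> \<le> variation \<Omega> \<mu> \<Omega>"
    using assms by (intro variation_mono) (auto simp: top_in_borel_on dest: borel_on_subset)
  finally show "variation \<Omega> ?\<nu> \<Omega> < \<infinity>"
    using assms by (auto simp: radon_measures_def)
qed simp

section \<open>Vector-valued Radon-Nikodym theorem and the polar factor\<close>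

text \<open>The density supplied by \<open>sigma_finite_measure.Radon_Nikodym\<close> takes values
  in \<open>ennreal\<close>. As \<open>N\<close> is finite, it is finite almost everywhere, hence
  its image under \<open>enn2real\<close> is an integrable real function with the same
  integrals.\<close>

lemma Radon_Nikodym_real:
  assumes "sigma_finite_measure L" "finite_measure N" "absolutely_continuous L N" "sets N = sets L"
  shows "\<exists>h::'a\<Rightarrow>real. integrable L h \<and> (\<forall>A\<in>sets L. measure N A = set_lebesgue_integral L A h)"
proof -
  interpret N: finite_measure N by fact
  obtain f where f[measurable]: "f \<in> borel_measurable L" and d: "density L f = N"
    using sigma_finite_measure.Radon_Nikodym[OF assms(1,3,4)] by blast
  have Nf: "emeasure N A = (\<integral>\<^sup>+x\<in>A. f x \<partial>L)" if "A \<in> sets L" for A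
    using that f unfolding d[symmetric] by (simp add: emeasure_density)
  have "(\<integral>\<^sup>+x. f x \<partial>L) = emeasure N (space L)"
    by (subst Nf) (auto intro!: nn_integral_cong)
  then have fin: "(\<integral>\<^sup>+x. f x \<partial>L) \<noteq> \<infinity>" by simp
  then have ae: "AE x in L. ennreal (enn2real (f x)) = f x"
    using nn_integral_PInf_AE[OF f] by (auto simp: less_top elim!: eventually_mono)
  have nn: "(\<integral>\<^sup>+x. ennreal (indicator A x * enn2real (f x)) \<partial>L) = emeasure N A" if "A \<in> sets L" for A
    unfolding Nf[OF that] using ae
    by (intro nn_integral_cong_AE) (auto simp: indicator_def elim!: eventually_mono)
  have int: "integrable L (\<lambda>x. enn2real (f x))"
  proof (rule integrableI_nonneg)
    have "(\<integral>\<^sup>+x. ennreal (enn2real (f x)) \<partial>L) = (\<integral>\<^sup>+x. f x \<partial>L)"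
      using ae by (intro nn_integral_cong_AE)
    then show "(\<integral>\<^sup>+x. ennreal (enn2real (f x)) \<partial>L) < \<infinity>" using fin by (simp add: less_top)
  qed auto
  have "measure N A = set_lebesgue_integral L A (\<lambda>x. enn2real (f x))" if A[measurable]: "A \<in> sets L" for A
  proof -
    have "set_lebesgue_integral L A (\<lambda>x. enn2real (f x)) = enn2real (\<integral>\<^sup>+x. ennreal (indicator A x * enn2real (f x)) \<partial>L)"
      unfolding set_lebesgue_integral_def by (subst integral_eq_nn_integral) auto
    also have "\<dots> = measure N A" by (simp add: nn[OF A] measure_def)
    finally show ?thesis by simp
  qed
  then show ?thesis using int by blast
qed

text \<open>Domination by \<open>T\<close> makes \<open>T + \<mu> \<bullet> b\<close> a positive
  finite measure for every basis vector \<open>b\<close>, which takes the place of a Jordan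
  decomposition. Its density minus the density \<open>h\<^sub>0\<close> of \<open>T\<close> is the
  \<open>b\<close>-component of \<open>g\<close>. The roles of \<open>T\<close> and \<open>L\<close>
  are kept apart: for the polar factor both are \<open>tv\<close>, for the absolutely continuous
  part \<open>L\<close> is Lebesgue measure.\<close>

lemma Radon_Nikodym_vector:
  fixes \<mu> :: "'a::euclidean_space set \<Rightarrow> 'b::euclidean_space"
  assumes \<mu>: "\<And>P :: nat \<Rightarrow> 'a set. range P \<subseteq> borel_on \<Omega> \<Longrightarrow> disjoint_family P \<Longrightarrow> (\<lambda>i. \<mu> (P i)) sums \<mu> (\<Union>i. P i)"
    and T: "finite_measure T" "sets T = borel_on \<Omega>"
    and le: "\<And>A. A \<in> borel_on \<Omega> \<Longrightarrow> norm (\<mu> A) \<le> measure T A"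
    and L: "sigma_finite_measure L" "sets L = borel_on \<Omega>" "absolutely_continuous L T"
  shows "\<exists>g. integrable L g \<and> (\<forall>A\<in>sets L. \<mu> A = set_lebesgue_integral L A g)"
proof -
  interpret T: finite_measure T by fact
  interpret sigma_algebra \<Omega> "borel_on \<Omega>" by (rule sigma_algebra_borel_on)
  obtain h\<^sub>0 :: "'a \<Rightarrow> real" where h0: "integrable L h\<^sub>0" "\<And>A. A \<in> sets L \<Longrightarrow> measure T A = set_lebesgue_integral L A h\<^sub>0"
    using Radon_Nikodym_real[OF L(1) T(1) L(3)] T(2) L(2) by auto
  have "\<exists>h::'a\<Rightarrow>real. integrable L h \<and> (\<forall>A\<in>sets L. measure T A + \<mu> A \<bullet> b = set_lebesgue_integral L A h)"
    if b: "b \<in> Basis" for b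
  proof -
    have nonneg: "0 \<le> measure T A + \<mu> A \<bullet> b" if "A \<in> borel_on \<Omega>" for A
      using le[OF that] Basis_le_norm[OF b, of "\<mu> A"] by linarith
    define N where "N = measure_of \<Omega> (borel_on \<Omega>) (\<lambda>A. ennreal (measure T A + \<mu> A \<bullet> b))"
    have sN: "sets N = borel_on \<Omega>" unfolding N_def by (simp add: space_closed sigma_sets_eq)
    have spN: "space N = \<Omega>" unfolding N_def using space_closed by (simp add: space_measure_of_conv)
    have eN: "emeasure N A = ennreal (measure T A + \<mu> A \<bullet> b)" if "A \<in> borel_on \<Omega>" for A
      unfolding N_def
    proof (rule emeasure_measure_of_sigma[OF sigma_algebra_axioms _ _ that])
      show "positive (borel_on \<Omega>) (\<lambda>A. ennreal (measure T A + \<mu> A \<bullet> b))"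
        using countably_additive_empty[of \<Omega> \<mu>, OF \<mu>] by (simp add: positive_def)
      show "countably_additive (borel_on \<Omega>) (\<lambda>A. ennreal (measure T A + \<mu> A \<bullet> b))"
      proof (rule countably_additiveI)
        fix A :: "nat \<Rightarrow> 'a set"
        assume A: "range A \<subseteq> borel_on \<Omega>" "disjoint_family A"
        have "(\<lambda>i. measure T (A i) + \<mu> (A i) \<bullet> b) sums (measure T (\<Union>i. A i) + \<mu> (\<Union>i. A i) \<bullet> b)"
          using A T(2) by (intro sums_add T.finite_measure_UNION bounded_linear.sums[OF bounded_linear_inner_left] \<mu>) auto
        then show "(\<Sum>i. ennreal (measure T (A i) + \<mu> (A i) \<bullet> b)) = ennreal (measure T (\<Union>i. A i) + \<mu> (\<Union>i. A i) \<bullet> b)"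
          using A(1) nonneg by (intro suminf_ennreal_eq) auto
      qed
    qed
    have fN: "finite_measure N" by (rule finite_measureI) (simp add: spN eN top_in_borel_on)
    have "absolutely_continuous L N"
      unfolding absolutely_continuous_def
    proof (intro subsetI)
      fix A assume "A \<in> null_sets L"
      then have A: "A \<in> null_sets T" using L(3) by (auto simp: absolutely_continuous_def)
      then have Ab: "A \<in> borel_on \<Omega>" using T(2) by auto
      have "measure T A = 0" using A by (simp add: measure_eq_0_null_sets)
      moreover have "norm (\<mu> A) \<le> 0" using le[OF Ab] calculation by simp
      ultimately show "A \<in> null_sets N" using Ab by (intro null_setsI) (auto simp: eN sN)
    qed
    from Radon_Nikodym_real[OF L(1) fN this] sN L(2)
    obtain h :: "'a \<Rightarrow> real" where "integrable L h" "\<And>A. A \<in> sets L \<Longrightarrow> measure N A = set_lebesgue_integral L A h" by auto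
    moreover have "measure N A = measure T A + \<mu> A \<bullet> b" if "A \<in> borel_on \<Omega>" for A
      using eN[OF that] nonneg[OF that] by (simp add: measure_def)
    ultimately show ?thesis using L(2) by auto
  qed
  then have "\<forall>b. \<exists>h::'a\<Rightarrow>real. b \<in> Basis \<longrightarrow> integrable L h \<and> (\<forall>A\<in>sets L. measure T A + \<mu> A \<bullet> b = set_lebesgue_integral L A h)"
    by blast
  from choice[OF this] obtain h :: "'b \<Rightarrow> 'a \<Rightarrow> real"
    where h: "\<And>b. b \<in> Basis \<Longrightarrow> integrable L (h b)"
      "\<And>b A. b \<in> Basis \<Longrightarrow> A \<in> sets L \<Longrightarrow> measure T A + \<mu> A \<bullet> b = set_lebesgue_integral L A (h b)" by blast
  let ?g = "\<lambda>x. \<Sum>b\<in>Basis. (h b x - h\<^sub>0 x) *\<^sub>R b"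
  have int: "integrable L ?g" using h(1) h0(1) by auto
  moreover have "\<mu> A = set_lebesgue_integral L A ?g" if A: "A \<in> sets L" for A
  proof (rule euclidean_eqI)
    fix b :: 'b assume b: "b \<in> Basis"
    have "set_lebesgue_integral L A ?g \<bullet> b = set_lebesgue_integral L A (\<lambda>x. ?g x \<bullet> b)"
      unfolding set_lebesgue_integral_def
      using integrable_mult_indicator[OF A int]
      by (subst integral_inner_left[symmetric]) (auto simp: )
    also have "\<dots> = set_lebesgue_integral L A (\<lambda>x. h b x - h\<^sub>0 x)"
      by (simp add: inner_sum_left_Basis b)
    also have "\<dots> = \<mu> A \<bullet> b"
      using h(2)[OF b A] h0(2)[OF A] set_integrable_of_integrable[OF h(1)[OF b] A] set_integrable_of_integrable[OF h0(1) A]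
      by (simp add: set_integral_diff)
    finally show "\<mu> A \<bullet> b = set_lebesgue_integral L A ?g \<bullet> b" by simp
  qed
  ultimately show ?thesis by blast
qed

lemma vec_density_spec:
  assumes "\<exists>g. integrable L g \<and> (\<forall>A\<in>sets L. \<mu> A = set_lebesgue_integral L A g)"
  shows "integrable L (vec_density L \<mu>)" "\<And>A. A \<in> sets L \<Longrightarrow> \<mu> A = set_lebesgue_integral L A (vec_density L \<mu>)"
  using someI_ex[OF assms] unfolding vec_density_def by blast+

lemma
  assumes \<mu>: "\<mu> \<in> radon_measures \<Omega>"
  shows integrable_polar: "integrable (tv \<Omega> \<mu>) (polar \<Omega> \<mu>)"
    and set_integral_polar: "\<And>A. A \<in> borel_on \<Omega> \<Longrightarrow> \<mu> A = set_lebesgue_integral (tv \<Omega> \<mu>) A (polar \<Omega> \<mu>)"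
proof -
  interpret finite_measure "tv \<Omega> \<mu>" by (rule finite_tv[OF \<mu>])
  have "\<exists>g. integrable (tv \<Omega> \<mu>) g \<and> (\<forall>A\<in>sets (tv \<Omega> \<mu>). \<mu> A = set_lebesgue_integral (tv \<Omega> \<mu>) A g)"
    by (rule Radon_Nikodym_vector[of \<Omega> \<mu> "tv \<Omega> \<mu>"])
      (auto intro: radon_sums[OF \<mu>] finite_tv[OF \<mu>] norm_le_tv[OF \<mu>] sigma_finite_measure_axioms
        simp: absolutely_continuous_def sets_tv)
  from vec_density_spec[OF this]
  show "integrable (tv \<Omega> \<mu>) (polar \<Omega> \<mu>)" "\<And>A. A \<in> borel_on \<Omega> \<Longrightarrow> \<mu> A = set_lebesgue_integral (tv \<Omega> \<mu>) A (polar \<Omega> \<mu>)"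
    by (auto simp: polar_def sets_tv)
qed

text \<open>All averages of the polar factor lie in the closed unit ball because
  \<open>norm (\<mu> A)\<close> is at most the variation of \<open>A\<close>; closedness puts the
  factor itself there almost everywhere. Conversely, the variation of \<Omega> is at most the
  integral of the norm of the factor, so the nonnegative function \<open>1 - norm\<close> has
  integral 0.\<close>

lemma norm_polar:
  assumes \<mu>: "\<mu> \<in> radon_measures \<Omega>"
  shows "AE x in tv \<Omega> \<mu>. norm (polar \<Omega> \<mu> x) = 1"
proof -
  let ?T = "tv \<Omega> \<mu>" and ?p = "polar \<Omega> \<mu>"
  interpret finite_measure ?T by (rule finite_tv[OF \<mu>])
  have le1: "AE x in ?T. ?p x \<in> cball 0 1"
  proof (rule averaging_theorem[OF integrable_polar[OF \<mu>]])
    fix A assume A: "A \<in> sets ?T" "0 < measure ?T A"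
    have "norm (\<mu> A) \<le> measure ?T A" using A \<mu> by (intro norm_le_tv) (auto simp: sets_tv)
    then show "(1 / measure ?T A) *\<^sub>R set_lebesgue_integral ?T A ?p \<in> cball 0 1"
      using A set_integral_polar[OF \<mu>, of A] by (simp add: sets_tv divide_simps)
  qed simp
  have [measurable]: "?p \<in> borel_measurable ?T" using integrable_polar[OF \<mu>] by simp
  have "emeasure ?T \<Omega> \<le> (\<integral>\<^sup>+x\<in>\<Omega>. ennreal (norm (?p x)) \<partial>?T)"
    using variation_density_le[OF integrable_polar[OF \<mu>] sets_tv set_integral_polar[OF \<mu>], of \<Omega>]
    by (simp add: emeasure_tv[OF \<mu> top_in_borel_on])
  also have "\<dots> = (\<integral>\<^sup>+x. ennreal (norm (?p x)) \<partial>?T)"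
    by (intro nn_integral_cong) (simp add: space_tv)
  also have "\<dots> = ennreal (\<integral>x. norm (?p x) \<partial>?T)"
    using integrable_polar[OF \<mu>] by (intro nn_integral_eq_integral) auto
  finally have "measure ?T \<Omega> \<le> (\<integral>x. norm (?p x) \<partial>?T)"
    by (simp add: emeasure_eq_measure)
  then have "(\<integral>x. 1 - norm (?p x) \<partial>?T) \<le> 0"
    using integrable_polar[OF \<mu>] by (simp add: space_tv)
  moreover have nn: "AE x in ?T. 0 \<le> 1 - norm (?p x)" using le1 by (auto elim!: eventually_mono)
  ultimately have "(\<integral>x. 1 - norm (?p x) \<partial>?T) = 0" using integral_nonneg_AE[OF nn] by linarith
  moreover have "integrable ?T (\<lambda>x. 1 - norm (?p x))" using integrable_polar[OF \<mu>] by simp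
  ultimately have "AE x in ?T. 1 - norm (?p x) = 0"
    using nn integral_nonneg_eq_0_iff_AE by blast
  then show ?thesis by (auto elim!: eventually_mono)
qed

section \<open>Lebesgue decomposition and integration against vector measures\<close>

lemma borel_on_borel: "open \<Omega> \<Longrightarrow> A \<in> borel_on \<Omega> \<Longrightarrow> A \<in> sets borel"
  by (auto simp: sets_restrict_space)

lemma emeasure_leb_on:
  assumes "open \<Omega>" "A \<in> borel_on \<Omega>"
  shows "emeasure (leb_on \<Omega>) A = emeasure lborel A"
  using assms borel_on_subset[OF assms(2)] by (intro emeasure_restrict_space) auto

lemma sigma_finite_leb_on: "open \<Omega> \<Longrightarrow> sigma_finite_measure (leb_on \<Omega>)"
  by (rule sigma_finite_measure_restrict_space[OF lborel.sigma_finite_measure_axioms]) auto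

text \<open>Exhaustion: a countable union \<open>N\<close> of null sets whose variations approach
  the supremum \<open>c\<close> attains \<open>c\<close>. A null set charged outside
  \<open>N\<close> could be added to \<open>N\<close> and would exceed \<open>c\<close>.\<close>

lemma null_carrier:
  assumes \<mu>: "\<mu> \<in> radon_measures \<Omega>" and \<Omega>: "open \<Omega>"
  shows "\<exists>N\<in>borel_on \<Omega>. emeasure lborel N = 0 \<and>
    (\<forall>A\<in>borel_on \<Omega>. emeasure lborel A = 0 \<longrightarrow> measure (tv \<Omega> \<mu>) (A - N) = 0)"
proof -
  let ?T = "tv \<Omega> \<mu>"
  interpret finite_measure ?T by (rule finite_tv[OF \<mu>])
  define Z where "Z = {A \<in> borel_on \<Omega>. emeasure lborel A = 0}"
  define c where "c = (SUP A\<in>Z. measure ?T A)"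
  have Z0: "{} \<in> Z" by (simp add: Z_def)
  have bdd: "bdd_above (measure ?T ` Z)" by (intro bdd_aboveI2[of _ _ "measure ?T \<Omega>"]) (metis bounded_measure space_tv)
  have "\<exists>A\<in>Z. c - 1 / real (Suc n) < measure ?T A" for n
  proof -
    have "c - 1 / real (Suc n) < c" by simp
    then show ?thesis unfolding c_def using Z0 by (subst (asm) less_cSUP_iff[OF _ bdd]) auto
  qed
  then obtain N where N: "\<And>n. N n \<in> Z" "\<And>n. c - 1 / real (Suc n) < measure ?T (N n)" by metis
  let ?N = "\<Union>n. N n"
  have NZ: "?N \<in> Z"
  proof -
    have s: "N n \<in> borel_on \<Omega>" "N n \<in> sets lborel" for n using N(1) borel_on_borel[OF \<Omega>] by (auto simp: Z_def)
    have "?N \<in> borel_on \<Omega>" using s(1) by auto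
    moreover have "emeasure lborel ?N = 0" using N(1) s by (intro emeasure_UN_eq_0) (auto simp: Z_def)
    ultimately show ?thesis by (simp add: Z_def)
  qed
  have "c \<le> measure ?T ?N"
  proof (rule LIMSEQ_le_const2)
    show "(\<lambda>n. c - 1 / real (Suc n)) \<longlonglongrightarrow> c"
      using tendsto_diff[OF tendsto_const LIMSEQ_inverse_real_of_nat, of c] by (simp add: inverse_eq_divide)
    have "measure ?T (N n) \<le> measure ?T ?N" for n
      using NZ by (intro finite_measure_mono) (auto simp: Z_def sets_tv)
    then show "\<exists>m. \<forall>n\<ge>m. c - 1 / real (Suc n) \<le> measure ?T ?N"
      using N(2) by (meson less_le_trans less_imp_le)
  qed
  moreover have "measure ?T ?N + measure ?T (A - ?N) \<le> c" if "A \<in> Z" for A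
  proof -
    have "A \<union> ?N \<in> Z"
    proof -
      have "A \<union> ?N \<in> borel_on \<Omega>" using that NZ by (auto simp: Z_def)
      moreover have "emeasure lborel (A \<union> ?N) \<le> emeasure lborel A + emeasure lborel ?N"
        using that NZ borel_on_borel[OF \<Omega>] by (intro emeasure_subadditive) (auto simp: Z_def)
      ultimately show ?thesis using that NZ by (simp add: Z_def)
    qed
    then have "measure ?T (A \<union> ?N) \<le> c" unfolding c_def using bdd by (intro cSUP_upper)
    moreover have "measure ?T (?N \<union> (A - ?N)) = measure ?T ?N + measure ?T (A - ?N)"
      using that NZ by (intro finite_measure_Union) (auto simp: Z_def sets_tv)
    moreover have "?N \<union> (A - ?N) = A \<union> ?N" by blast
    ultimately show ?thesis by simp
  qed
  ultimately have "measure ?T (A - ?N) = 0" if "A \<in> Z" for A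
    using that measure_nonneg[of ?T "A - ?N"] by (smt (verit))
  then show ?thesis using NZ unfolding Z_def by blast
qed

text \<open>Uniqueness behind the \<open>THE\<close>: two candidates with carriers \<open>N\<close>
  and \<open>N'\<close> are determined by their values inside the null set
  \<open>N \<union> N'\<close>, where both agree with \<mu>. Equality as functions also uses that
  members of \<open>radon_measures\<close> vanish off the Borel sets.\<close>

lemma sing_partI:
  assumes \<nu>: "\<nu> \<in> radon_measures \<Omega>" "N \<in> borel_on \<Omega>" "emeasure lborel N = 0"
    "\<And>A. A \<in> borel_on \<Omega> \<Longrightarrow> \<nu> A = \<nu> (A \<inter> N)"
    "\<And>A. A \<in> borel_on \<Omega> \<Longrightarrow> emeasure lborel A = 0 \<Longrightarrow> \<mu> A = \<nu> A" and \<Omega>: "open \<Omega>"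
  shows "sing_part \<Omega> \<mu> = \<nu>"
  unfolding sing_part_def
proof (rule the_equality)
  show "\<nu> \<in> radon_measures \<Omega> \<and> (\<exists>N\<in>borel_on \<Omega>. emeasure lborel N = 0 \<and> (\<forall>A\<in>borel_on \<Omega>. \<nu> A = \<nu> (A \<inter> N))) \<and>
        (\<forall>A\<in>borel_on \<Omega>. emeasure lborel A = 0 \<longrightarrow> \<mu> A - \<nu> A = 0)"
  proof (intro conjI bexI[of _ N] ballI impI)
    fix A assume A: "A \<in> borel_on \<Omega>" "emeasure lborel A = 0"
    show "\<mu> A - \<nu> A = 0" using assms(5)[OF A] by simp
  qed (fact assms)+
  fix \<nu>' assume *: "\<nu>' \<in> radon_measures \<Omega> \<and> (\<exists>N\<in>borel_on \<Omega>. emeasure lborel N = 0 \<and> (\<forall>A\<in>borel_on \<Omega>. \<nu>' A = \<nu>' (A \<inter> N))) \<and>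
        (\<forall>A\<in>borel_on \<Omega>. emeasure lborel A = 0 \<longrightarrow> \<mu> A - \<nu>' A = 0)"
  from * obtain N' where N': "N' \<in> borel_on \<Omega>" "emeasure lborel N' = 0"
      "\<forall>A\<in>borel_on \<Omega>. \<nu>' A = \<nu>' (A \<inter> N')" by blast
  have \<nu>': "\<nu>' \<in> radon_measures \<Omega>" "N' \<in> borel_on \<Omega>" "emeasure lborel N' = 0"
    "\<And>A. A \<in> borel_on \<Omega> \<Longrightarrow> \<nu>' A = \<nu>' (A \<inter> N')"
    "\<And>A. A \<in> borel_on \<Omega> \<Longrightarrow> emeasure lborel A = 0 \<Longrightarrow> \<mu> A = \<nu>' A"
  proof -
    fix A assume "A \<in> borel_on \<Omega>"
    then show "\<nu>' A = \<nu>' (A \<inter> N')" by (rule N'(3)[rule_format])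
    assume "emeasure lborel A = 0"
    with * \<open>A \<in> borel_on \<Omega>\<close> have "\<mu> A - \<nu>' A = 0" by blast
    then show "\<mu> A = \<nu>' A" by simp
  qed (use * N' in blast)+
  show "\<nu>' = \<nu>"
  proof
    fix A
    show "\<nu>' A = \<nu> A"
    proof (cases "A \<in> borel_on \<Omega>")
      case False
      then show ?thesis using \<nu>(1) \<nu>'(1) by (simp add: radon_notin)
    next
      case True
      let ?B = "A \<inter> (N \<union> N')"
      have B: "?B \<in> borel_on \<Omega>" using True \<nu>(2) \<nu>'(2) by auto
      have "emeasure lborel (N \<union> N') \<le> emeasure lborel N + emeasure lborel N'"
        using \<nu>(2) \<nu>'(2) borel_on_borel[OF \<Omega>] by (intro emeasure_subadditive) auto
      moreover have "emeasure lborel ?B \<le> emeasure lborel (N \<union> N')"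
        using \<nu>(2) \<nu>'(2) borel_on_borel[OF \<Omega>] by (intro emeasure_mono) auto
      ultimately have B0: "emeasure lborel ?B = 0" using \<nu>(3) \<nu>'(3) by simp
      have eq: "?B \<inter> N = A \<inter> N" "?B \<inter> N' = A \<inter> N'" by auto
      have "\<nu> A = \<nu> ?B" using \<nu>(4)[OF True] \<nu>(4)[OF B] unfolding eq by simp
      also have "\<dots> = \<nu>' ?B" using \<nu>(5)[OF B B0] \<nu>'(5)[OF B B0] by simp
      also have "\<dots> = \<nu>' A" using \<nu>'(4)[OF True] \<nu>'(4)[OF B] unfolding eq by simp
      finally show ?thesis by simp
    qed
  qed
qed

text \<open>The restriction of \<mu> to the set from \<open>null_carrier\<close> has the defining
  properties. Later lemmas work with this explicit form and its carrier in place of the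
  \<open>THE\<close>.\<close>

lemma sing_part_ex:
  assumes \<mu>: "\<mu> \<in> radon_measures \<Omega>" and \<Omega>: "open \<Omega>"
  shows "\<exists>N\<in>borel_on \<Omega>. emeasure lborel N = 0 \<and>
    sing_part \<Omega> \<mu> = (\<lambda>A. if A \<in> borel_on \<Omega> then \<mu> (A \<inter> N) else 0) \<and>
    (\<forall>A\<in>borel_on \<Omega>. emeasure lborel A = 0 \<longrightarrow> measure (tv \<Omega> \<mu>) (A - N) = 0)"
proof -
  obtain N where N: "N \<in> borel_on \<Omega>" "emeasure lborel N = 0"
    "\<And>A. A \<in> borel_on \<Omega> \<Longrightarrow> emeasure lborel A = 0 \<Longrightarrow> measure (tv \<Omega> \<mu>) (A - N) = 0"
    using null_carrier[OF assms] by auto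
  have "sing_part \<Omega> \<mu> = (\<lambda>A. if A \<in> borel_on \<Omega> then \<mu> (A \<inter> N) else 0)"
  proof (rule sing_partI[OF radon_restrict[OF \<mu> N(1)] N(1,2) _ _ \<Omega>])
    fix A assume A: "A \<in> borel_on \<Omega>"
    then have AN: "A \<inter> N \<in> borel_on \<Omega>" "A - N \<in> borel_on \<Omega>" using N(1) by auto
    then show "(if A \<in> borel_on \<Omega> then \<mu> (A \<inter> N) else 0) = (if A \<inter> N \<in> borel_on \<Omega> then \<mu> (A \<inter> N \<inter> N) else 0)"
      using A by (simp add: Int_assoc)
    assume "emeasure lborel A = 0"
    then have "\<mu> (A - N) = 0" using norm_le_tv[OF \<mu> AN(2)] N(3)[OF A] by simp
    moreover have "\<mu> ((A \<inter> N) \<union> (A - N)) = \<mu> (A \<inter> N) + \<mu> (A - N)"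
      using AN by (intro radon_add[OF \<mu>]) auto
    moreover have "(A \<inter> N) \<union> (A - N) = A" by blast
    ultimately show "\<mu> A = (if A \<in> borel_on \<Omega> then \<mu> (A \<inter> N) else 0)" using A by simp
  qed
  then show ?thesis using N by blast
qed

lemma radon_sing_part:
  assumes "\<mu> \<in> radon_measures \<Omega>" "open \<Omega>"
  shows "sing_part \<Omega> \<mu> \<in> radon_measures \<Omega>"
  using sing_part_ex[OF assms] radon_restrict[OF assms(1)] by auto

lemma
  assumes \<mu>: "\<mu> \<in> radon_measures \<Omega>" and \<Omega>: "open \<Omega>"
  shows integrable_ac_density: "integrable (leb_on \<Omega>) (ac_density \<Omega> \<mu>)"
    and ac_density_decomp: "\<And>A. A \<in> borel_on \<Omega> \<Longrightarrow>
      \<mu> A = set_lebesgue_integral (leb_on \<Omega>) A (ac_density \<Omega> \<mu>) + sing_part \<Omega> \<mu> A"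
proof -
  let ?s = "sing_part \<Omega> \<mu>"
  obtain N where N: "N \<in> borel_on \<Omega>" "emeasure lborel N = 0"
    "?s = (\<lambda>A. if A \<in> borel_on \<Omega> then \<mu> (A \<inter> N) else 0)"
    "\<And>A. A \<in> borel_on \<Omega> \<Longrightarrow> emeasure lborel A = 0 \<Longrightarrow> measure (tv \<Omega> \<mu>) (A - N) = 0"
    using sing_part_ex[OF assms] by auto
  interpret finite_measure "tv \<Omega> \<mu>" by (rule finite_tv[OF \<mu>])
  \<comment> \<open>The variation off the carrier \<open>N\<close>: it dominates \<mu> minus its
    singular part and charges no Lebesgue null set, so \<open>Radon_Nikodym_vector\<close> applies
    with Lebesgue measure as reference.\<close>
  define T where "T = density (tv \<Omega> \<mu>) (indicator (\<Omega> - N))"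
  have sT: "sets T = borel_on \<Omega>" by (simp add: T_def sets_tv)
  have NN: "\<Omega> - N \<in> sets (tv \<Omega> \<mu>)" using N(1) top_in_borel_on by (auto simp: sets_tv)
  have eT: "emeasure T A = emeasure (tv \<Omega> \<mu>) (A - N)" if "A \<in> borel_on \<Omega>" for A
  proof -
    have "emeasure T A = emeasure (tv \<Omega> \<mu>) ((\<Omega> - N) \<inter> A)"
      unfolding T_def using that by (intro emeasure_restricted NN) (simp add: sets_tv)
    also have "(\<Omega> - N) \<inter> A = A - N" using borel_on_subset[OF that] by blast
    finally show ?thesis .
  qed
  have mT: "measure T A = measure (tv \<Omega> \<mu>) (A - N)" if "A \<in> borel_on \<Omega>" for A
    using eT[OF that] by (simp add: measure_def)
  have fT: "finite_measure T"
  proof (rule finite_measureI)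
    have "space T = \<Omega>" by (simp add: T_def space_tv)
    then show "emeasure T (space T) \<noteq> \<infinity>" using eT[OF top_in_borel_on] by simp
  qed
  interpret T: finite_measure T by (rule fT)
  have diff: "\<mu> A - ?s A = \<mu> (A - N)" if "A \<in> borel_on \<Omega>" for A
  proof -
    have "\<mu> ((A \<inter> N) \<union> (A - N)) = \<mu> (A \<inter> N) + \<mu> (A - N)"
      using that N(1) by (intro radon_add[OF \<mu>]) auto
    moreover have "(A \<inter> N) \<union> (A - N) = A" by blast
    ultimately show ?thesis using N(3) that by simp
  qed
  have "\<exists>g. integrable (leb_on \<Omega>) g \<and> (\<forall>A\<in>sets (leb_on \<Omega>). \<mu> A - ?s A = set_lebesgue_integral (leb_on \<Omega>) A g)"
  proof (rule Radon_Nikodym_vector[OF _ fT sT _ sigma_finite_leb_on[OF \<Omega>] sets_leb_on])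
    show "(\<lambda>i. \<mu> (P i) - ?s (P i)) sums (\<mu> (\<Union>i. P i) - ?s (\<Union>i. P i))"
      if "range P \<subseteq> borel_on \<Omega>" "disjoint_family P" for P :: "nat \<Rightarrow> _"
      using that by (intro sums_diff radon_sums[OF \<mu>] radon_sums[OF radon_sing_part[OF \<mu> \<Omega>]])
    fix A assume A: "A \<in> borel_on \<Omega>"
    have "norm (\<mu> (A - N)) \<le> measure (tv \<Omega> \<mu>) (A - N)" using A N(1) by (intro norm_le_tv[OF \<mu>]) auto
    then show "norm (\<mu> A - ?s A) \<le> measure T A" using A by (simp add: diff mT)
  next
    show "absolutely_continuous (leb_on \<Omega>) T"
      unfolding absolutely_continuous_def
    proof
      fix A assume A: "A \<in> null_sets (leb_on \<Omega>)"
      then have Ab: "A \<in> borel_on \<Omega>" using sets_leb_on by blast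
      have "emeasure lborel A = 0" using A emeasure_leb_on[OF \<Omega> Ab] by auto
      then have "measure T A = 0" using N(4)[OF Ab] mT[OF Ab] by simp
      then show "A \<in> null_sets T" using Ab by (intro null_setsI) (auto simp: sT T.emeasure_eq_measure)
    qed
  qed
  from vec_density_spec[OF this]
  show "integrable (leb_on \<Omega>) (ac_density \<Omega> \<mu>)"
    "\<And>A. A \<in> borel_on \<Omega> \<Longrightarrow> \<mu> A = set_lebesgue_integral (leb_on \<Omega>) A (ac_density \<Omega> \<mu>) + ?s A"
    by (simp_all add: ac_density_def sets_leb_on[symmetric] algebra_simps)
qed

lemma set_integral_null:
  fixes g :: "'a::euclidean_space \<Rightarrow> 'b::euclidean_space"
  assumes "open \<Omega>" "A \<in> borel_on \<Omega>" "emeasure lborel A = 0"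
  shows "set_lebesgue_integral (leb_on \<Omega>) A g = 0"
proof -
  have "A \<in> null_sets (leb_on \<Omega>)" using assms by (intro null_setsI) (auto simp: emeasure_leb_on sets_leb_on)
  then have "AE x in leb_on \<Omega>. x \<notin> A" by (rule AE_not_in)
  then have "AE x in leb_on \<Omega>. indicator A x *\<^sub>R g x = 0" by eventually_elim simp
  then show ?thesis unfolding set_lebesgue_integral_def by (rule integral_eq_zero_AE)
qed

lemma leb_measure_borel: "A \<in> borel_on \<Omega> \<Longrightarrow> leb_measure \<Omega> u A = set_lebesgue_integral (leb_on \<Omega>) A u"
  by (simp add: leb_measure_def)

text \<open>A null carrier for \<nu> serves the sum as well, since Lebesgue integrals vanish on null
  sets. This lets the formula for \<open>u\<^sub>0 + \<nu>\<close> be read off from \<nu>.\<close>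

lemma sing_part_add_leb:
  assumes \<nu>: "\<nu> \<in> radon_measures \<Omega>" and \<Omega>: "open \<Omega>"
  shows "sing_part \<Omega> (\<lambda>A. leb_measure \<Omega> u A + \<nu> A) = sing_part \<Omega> \<nu>"
proof -
  obtain N where N: "N \<in> borel_on \<Omega>" "emeasure lborel N = 0"
    "sing_part \<Omega> \<nu> = (\<lambda>A. if A \<in> borel_on \<Omega> then \<nu> (A \<inter> N) else 0)"
    using sing_part_ex[OF assms] by auto
  show ?thesis
  proof (rule sing_partI[OF radon_sing_part[OF assms] N(1,2) _ _ \<Omega>])
    fix A assume A: "A \<in> borel_on \<Omega>"
    then have AN: "A \<inter> N \<in> borel_on \<Omega>" using N(1) by auto
    then show "sing_part \<Omega> \<nu> A = sing_part \<Omega> \<nu> (A \<inter> N)"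
      unfolding N(3) using A by (simp add: Int_assoc)
    assume A0: "emeasure lborel A = 0"
    then show "leb_measure \<Omega> u A + \<nu> A = sing_part \<Omega> \<nu> A"
      using ac_density_decomp[OF assms A] by (simp add: leb_measure_borel A set_integral_null[OF \<Omega> A A0])
  qed
qed

lemma ac_density_unique:
  assumes \<mu>: "\<mu> \<in> radon_measures \<Omega>" and \<Omega>: "open \<Omega>" and u: "integrable (leb_on \<Omega>) u"
    and eq: "\<And>A. A \<in> borel_on \<Omega> \<Longrightarrow> \<mu> A = set_lebesgue_integral (leb_on \<Omega>) A u + sing_part \<Omega> \<mu> A"
  shows "AE x in leb_on \<Omega>. ac_density \<Omega> \<mu> x = u x"
proof -
  interpret sigma_finite_measure "leb_on \<Omega>" by (rule sigma_finite_leb_on[OF \<Omega>])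
  show ?thesis
    using eq ac_density_decomp[OF \<mu> \<Omega>]
    by (intro density_unique_banach integrable_ac_density[OF \<mu> \<Omega>] u) (auto simp: sets_leb_on)
qed

lemma ac_density_add_leb:
  assumes \<nu>: "\<nu> \<in> radon_measures \<Omega>" and \<Omega>: "open \<Omega>" and u: "u \<in> L1 \<Omega>"
  shows "AE x in leb_on \<Omega>. ac_density \<Omega> (\<lambda>A. leb_measure \<Omega> u A + \<nu> A) x = u x + ac_density \<Omega> \<nu> x"
proof (rule ac_density_unique[OF radon_add_measure[OF radon_leb_measure[OF u] \<nu>] \<Omega>])
  have i: "integrable (leb_on \<Omega>) u" "integrable (leb_on \<Omega>) (ac_density \<Omega> \<nu>)"
    using u integrable_ac_density[OF \<nu> \<Omega>] by (auto simp: L1_def)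
  then show "integrable (leb_on \<Omega>) (\<lambda>x. u x + ac_density \<Omega> \<nu> x)" by simp
  fix A assume A: "A \<in> borel_on \<Omega>"
  then have "set_lebesgue_integral (leb_on \<Omega>) A (\<lambda>x. u x + ac_density \<Omega> \<nu> x)
      = set_lebesgue_integral (leb_on \<Omega>) A u + set_lebesgue_integral (leb_on \<Omega>) A (ac_density \<Omega> \<nu>)"
    using i by (intro set_integral_add set_integrable_of_integrable) (auto simp: sets_leb_on)
  then show "leb_measure \<Omega> u A + \<nu> A = set_lebesgue_integral (leb_on \<Omega>) A (\<lambda>x. u x + ac_density \<Omega> \<nu> x)
      + sing_part \<Omega> (\<lambda>A. leb_measure \<Omega> u A + \<nu> A) A"
    unfolding sing_part_add_leb[OF \<nu> \<Omega>] using ac_density_decomp[OF \<nu> \<Omega> A] A by (simp add: leb_measure_borel)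
qed

lemma radon_zero: "(\<lambda>A. 0) \<in> radon_measures \<Omega>"
proof (rule radon_measuresI)
  have "variation \<Omega> (\<lambda>A. 0) \<Omega> \<le> 0" unfolding variation_def by (rule SUP_least) simp
  then show "variation \<Omega> (\<lambda>A. 0) \<Omega> < \<infinity>" using ennreal_zero_less_top by (metis infinity_ennreal_def le_less_trans)
qed simp_all

lemma sing_part_leb:
  assumes "open \<Omega>"
  shows "sing_part \<Omega> (leb_measure \<Omega> u) = (\<lambda>A. 0)"
proof (rule sing_partI[OF radon_zero, of "{}"])
  show "leb_measure \<Omega> u A = 0" if "A \<in> borel_on \<Omega>" "emeasure lborel A = 0" for A
    using that assms by (simp add: leb_measure_borel set_integral_null)
qed (use assms in auto)

lemma ac_density_leb:
  assumes "open \<Omega>" "u \<in> L1 \<Omega>"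
  shows "AE x in leb_on \<Omega>. ac_density \<Omega> (leb_measure \<Omega> u) x = u x"
  using assms by (intro ac_density_unique radon_leb_measure) (auto simp: sing_part_leb leb_measure_borel L1_def)

lemma area_excess_leb:
  assumes "open \<Omega>" "u \<in> L1 \<Omega>"
  shows "area_excess \<Omega> (leb_measure \<Omega> u) = (\<integral>\<^sup>+x. ennreal (sqrt (1 + (norm (u x))\<^sup>2) - 1) \<partial>leb_on \<Omega>)"
proof -
  have "variation \<Omega> (\<lambda>A. 0::'b) \<Omega> \<le> 0" unfolding variation_def by (rule SUP_least) simp
  then have "emeasure (tv \<Omega> (\<lambda>A. 0::'b)) \<Omega> = 0" by (simp add: emeasure_tv[OF radon_zero top_in_borel_on])
  then show ?thesis
    unfolding area_excess_def sing_part_leb[OF assms(1)]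
    using ac_density_leb[OF assms] by (auto intro!: nn_integral_cong_AE elim!: eventually_mono)
qed

lemma area_leb:
  assumes "open \<Omega>" "u \<in> L1 \<Omega>"
  shows "area \<Omega> (leb_measure \<Omega> u) \<Omega> = (\<integral>\<^sup>+x. ennreal (sqrt (1 + (norm (u x))\<^sup>2)) \<partial>leb_on \<Omega>)"
proof -
  have "variation \<Omega> (\<lambda>A. 0::'b) \<Omega> \<le> 0" unfolding variation_def by (rule SUP_least) simp
  then have "emeasure (tv \<Omega> (\<lambda>A. 0::'b)) \<Omega> = 0" by (simp add: emeasure_tv[OF radon_zero top_in_borel_on])
  then show ?thesis
    unfolding area_def sing_part_leb[OF assms(1)]
    using ac_density_leb[OF assms] AE_space[of "leb_on \<Omega>"]
    by (auto intro!: nn_integral_cong_AE elim!: eventually_elim2 simp: space_leb_on)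
qed

section \<open>Integrals of bounded fields against vector measures\<close>

lemma integral_simple_inner:
  fixes g :: "'a \<Rightarrow> 'b::euclidean_space"
  assumes F: "simple_function L F" and g: "integrable L g"
  shows "(\<integral>x. F x \<bullet> g x \<partial>L) = (\<Sum>y\<in>F ` space L. y \<bullet> set_lebesgue_integral L (F -` {y} \<inter> space L) g)"
proof -
  have fin: "finite (F ` space L)" and s: "\<And>y. F -` {y} \<inter> space L \<in> sets L"
    using F by (auto simp: simple_function_def intro: simple_functionD)
  have "(\<integral>x. F x \<bullet> g x \<partial>L) = (\<integral>x. (\<Sum>y\<in>F ` space L. y \<bullet> (indicator (F -` {y} \<inter> space L) x *\<^sub>R g x)) \<partial>L)"
  proof (intro Bochner_Integration.integral_cong refl)
    fix x assume x: "x \<in> space L"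
    have "(\<Sum>y\<in>F ` space L. y \<bullet> (indicator (F -` {y} \<inter> space L) x *\<^sub>R g x)) = (\<Sum>y\<in>F ` space L. if y = F x then F x \<bullet> g x else 0)"
      using x by (intro sum.cong) (auto simp: indicator_def)
    also have "\<dots> = F x \<bullet> g x" using fin x by simp
    finally show "F x \<bullet> g x = (\<Sum>y\<in>F ` space L. y \<bullet> (indicator (F -` {y} \<inter> space L) x *\<^sub>R g x))" by simp
  qed
  also have "\<dots> = (\<Sum>y\<in>F ` space L. \<integral>x. y \<bullet> (indicator (F -` {y} \<inter> space L) x *\<^sub>R g x) \<partial>L)"
    using integrable_mult_indicator[OF s g] by (intro Bochner_Integration.integral_sum integrable_inner_right) auto
  also have "\<dots> = (\<Sum>y\<in>F ` space L. y \<bullet> set_lebesgue_integral L (F -` {y} \<inter> space L) g)"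
    unfolding set_lebesgue_integral_def
    using integrable_mult_indicator[OF s g] by (intro sum.cong refl integral_inner_right) simp
  finally show ?thesis .
qed

text \<open>Values on Borel sets determine the integral of a bounded field: the identity holds for
  simple fields and passes to the limit by dominated convergence. Two reference measures are allowed
  so that one statement covers the splitting into absolutely continuous and singular part as well as
  the sum of a function and a measure.\<close>

lemma vec_integral_eq:
  fixes \<mu> :: "'a::euclidean_space set \<Rightarrow> 'b::euclidean_space"
  assumes \<mu>: "\<mu> \<in> radon_measures \<Omega>"
    and L: "sets L\<^sub>1 = borel_on \<Omega>" "sets L\<^sub>2 = borel_on \<Omega>" and g: "integrable L\<^sub>1 g\<^sub>1" "integrable L\<^sub>2 g\<^sub>2"
    and eq: "\<And>A. A \<in> borel_on \<Omega> \<Longrightarrow> \<mu> A = set_lebesgue_integral L\<^sub>1 A g\<^sub>1 + set_lebesgue_integral L\<^sub>2 A g\<^sub>2"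
    and \<phi>: "\<phi> \<in> borel_measurable (restrict_space borel \<Omega>)" "bounded (\<phi> ` \<Omega>)"
  shows "vec_integral \<Omega> \<phi> \<mu> = (\<integral>x. \<phi> x \<bullet> g\<^sub>1 x \<partial>L\<^sub>1) + (\<integral>x. \<phi> x \<bullet> g\<^sub>2 x \<partial>L\<^sub>2)"
proof -
  let ?R = "restrict_space borel \<Omega>"
  obtain B where B: "\<And>x. x \<in> \<Omega> \<Longrightarrow> norm (\<phi> x) \<le> B" using \<phi>(2) by (auto simp: bounded_iff)
  \<comment> \<open>The simple approximants are bounded by \<open>2 * norm (\<phi> x)\<close>, which
    yields the dominating function \<open>2 * B * norm (g x)\<close>.\<close>
  obtain F where "\<forall>i. simple_function ?R (F i)" "\<forall>x\<in>space ?R. (\<lambda>i. F i x) \<longlonglongrightarrow> \<phi> x"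
    "\<forall>i. \<forall>x\<in>space ?R. dist (F i x) 0 \<le> 2 * dist (\<phi> x) 0"
    using borel_measurable_implies_sequence_metric[OF \<phi>(1), of 0] by blast
  then have F: "simple_function ?R (F i)" "x \<in> \<Omega> \<Longrightarrow> (\<lambda>i. F i x) \<longlonglongrightarrow> \<phi> x"
     "x \<in> \<Omega> \<Longrightarrow> norm (F i x) \<le> 2 * norm (\<phi> x)" for i x
    by (simp_all add: space_restrict_space)
  have sp: "space L = \<Omega>" if "sets L = borel_on \<Omega>" for L :: "'a measure"
    using sets_eq_imp_space_eq[of L ?R] that by (simp add: space_restrict_space)
  have lim: "(\<lambda>i. \<integral>x. F i x \<bullet> g x \<partial>L) \<longlonglongrightarrow> (\<integral>x. \<phi> x \<bullet> g x \<partial>L)"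
    and simp: "(\<integral>x. F i x \<bullet> g x \<partial>L) = (\<Sum>y\<in>F i ` \<Omega>. y \<bullet> set_lebesgue_integral L (F i -` {y} \<inter> \<Omega>) g)"
    if L: "sets L = borel_on \<Omega>" and g: "integrable L g" for L :: "'a measure" and g and i
  proof -
    have [measurable]: "g \<in> borel_measurable L" using g by simp
    have [measurable]: "\<phi> \<in> borel_measurable L" using \<phi>(1) measurable_cong_sets[OF L refl] by auto
    have F': "simple_function L (F i)" for i
      using F(1)[of i] L sp[OF L] by (simp add: simple_function_def space_restrict_space)
    then have [measurable]: "F i \<in> borel_measurable L" for i by (rule borel_measurable_simple_function)
    show "(\<lambda>i. \<integral>x. F i x \<bullet> g x \<partial>L) \<longlonglongrightarrow> (\<integral>x. \<phi> x \<bullet> g x \<partial>L)"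
    proof (rule integral_dominated_convergence[where w = "\<lambda>x. 2 * B * norm (g x)"])
      show "integrable L (\<lambda>x. 2 * B * norm (g x))" using g by simp
      show "AE x in L. (\<lambda>i. F i x \<bullet> g x) \<longlonglongrightarrow> \<phi> x \<bullet> g x"
        using F(2) by (intro AE_I2 tendsto_intros) (auto simp: sp[OF L])
      show "AE x in L. norm (F i x \<bullet> g x) \<le> 2 * B * norm (g x)" for i
      proof (rule AE_I2)
        fix x assume "x \<in> space L"
        then have "norm (F i x) \<le> 2 * B" using F(3)[of x i] B[of x] by (simp add: sp[OF L])
        moreover have "norm (F i x \<bullet> g x) \<le> norm (F i x) * norm (g x)" by (simp add: Cauchy_Schwarz_ineq2)
        ultimately show "norm (F i x \<bullet> g x) \<le> 2 * B * norm (g x)"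
          by (meson mult_right_mono norm_ge_zero order_trans)
      qed
    qed measurable
    show "(\<integral>x. F i x \<bullet> g x \<partial>L) = (\<Sum>y\<in>F i ` \<Omega>. y \<bullet> set_lebesgue_integral L (F i -` {y} \<inter> \<Omega>) g)"
      using integral_simple_inner[OF F' g] by (simp add: sp[OF L])
  qed
  have "(\<integral>x. F i x \<bullet> polar \<Omega> \<mu> x \<partial>tv \<Omega> \<mu>) = (\<integral>x. F i x \<bullet> g\<^sub>1 x \<partial>L\<^sub>1) + (\<integral>x. F i x \<bullet> g\<^sub>2 x \<partial>L\<^sub>2)" for i
  proof -
    have s: "F i -` {y} \<inter> \<Omega> \<in> borel_on \<Omega>" for y
      using simple_functionD(2)[OF F(1)[of i], of "{y}"] by (simp add: space_restrict_space)
    show ?thesis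
      unfolding simp[OF sets_tv integrable_polar[OF \<mu>]] simp[OF L(1) g(1)] simp[OF L(2) g(2)]
      using eq[OF s] set_integral_polar[OF \<mu> s]
      by (simp add: sum.distrib[symmetric] inner_add_right[symmetric])
  qed
  moreover have "(\<lambda>i. \<integral>x. F i x \<bullet> polar \<Omega> \<mu> x \<partial>tv \<Omega> \<mu>) \<longlonglongrightarrow> vec_integral \<Omega> \<phi> \<mu>"
    unfolding vec_integral_def by (rule lim[OF sets_tv integrable_polar[OF \<mu>]])
  moreover have "(\<lambda>i. (\<integral>x. F i x \<bullet> g\<^sub>1 x \<partial>L\<^sub>1) + (\<integral>x. F i x \<bullet> g\<^sub>2 x \<partial>L\<^sub>2)) \<longlonglongrightarrow>
      (\<integral>x. \<phi> x \<bullet> g\<^sub>1 x \<partial>L\<^sub>1) + (\<integral>x. \<phi> x \<bullet> g\<^sub>2 x \<partial>L\<^sub>2)"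
    by (intro tendsto_add lim L g)
  ultimately show ?thesis by (simp add: LIMSEQ_unique)
qed

lemma vec_integral_leb:
  assumes "u \<in> L1 \<Omega>" "\<phi> \<in> borel_measurable (restrict_space borel \<Omega>)" "bounded (\<phi> ` \<Omega>)"
  shows "vec_integral \<Omega> \<phi> (leb_measure \<Omega> u) = (\<integral>x. \<phi> x \<bullet> u x \<partial>leb_on \<Omega>)"
proof -
  have "vec_integral \<Omega> \<phi> (leb_measure \<Omega> u) = (\<integral>x. \<phi> x \<bullet> u x \<partial>leb_on \<Omega>) + (\<integral>x. \<phi> x \<bullet> 0 \<partial>leb_on \<Omega>)"
    using assms by (intro vec_integral_eq radon_leb_measure) (auto simp: sets_leb_on L1_def leb_measure_borel set_lebesgue_integral_def)
  then show ?thesis by simp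
qed

lemma vec_integral_decomp:
  assumes "\<mu> \<in> radon_measures \<Omega>" "open \<Omega>" "\<phi> \<in> borel_measurable (restrict_space borel \<Omega>)" "bounded (\<phi> ` \<Omega>)"
  shows "vec_integral \<Omega> \<phi> \<mu> = (\<integral>x. \<phi> x \<bullet> ac_density \<Omega> \<mu> x \<partial>leb_on \<Omega>)
    + (\<integral>x. \<phi> x \<bullet> polar \<Omega> (sing_part \<Omega> \<mu>) x \<partial>tv \<Omega> (sing_part \<Omega> \<mu>))"
  using assms set_integral_polar[OF radon_sing_part[OF assms(1,2)]]
  by (intro vec_integral_eq integrable_ac_density integrable_polar radon_sing_part)
    (auto simp: sets_leb_on sets_tv ac_density_decomp)

lemma vec_integral_add_leb:
  assumes "\<nu> \<in> radon_measures \<Omega>" "u \<in> L1 \<Omega>" "\<phi> \<in> borel_measurable (restrict_space borel \<Omega>)" "bounded (\<phi> ` \<Omega>)"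
  shows "vec_integral \<Omega> \<phi> (\<lambda>A. leb_measure \<Omega> u A + \<nu> A) = (\<integral>x. \<phi> x \<bullet> u x \<partial>leb_on \<Omega>) + vec_integral \<Omega> \<phi> \<nu>"
  unfolding vec_integral_def[of _ _ \<nu>]
  using assms set_integral_polar[OF assms(1)]
  by (intro vec_integral_eq radon_add_measure radon_leb_measure integrable_polar)
    (auto simp: sets_leb_on sets_tv leb_measure_borel L1_def)

section \<open>Approximation by continuous functions\<close>

lemma measurable_ident_borel_on:
  assumes "sets L = borel_on \<Omega>"
  shows "(\<lambda>x. x) \<in> measurable L borel"
proof -
  have "(\<lambda>x. x) \<in> measurable (restrict_space borel \<Omega>) borel"
    by (intro measurable_restrict_space1) simp
  then show ?thesis using measurable_cong_sets[OF assms refl] by blast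
qed

text \<open>The finite measure with density \<open>q\<close> is pushed forward to the Borel sets of
  the whole space, where finite measures are inner regular for compact and outer regular for open
  sets.\<close>

lemma regular_sandwich:
  fixes q :: "'a::euclidean_space \<Rightarrow> real"
  assumes L: "sets L = borel_on \<Omega>" and q: "integrable L q" "\<And>x. 0 \<le> q x"
    and E: "E \<in> sets borel" and e: "0 < e"
  shows "\<exists>C U. compact C \<and> open U \<and> C \<subseteq> E \<and> E \<subseteq> U \<and> (\<integral>x. indicator (U - C) x * q x \<partial>L) < e"
proof -
  have id[measurable]: "(\<lambda>x. x) \<in> measurable L borel" by (rule measurable_ident_borel_on[OF L])
  have [measurable]: "q \<in> borel_measurable L" using q by simp
  define Q where "Q = distr (density L (\<lambda>x. ennreal (q x))) borel (\<lambda>x. x)"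
  have sQ: "sets Q = sets borel" by (simp add: Q_def)
  have eQ: "emeasure Q A = (\<integral>\<^sup>+x. ennreal (indicator A x * q x) \<partial>L)" if "A \<in> sets borel" for A
  proof -
    have A: "A \<inter> space L \<in> sets L" using measurable_sets[OF id that] by simp
    have "emeasure Q A = emeasure (density L (\<lambda>x. ennreal (q x))) (A \<inter> space L)"
      unfolding Q_def using that by (subst emeasure_distr) auto
    also have "\<dots> = (\<integral>\<^sup>+x. ennreal (q x) * indicator (A \<inter> space L) x \<partial>L)"
      using A by (intro emeasure_density) auto
    also have "\<dots> = (\<integral>\<^sup>+x. ennreal (indicator A x * q x) \<partial>L)"
      by (intro nn_integral_cong) (auto simp: indicator_def)
    finally show ?thesis .
  qed
  have ind: "integrable L (\<lambda>x. indicator A x * q x)" if "A \<in> sets borel" for A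
  proof -
    have A: "A \<inter> space L \<in> sets L" using measurable_sets[OF id that] by simp
    have "integrable L (\<lambda>x. indicator (A \<inter> space L) x *\<^sub>R q x)" by (rule integrable_mult_indicator[OF A q(1)])
    then show ?thesis by (rule Bochner_Integration.integrable_cong[THEN iffD1, rotated -1]) (auto simp: indicator_def)
  qed
  have mQ: "emeasure Q A = ennreal (\<integral>x. indicator A x * q x \<partial>L)" if "A \<in> sets borel" for A
    unfolding eQ[OF that] using ind[OF that] q(2) by (intro nn_integral_eq_integral) auto
  have "finite_measure Q"
    by (rule finite_measureI) (simp add: sets_eq_imp_space_eq[OF sQ] mQ)
  then interpret finite_measure Q .
  have fin: "emeasure Q (space Q) \<noteq> \<infinity>" by simp
  have mm: "measure Q A = (\<integral>x. indicator A x * q x \<partial>L)" if "A \<in> sets borel" for A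
    using mQ[OF that] q(2) by (simp add: measure_def integral_nonneg)
  have "\<exists>C\<in>{K. K \<subseteq> E \<and> compact K}. emeasure Q E < emeasure Q C + ennreal (e/2)"
    using e by (intro SUP_approx_ennreal[OF _ _ inner_regular[OF sQ fin E]]) auto
  then obtain C where C: "C \<subseteq> E" "compact C" "emeasure Q E < emeasure Q C + ennreal (e/2)" by blast
  have "\<exists>U\<in>{U. E \<subseteq> U \<and> open U}. emeasure Q U < emeasure Q E + ennreal (e/2)"
    using e by (intro INF_approx_ennreal[OF _ outer_regular[OF sQ fin E]]) auto
  then obtain U where U: "E \<subseteq> U" "open U" "emeasure Q U < emeasure Q E + ennreal (e/2)" by blast
  have bor: "C \<in> sets borel" "U \<in> sets borel" using C U by (auto intro: borel_compact)
  have "measure Q E < measure Q C + e/2" "measure Q U < measure Q E + e/2"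
    using C(3) U(3) e by (auto simp: emeasure_eq_measure ennreal_plus[symmetric] ennreal_less_iff simp del: ennreal_plus)
  moreover have "measure Q (U - C) = measure Q U - measure Q C"
    using C U bor by (intro finite_measure_Diff) (auto simp: sQ)
  ultimately have "measure Q (U - C) < e" by simp
  then have "(\<integral>x. indicator (U - C) x * q x \<partial>L) < e" using mm[of "U - C"] bor by simp
  then show ?thesis using C(1,2) U(1,2) by blast
qed

lemma Urysohn_indicator:
  fixes C U E :: "'a::euclidean_space set"
  assumes "compact C" "open U" "C \<subseteq> E" "E \<subseteq> U"
  obtains \<eta> :: "'a \<Rightarrow> real" where "continuous_on UNIV \<eta>" "\<And>x. 0 \<le> \<eta> x" "\<And>x. \<eta> x \<le> 1"
    "\<And>x. \<bar>\<eta> x - indicator E x\<bar> \<le> indicator (U - C) x"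
proof -
  obtain \<eta> :: "'a \<Rightarrow> real" where \<eta>: "continuous_on UNIV \<eta>" "\<And>x. \<eta> x \<in> closed_segment 1 0"
    "\<And>x. x \<in> C \<Longrightarrow> \<eta> x = 1" "\<And>x. x \<in> - U \<Longrightarrow> \<eta> x = 0"
    using Urysohn[of C "- U" 1 "0::real"] assms compact_imp_closed[of C] by blast
  have r: "0 \<le> \<eta> x \<and> \<eta> x \<le> 1" for x using \<eta>(2)[of x] by (auto simp: closed_segment_eq_real_ivl)
  show ?thesis
  proof (rule that[OF \<eta>(1)])
    show "\<bar>\<eta> x - indicator E x\<bar> \<le> indicator (U - C) x" for x
      using r[of x] \<eta>(3)[of x] \<eta>(4)[of x] assms(3,4) by (auto simp: indicator_def)
  qed (use r in auto)
qed

text \<open>A single \<eta> has to work for both measures. The union of the inner compact sets and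
  the intersection of the outer open sets still enclose \<open>E\<close>, and the region of
  disagreement lies in each of the two differences.\<close>

lemma continuous_approx_indicator2:
  fixes q\<^sub>1 q\<^sub>2 :: "'a::euclidean_space \<Rightarrow> real"
  assumes L: "sets L\<^sub>1 = borel_on \<Omega>" "sets L\<^sub>2 = borel_on \<Omega>"
    and q: "integrable L\<^sub>1 q\<^sub>1" "integrable L\<^sub>2 q\<^sub>2" "\<And>x. 0 \<le> q\<^sub>1 x" "\<And>x. 0 \<le> q\<^sub>2 x"
    and E: "E \<in> sets borel" and e: "0 < e"
  obtains \<eta> :: "'a \<Rightarrow> real" where "continuous_on UNIV \<eta>" "\<And>x. 0 \<le> \<eta> x" "\<And>x. \<eta> x \<le> 1"
    "(\<integral>x. \<bar>\<eta> x - indicator E x\<bar> * q\<^sub>1 x \<partial>L\<^sub>1) < e" "(\<integral>x. \<bar>\<eta> x - indicator E x\<bar> * q\<^sub>2 x \<partial>L\<^sub>2) < e"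
proof -
  obtain C\<^sub>1 U\<^sub>1 where 1: "compact C\<^sub>1" "open U\<^sub>1" "C\<^sub>1 \<subseteq> E" "E \<subseteq> U\<^sub>1" "(\<integral>x. indicator (U\<^sub>1 - C\<^sub>1) x * q\<^sub>1 x \<partial>L\<^sub>1) < e"
    using regular_sandwich[OF L(1) q(1,3) E e] by auto
  obtain C\<^sub>2 U\<^sub>2 where 2: "compact C\<^sub>2" "open U\<^sub>2" "C\<^sub>2 \<subseteq> E" "E \<subseteq> U\<^sub>2" "(\<integral>x. indicator (U\<^sub>2 - C\<^sub>2) x * q\<^sub>2 x \<partial>L\<^sub>2) < e"
    using regular_sandwich[OF L(2) q(2,4) E e] by auto
  obtain \<eta> :: "'a \<Rightarrow> real" where \<eta>: "continuous_on UNIV \<eta>" "\<And>x. 0 \<le> \<eta> x" "\<And>x. \<eta> x \<le> 1"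
    "\<And>x. \<bar>\<eta> x - indicator E x\<bar> \<le> indicator ((U\<^sub>1 \<inter> U\<^sub>2) - (C\<^sub>1 \<union> C\<^sub>2)) x"
    using Urysohn_indicator[of "C\<^sub>1 \<union> C\<^sub>2" "U\<^sub>1 \<inter> U\<^sub>2" E] 1(1-4) 2(1-4) by blast
  have le: "(\<integral>x. \<bar>\<eta> x - indicator E x\<bar> * q x \<partial>L) \<le> (\<integral>x. indicator (U - C) x * q x \<partial>L)"
    if L: "sets L = borel_on \<Omega>" and q: "integrable L q" "\<And>x. 0 \<le> q x" and UC: "U - C \<in> sets borel"
      "(U\<^sub>1 \<inter> U\<^sub>2) - (C\<^sub>1 \<union> C\<^sub>2) \<subseteq> U - C" for L :: "'a measure" and q U C
  proof (rule integral_mono')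
    have id: "(\<lambda>x. x) \<in> measurable L borel" by (rule measurable_ident_borel_on[OF L])
    have A: "(U - C) \<inter> space L \<in> sets L" using measurable_sets[OF id UC(1)] by simp
    have "integrable L (\<lambda>x. indicator ((U - C) \<inter> space L) x *\<^sub>R q x)" by (rule integrable_mult_indicator[OF A q(1)])
    then show "integrable L (\<lambda>x. indicator (U - C) x * q x)"
      by (rule Bochner_Integration.integrable_cong[THEN iffD1, rotated -1]) (auto simp: indicator_def)
    fix x
    have "\<bar>\<eta> x - indicator E x\<bar> \<le> indicator (U - C) x"
      by (rule order_trans[OF \<eta>(4)]) (use UC(2) in \<open>auto simp: indicator_def\<close>)
    then show "\<bar>\<eta> x - indicator E x\<bar> * q x \<le> indicator (U - C) x * q x" using q(2) by (rule mult_right_mono)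
    show "0 \<le> indicator (U - C) x * q x" using q(2) by simp
  qed
  have b: "U\<^sub>1 - C\<^sub>1 \<in> sets borel" "U\<^sub>2 - C\<^sub>2 \<in> sets borel" 
    using 1(1,2) 2(1,2) by (auto intro: borel_compact)
  have s: "U\<^sub>1 \<inter> U\<^sub>2 - (C\<^sub>1 \<union> C\<^sub>2) \<subseteq> U\<^sub>1 - C\<^sub>1" "U\<^sub>1 \<inter> U\<^sub>2 - (C\<^sub>1 \<union> C\<^sub>2) \<subseteq> U\<^sub>2 - C\<^sub>2"
    by auto
  show ?thesis
    by (rule that[OF \<eta>(1-3) le_less_trans[OF le[OF L(1) q(1,3) b(1) s(1)] 1(5)]
      le_less_trans[OF le[OF L(2) q(2,4) b(2) s(2)] 2(5)]])
qed

text \<open>Multiples of indicators are the case that needs an argument. The inner compact set comes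
  from the finite measure with density \<open>indicator A\<close>; the outer open set comes from the
  outer regularity of Lebesgue measure itself, as \<Omega> may have infinite measure.\<close>

lemma continuous_dense_L1:
  fixes u :: "'a::euclidean_space \<Rightarrow> 'b::euclidean_space"
  assumes "open \<Omega>" "integrable (leb_on \<Omega>) u" "0 < e"
  shows "\<exists>w. continuous_on UNIV w \<and> integrable (leb_on \<Omega>) w \<and> (\<integral>x. norm (u x - w x) \<partial>leb_on \<Omega>) < e"
  using assms(2,3)
proof (induction arbitrary: e rule: integrable_induct)
  case (base A c)
  let ?L = "leb_on \<Omega>"
  have A: "A \<in> borel_on \<Omega>" "A \<in> sets borel" using base(1) borel_on_borel[OF assms(1)] by (auto simp: sets_leb_on)
  \<comment> \<open>The factor 2 accounts for the inner and the outer error; the added 1 covers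
    \<open>c = 0\<close>.\<close>
  define e' where "e' = e / (2 * (norm c + 1))"
  have e': "0 < e'" using base(3) by (simp add: e'_def add_nonneg_pos)
  have iA: "integrable ?L (indicator A :: 'a \<Rightarrow> real)" using base(1,2) by (intro integrable_real_indicator) auto
  obtain C U' where C: "compact C" "C \<subseteq> A" "A \<subseteq> U'" "open U'" "(\<integral>x. indicator (U' - C) x * indicator A x \<partial>?L) < e'"
    using regular_sandwich[OF sets_leb_on iA _ A(2) e'] by auto
  obtain U where U: "open U" "A \<subseteq> U" "emeasure lborel (U - A) < ennreal e'"
    using outer_regular_lborel[OF A(2), of e'] e' by auto
  obtain \<eta> :: "'a \<Rightarrow> real" where \<eta>: "continuous_on UNIV \<eta>" "\<And>x. 0 \<le> \<eta> x" "\<And>x. \<eta> x \<le> 1"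
    "\<And>x. \<bar>\<eta> x - indicator A x\<bar> \<le> indicator (U - C) x"
    using Urysohn_indicator[OF C(1) U(1) C(2) U(2)] by blast
  have [measurable]: "\<eta> \<in> borel_measurable ?L"
    using \<eta>(1) by (intro measurable_restrict_space1) (simp add: borel_measurable_continuous_onI)
  have [measurable]: "A \<in> sets ?L" using base(1) .
  have meas: "\<Omega> \<inter> (U - A) \<in> sets ?L" "\<Omega> \<inter> (A - C) \<in> sets ?L"
    using A U(1) C(1) borel_compact[OF C(1)] by (auto simp: sets_restrict_space)
  have fin: "emeasure ?L (\<Omega> \<inter> (U - A)) < ennreal e'"
  proof -
    have "emeasure ?L (\<Omega> \<inter> (U - A)) = emeasure lborel (\<Omega> \<inter> (U - A))"
      using meas by (intro emeasure_leb_on assms) (simp add: sets_leb_on)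
    also have "\<dots> \<le> emeasure lborel (U - A)" using U(1) A by (intro emeasure_mono) auto
    finally show ?thesis using U(3) by simp
  qed
  have iUA: "integrable ?L (indicator (\<Omega> \<inter> (U - A)) :: 'a \<Rightarrow> real)"
    using meas fin by (intro integrable_real_indicator) (auto intro: less_trans)
  have mUA: "(\<integral>x. indicator (\<Omega> \<inter> (U - A)) x \<partial>?L) < e'"
    using fin e' meas sets.sets_into_space[OF meas(1)]
    by (simp add: Int_absorb2 measure_def) (metis enn2real_ennreal enn2real_less_iff ennreal_less_top less_imp_le less_trans order_less_imp_le)
  have iAC: "integrable ?L (\<lambda>x. indicator (U' - C) x * indicator A x :: real)"
  proof -
    have "integrable ?L (\<lambda>x. indicator (\<Omega> \<inter> (A - C)) x *\<^sub>R (indicator A x :: real))"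
      by (rule integrable_mult_indicator[OF meas(2) iA])
    then show ?thesis
      by (rule Bochner_Integration.integrable_cong[THEN iffD1, rotated -1]) (use C(3) in \<open>auto simp: indicator_def space_leb_on\<close>)
  qed
  have dom: "\<bar>\<eta> x - indicator A x\<bar> \<le> indicator (\<Omega> \<inter> (U - A)) x + indicator (U' - C) x * indicator A x" if "x \<in> \<Omega>" for x
    by (rule order_trans[OF \<eta>(4)]) (use C(3) that in \<open>auto simp: indicator_def\<close>)
  have int: "integrable ?L (\<lambda>x. \<eta> x - indicator A x)"
  proof (rule Bochner_Integration.integrable_bound)
    show "integrable ?L (\<lambda>x. indicator (\<Omega> \<inter> (U - A)) x + indicator (U' - C) x * indicator A x :: real)"
      using iUA iAC by simp
    show "AE x in ?L. norm (\<eta> x - indicator A x) \<le> norm (indicator (\<Omega> \<inter> (U - A)) x + indicator (U' - C) x * indicator A x :: real)"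
      using dom by (intro AE_I2) (force simp: space_leb_on)
  qed measurable
  have "(\<integral>x. \<bar>\<eta> x - indicator A x\<bar> \<partial>?L) \<le> (\<integral>x. indicator (\<Omega> \<inter> (U - A)) x + indicator (U' - C) x * indicator A x \<partial>?L)"
    using int iUA iAC dom by (intro integral_mono) (auto simp: space_leb_on)
  also have "\<dots> < 2 * e'" using iUA iAC mUA C(5) by simp
  finally have lt: "(\<integral>x. \<bar>\<eta> x - indicator A x\<bar> \<partial>?L) < 2 * e'" .
  have "integrable ?L (\<lambda>x. (\<eta> x - indicator A x) + indicator A x)" using int iA by (rule Bochner_Integration.integrable_add)
  then have i\<eta>: "integrable ?L \<eta>" by simp
  have "(\<integral>x. norm (indicator A x *\<^sub>R c - \<eta> x *\<^sub>R c) \<partial>?L) = (\<integral>x. norm c * \<bar>\<eta> x - indicator A x\<bar> \<partial>?L)"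
    by (intro Bochner_Integration.integral_cong refl) (simp add: scaleR_diff_left[symmetric] abs_minus_commute mult.commute)
  also have "\<dots> = norm c * (\<integral>x. \<bar>\<eta> x - indicator A x\<bar> \<partial>?L)" by simp
  also have "\<dots> \<le> norm c * (2 * e')" using lt by (intro mult_left_mono) auto
  also have "\<dots> < e"
  proof -
    have "norm c < norm c + 1" by simp
    then have "norm c * e < e * (norm c + 1)" using base(3) by (simp add: mult.commute)
    then show ?thesis using base(3) by (simp add: e'_def pos_divide_less_eq add_nonneg_pos mult.commute)
  qed
  finally have "(\<integral>x. norm (indicator A x *\<^sub>R c - \<eta> x *\<^sub>R c) \<partial>?L) < e" .
  moreover have "continuous_on UNIV (\<lambda>x. \<eta> x *\<^sub>R c)" using \<eta>(1) by (intro continuous_intros)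
  moreover have "integrable ?L (\<lambda>x. \<eta> x *\<^sub>R c)" using i\<eta> by simp
  ultimately show ?case by blast
next
  case (add f g)
  let ?L = "leb_on \<Omega>"
  obtain w where w: "continuous_on UNIV w" "integrable ?L w" "(\<integral>x. norm (f x - w x) \<partial>?L) < e/2"
    using add.IH(1)[of "e/2"] add.prems by auto
  obtain w' where w': "continuous_on UNIV w'" "integrable ?L w'" "(\<integral>x. norm (g x - w' x) \<partial>?L) < e/2"
    using add.IH(2)[of "e/2"] add.prems by auto
  have "(\<integral>x. norm (f x + g x - (w x + w' x)) \<partial>?L) \<le> (\<integral>x. norm (f x - w x) + norm (g x - w' x) \<partial>?L)"
    using w(2) w'(2) add.hyps by (intro integral_mono) (auto simp: add_diff_add norm_triangle_ineq)
  also have "\<dots> < e" using w w' add.hyps by simp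
  finally show ?case using w w' by (intro exI[of _ "\<lambda>x. w x + w' x"]) (auto intro: continuous_intros)
next
  case (lim f s)
  let ?L = "leb_on \<Omega>"
  have "(\<lambda>i. \<integral>x. norm (f x - s i x) \<partial>?L) \<longlonglongrightarrow> (\<integral>x. norm (f x - f x) \<partial>?L)"
  proof (rule integral_dominated_convergence[where w = "\<lambda>x. 3 * norm (f x)"])
    show "integrable ?L (\<lambda>x. 3 * norm (f x))" using lim.hyps by simp
    show "AE x in ?L. (\<lambda>i. norm (f x - s i x)) \<longlonglongrightarrow> norm (f x - f x)"
      using lim.hyps by (intro AE_I2 tendsto_intros) auto
    show "AE x in ?L. norm (norm (f x - s i x)) \<le> 3 * norm (f x)" for i
    proof (rule AE_I2)
      fix x assume x: "x \<in> space ?L"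
      have "norm (f x - s i x) \<le> norm (f x) + norm (s i x)" by (rule norm_triangle_ineq4)
      then show "norm (norm (f x - s i x)) \<le> 3 * norm (f x)" using lim.hyps(3)[OF x, of i] by simp
    qed
  qed (use lim.hyps in auto)
  then have "(\<lambda>i. \<integral>x. norm (f x - s i x) \<partial>?L) \<longlonglongrightarrow> 0" by simp
  then have "eventually (\<lambda>i. (\<integral>x. norm (f x - s i x) \<partial>?L) < e/2) sequentially"
    using lim.prems by (intro order_tendstoD) auto
  then obtain i where i: "(\<integral>x. norm (f x - s i x) \<partial>?L) < e/2" by (auto simp: eventually_sequentially)
  obtain w where w: "continuous_on UNIV w" "integrable ?L w" "(\<integral>x. norm (s i x - w x) \<partial>?L) < e/2"
    using lim.IH[of "e/2" i] lim.prems by auto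
  have "(\<integral>x. norm (f x - w x) \<partial>?L) \<le> (\<integral>x. norm (f x - s i x) + norm (s i x - w x) \<partial>?L)"
    using w(2) lim.hyps by (intro integral_mono) (auto intro: norm_diff_triangle_le)
  also have "\<dots> < e" using w lim.hyps i by simp
  finally show ?case using w by blast
qed

section \<open>Lower semicontinuity for suprema of affine integrands\<close>

text \<open>For negative \<open>y\<close> the truncation of \<open>ennreal\<close> at 0 only raises
  the right side. The case occurs because integrals of affine minorants may be negative.\<close>

lemma ennreal_plus_le: "0 \<le> e \<Longrightarrow> ennreal (y + e) \<le> ennreal y + ennreal e"
proof (cases "0 \<le> y")
  case False
  assume "0 \<le> e"
  have "ennreal (y + e) \<le> ennreal e" using False by (intro ennreal_leI) simp
  also have "\<dots> = ennreal y + ennreal e" using False by (simp add: ennreal_neg)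
  finally show ?thesis .
qed simp

text \<open>Exactly what weak* convergence can handle: a bounded continuous slope is an admissible
  test field, and an integrable offset has a finite integral even if \<Omega> has infinite
  measure.\<close>

definition affine_minorant ::
  "'a::euclidean_space set \<Rightarrow> ('a \<Rightarrow> 'b::euclidean_space \<Rightarrow> real) \<Rightarrow> ('a \<Rightarrow> real) \<Rightarrow> ('a \<Rightarrow> 'b) \<Rightarrow> bool" where
  "affine_minorant \<Omega> \<Phi> \<alpha> \<beta> \<longleftrightarrow> integrable (leb_on \<Omega>) \<alpha> \<and> continuous_on \<Omega> \<beta> \<and> bounded (\<beta> ` \<Omega>) \<and>
     (\<forall>x\<in>\<Omega>. \<forall>z. \<alpha> x + \<beta> x \<bullet> z \<le> \<Phi> x z)"

lemma affine_minorant_zero: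
  assumes "\<And>x z. x \<in> \<Omega> \<Longrightarrow> 0 \<le> \<Phi> x z"
  shows "affine_minorant \<Omega> \<Phi> (\<lambda>x. 0) (\<lambda>x. 0)"
  using assms by (auto simp: affine_minorant_def bounded_iff)

lemma borel_measurable_continuous_borel_on:
  fixes \<eta> :: "'a::euclidean_space \<Rightarrow> 'b::topological_space"
  assumes "continuous_on \<Omega> \<eta>" "sets L = borel_on \<Omega>"
  shows "\<eta> \<in> borel_measurable L"
  using borel_measurable_continuous_on_restrict[OF assms(1)] measurable_cong_sets[OF assms(2) refl] by blast

text \<open>At each point both affine functions lie below \<Phi>, so they may be averaged with a
  weight that depends on the point; a continuous weight keeps the slope continuous. Such mixtures
  stand in for pointwise maxima, which are not affine in \<open>z\<close>.\<close>

lemma affine_minorant_mix: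
  fixes \<Omega> :: "'a::euclidean_space set"
  assumes 1: "affine_minorant \<Omega> \<Phi> \<alpha> \<beta>" and 2: "affine_minorant \<Omega> \<Phi> \<alpha>' \<beta>'"
    and \<eta>: "continuous_on UNIV \<eta>" "\<And>x. 0 \<le> \<eta> x" "\<And>x. \<eta> x \<le> (1::real)"
  shows "affine_minorant \<Omega> \<Phi> (\<lambda>x. (1 - \<eta> x) * \<alpha> x + \<eta> x * \<alpha>' x) (\<lambda>x. (1 - \<eta> x) *\<^sub>R \<beta> x + \<eta> x *\<^sub>R \<beta>' x)"
  unfolding affine_minorant_def
proof (intro conjI ballI allI)
  have \<eta>': "continuous_on \<Omega> \<eta>" using \<eta>(1) continuous_on_subset by blast
  have [measurable]: "\<eta> \<in> borel_measurable (leb_on \<Omega>)"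
    by (rule borel_measurable_continuous_borel_on[OF \<eta>' sets_leb_on])
  have i: "integrable (leb_on \<Omega>) \<alpha>" "integrable (leb_on \<Omega>) \<alpha>'" using 1 2 by (auto simp: affine_minorant_def)
  then have [measurable]: "\<alpha> \<in> borel_measurable (leb_on \<Omega>)" "\<alpha>' \<in> borel_measurable (leb_on \<Omega>)" by auto
  have "norm ((1 - \<eta> x) * \<alpha> x) \<le> norm (\<alpha> x)" "norm (\<eta> x * \<alpha>' x) \<le> norm (\<alpha>' x)" for x
    using \<eta>(2,3)[of x] by (auto simp: abs_mult intro: mult_left_le_one_le)
  note b = this
  have "integrable (leb_on \<Omega>) (\<lambda>x. (1 - \<eta> x) * \<alpha> x)"
    using b(1) by (intro Bochner_Integration.integrable_bound[OF i(1)]) auto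
  moreover have "integrable (leb_on \<Omega>) (\<lambda>x. \<eta> x * \<alpha>' x)"
    using b(2) by (intro Bochner_Integration.integrable_bound[OF i(2)]) auto
  ultimately show "integrable (leb_on \<Omega>) (\<lambda>x. (1 - \<eta> x) * \<alpha> x + \<eta> x * \<alpha>' x)" by simp
  show "continuous_on \<Omega> (\<lambda>x. (1 - \<eta> x) *\<^sub>R \<beta> x + \<eta> x *\<^sub>R \<beta>' x)"
    using 1 2 \<eta>' by (intro continuous_intros) (auto simp: affine_minorant_def)
  obtain B B' where B: "\<And>x. x \<in> \<Omega> \<Longrightarrow> norm (\<beta> x) \<le> B" "\<And>x. x \<in> \<Omega> \<Longrightarrow> norm (\<beta>' x) \<le> B'"
    using 1 2 unfolding affine_minorant_def bounded_iff by (metis imageI)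
  have "norm ((1 - \<eta> x) *\<^sub>R \<beta> x + \<eta> x *\<^sub>R \<beta>' x) \<le> B + B'" if "x \<in> \<Omega>" for x
  proof -
    have "norm ((1 - \<eta> x) *\<^sub>R \<beta> x) \<le> norm (\<beta> x)" "norm (\<eta> x *\<^sub>R \<beta>' x) \<le> norm (\<beta>' x)"
      using \<eta>(2,3)[of x] by (auto intro: mult_left_le_one_le)
    then show ?thesis
      using B[OF that] norm_triangle_ineq[of "(1 - \<eta> x) *\<^sub>R \<beta> x" "\<eta> x *\<^sub>R \<beta>' x"] by linarith
  qed
  then show "bounded ((\<lambda>x. (1 - \<eta> x) *\<^sub>R \<beta> x + \<eta> x *\<^sub>R \<beta>' x) ` \<Omega>)" unfolding bounded_iff by blast
  fix x z assume x: "x \<in> \<Omega>"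
  have "(1 - \<eta> x) * (\<alpha> x + \<beta> x \<bullet> z) + \<eta> x * (\<alpha>' x + \<beta>' x \<bullet> z) \<le> (1 - \<eta> x) * \<Phi> x z + \<eta> x * \<Phi> x z"
    using 1 2 x \<eta>(2,3)[of x] by (intro add_mono mult_left_mono) (auto simp: affine_minorant_def)
  then show "(1 - \<eta> x) * \<alpha> x + \<eta> x * \<alpha>' x + ((1 - \<eta> x) *\<^sub>R \<beta> x + \<eta> x *\<^sub>R \<beta>' x) \<bullet> z \<le> \<Phi> x z"
    by (simp add: algebra_simps)
qed

lemma integrable_bounded_inner:
  fixes g :: "'a::euclidean_space \<Rightarrow> 'b::euclidean_space"
  assumes L: "sets L = borel_on \<Omega>" and g: "integrable L g" and b: "continuous_on \<Omega> \<beta>" "bounded (\<beta> ` \<Omega>)"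
  shows "integrable L (\<lambda>x. \<beta> x \<bullet> g x)"
proof -
  obtain B where B: "\<And>x. x \<in> \<Omega> \<Longrightarrow> norm (\<beta> x) \<le> B" using b(2) by (auto simp: bounded_iff)
  have [measurable]: "\<beta> \<in> borel_measurable L" "g \<in> borel_measurable L"
    using borel_measurable_continuous_borel_on[OF b(1) L] g by auto
  have sp: "space L = \<Omega>" using sets_eq_imp_space_eq[OF L] by (simp add: space_restrict_space)
  show ?thesis
  proof (rule Bochner_Integration.integrable_bound)
    show "integrable L (\<lambda>x. B * norm (g x))" using g by simp
    show "AE x in L. norm (\<beta> x \<bullet> g x) \<le> norm (B * norm (g x))"
    proof (rule AE_I2)
      fix x assume "x \<in> space L"
      then have "norm (\<beta> x) \<le> B" using B sp by simp
      then have "norm (\<beta> x) * norm (g x) \<le> B * norm (g x)" by (intro mult_right_mono) auto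
      moreover have "norm (\<beta> x \<bullet> g x) \<le> norm (\<beta> x) * norm (g x)" by (simp add: Cauchy_Schwarz_ineq2)
      ultimately show "norm (\<beta> x \<bullet> g x) \<le> norm (B * norm (g x))" by simp
    qed
  qed measurable
qed

text \<open>Starting at 0, the value of the zero minorant, makes every stage nonnegative, so that
  \<open>ennreal\<close> loses nothing.\<close>

primrec running_max :: "(nat \<Rightarrow> 'a \<Rightarrow> real) \<Rightarrow> nat \<Rightarrow> 'a \<Rightarrow> real" where
  "running_max h 0 x = 0"
| "running_max h (Suc n) x = max (running_max h n x) (h n x)"

lemma running_max_nonneg: "0 \<le> running_max h n x"
  by (induction n) auto

lemma running_max_mono: "m \<le> n \<Longrightarrow> running_max h m x \<le> running_max h n x"
  by (rule lift_Suc_mono_le) auto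

lemma integrable_running_max: "(\<And>k. integrable L (h k)) \<Longrightarrow> integrable L (running_max h n)"
proof (induction n)
  case (Suc n)
  then have "integrable L (\<lambda>x. max (running_max h n x) (h n x))" by auto
  then show ?case by (simp cong: Bochner_Integration.integrable_cong)
qed (simp cong: Bochner_Integration.integrable_cong)

text \<open>With the indicator of \<open>g < h\<close> as weight the mixture is exactly
  \<open>max g h\<close>. The last term is the price of another weight \<open>t\<close>, the first
  that of \<open>g\<close> in place of \<open>H\<close>.\<close>

lemma max_mix_le:
  fixes H g h :: real
  shows "\<bar>max H h - ((1 - t) * g + t * h)\<bar> \<le> \<bar>H - g\<bar> + \<bar>t - (if g < h then 1 else 0)\<bar> * \<bar>h - g\<bar>"
proof -
  have "\<bar>max H h - max g h\<bar> \<le> \<bar>H - g\<bar>" by linarith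
  moreover have "max g h = g + (if g < h then 1 else 0) * (h - g)" by simp
  then have "max g h - ((1 - t) * g + t * h) = - ((t - (if g < h then 1 else 0)) * (h - g))"
    by (simp add: algebra_simps)
  then have "\<bar>max g h - ((1 - t) * g + t * h)\<bar> = \<bar>t - (if g < h then 1 else 0)\<bar> * \<bar>h - g\<bar>"
    by (metis abs_minus_cancel abs_mult)
  ultimately show ?thesis by linarith
qed

text \<open>By induction, the next maximum is approximated by a mixture of the previous approximant
  with the new minorant, the weight being continuous and close to the indicator of the set where the
  new one is larger. One weight serves both measures although they compare different quantities,
  because they live on disjoint sets.\<close>

lemma affine_minorant_approx_max:
  fixes \<Omega> :: "'a::euclidean_space set" and a p :: "'a \<Rightarrow> 'b::euclidean_space"
  assumes \<Omega>: "open \<Omega>" and \<Phi>0: "\<And>x z. x \<in> \<Omega> \<Longrightarrow> 0 \<le> \<Phi> x z"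
    and minor: "\<And>k. affine_minorant \<Omega> \<Phi> (\<alpha> k) (\<beta> k)"
    and a: "integrable (leb_on \<Omega>) a" and S: "sets S = borel_on \<Omega>" and p: "integrable S p"
    and N: "N \<in> borel_on \<Omega>" "AE x in leb_on \<Omega>. x \<notin> N" "AE x in S. x \<in> N"
    and e: "0 < (e::real)"
  shows "\<exists>A B. affine_minorant \<Omega> \<Phi> A B \<and>
     (\<integral>x. \<bar>running_max (\<lambda>k x. \<alpha> k x + \<beta> k x \<bullet> a x) n x - (A x + B x \<bullet> a x)\<bar> \<partial>leb_on \<Omega>) < e \<and>
     (\<integral>x. \<bar>running_max (\<lambda>k x. \<beta> k x \<bullet> p x) n x - B x \<bullet> p x\<bar> \<partial>S) < e"
  using e
proof (induction n arbitrary: e)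
  case 0
  then show ?case using affine_minorant_zero[of \<Omega> \<Phi>] \<Phi>0
    by (intro exI[of _ "\<lambda>x. 0"]) auto
next
  case (Suc n)
  let ?L = "leb_on \<Omega>"
  define H where "H = running_max (\<lambda>k x. \<alpha> k x + \<beta> k x \<bullet> a x) n"
  define G where "G = running_max (\<lambda>k x. \<beta> k x \<bullet> p x) n"
  from Suc.IH[of "e/2"] Suc.prems obtain A B where AB: "affine_minorant \<Omega> \<Phi> A B"
    "(\<integral>x. \<bar>H x - (A x + B x \<bullet> a x)\<bar> \<partial>?L) < e/2" "(\<integral>x. \<bar>G x - B x \<bullet> p x\<bar> \<partial>S) < e/2"
    unfolding H_def G_def by auto
  have int: "integrable ?L (\<lambda>x. A x + B x \<bullet> a x)" "integrable S (\<lambda>x. B x \<bullet> p x)"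
    if "affine_minorant \<Omega> \<Phi> A B" for A B
    using that integrable_bounded_inner[OF sets_leb_on a] integrable_bounded_inner[OF S p]
    by (auto simp: affine_minorant_def)
  have iH: "integrable ?L H" unfolding H_def using int[OF minor] by (intro integrable_running_max) auto
  have iG: "integrable S G" unfolding G_def using int[OF minor] by (intro integrable_running_max) auto
  define g where "g x = A x + B x \<bullet> a x" for x
  define h where "h x = \<alpha> n x + \<beta> n x \<bullet> a x" for x
  define g' where "g' x = B x \<bullet> p x" for x
  define h' where "h' x = \<beta> n x \<bullet> p x" for x
  have i: "integrable ?L g" "integrable ?L h" "integrable S g'" "integrable S h'"
    unfolding g_def h_def g'_def h'_def using int[OF AB(1)] int[OF minor[of n]] by auto
  have [measurable]: "g \<in> borel_measurable ?L" "h \<in> borel_measurable ?L" "g' \<in> borel_measurable S" "h' \<in> borel_measurable S"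
    using i by auto
  \<comment> \<open>Off \<open>N\<close> the set compares the affine functions at \<open>a\<close>,
    on \<open>N\<close> their slopes along \<open>p\<close>; each measure sees only its own
    half.\<close>
  define E where "E = ({x \<in> space ?L. g x < h x} - N) \<union> ({x \<in> space S. g' x < h' x} \<inter> N)"
  have sp: "space S = \<Omega>" using sets_eq_imp_space_eq[OF S] by (simp add: space_restrict_space)
  have "{x \<in> space ?L. g x < h x} \<in> sets ?L" "{x \<in> space S. g' x < h' x} \<in> sets S" by measurable
  then have "E \<in> borel_on \<Omega>" unfolding E_def using N(1) S sets_leb_on[of \<Omega>] by auto
  then have E: "E \<in> sets borel" by (rule borel_on_borel[OF \<Omega>])
  obtain \<eta> :: "'a \<Rightarrow> real" where \<eta>: "continuous_on UNIV \<eta>" "\<And>x. 0 \<le> \<eta> x" "\<And>x. \<eta> x \<le> 1"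
    "(\<integral>x. \<bar>\<eta> x - indicator E x\<bar> * \<bar>h x - g x\<bar> \<partial>?L) < e/2" "(\<integral>x. \<bar>\<eta> x - indicator E x\<bar> * \<bar>h' x - g' x\<bar> \<partial>S) < e/2"
    by (rule continuous_approx_indicator2[OF sets_leb_on S _ _ _ _ E, of "\<lambda>x. \<bar>h x - g x\<bar>" "\<lambda>x. \<bar>h' x - g' x\<bar>" "e/2"])
      (use i Suc.prems in auto)
  have \<eta>': "continuous_on \<Omega> \<eta>" using \<eta>(1) continuous_on_subset by blast
  let ?A = "\<lambda>x. (1 - \<eta> x) * A x + \<eta> x * \<alpha> n x" and ?B = "\<lambda>x. (1 - \<eta> x) *\<^sub>R B x + \<eta> x *\<^sub>R \<beta> n x"
  have mix: "affine_minorant \<Omega> \<Phi> ?A ?B" by (rule affine_minorant_mix[OF AB(1) minor \<eta>(1-3)])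
  have key: "(\<integral>x. \<bar>max (F x) (k x) - ((1 - \<eta> x) * l x + \<eta> x * k x)\<bar> \<partial>L) < e"
    if L: "sets L = borel_on \<Omega>" and il: "integrable L l" and ik: "integrable L k" and iF: "integrable L F"
      and 1: "(\<integral>x. \<bar>F x - l x\<bar> \<partial>L) < e/2" and 2: "(\<integral>x. \<bar>\<eta> x - indicator E x\<bar> * \<bar>k x - l x\<bar> \<partial>L) < e/2"
      and ae: "AE x in L. indicator E x = (if l x < k x then 1 else 0 :: real)" for L :: "'a measure" and l k F
  proof -
    have [measurable]: "\<eta> \<in> borel_measurable L" by (rule borel_measurable_continuous_borel_on[OF \<eta>' L])
    have [measurable]: "l \<in> borel_measurable L" "k \<in> borel_measurable L" using il ik by auto
    have [measurable]: "E \<in> sets L" using \<open>E \<in> borel_on \<Omega>\<close> L by simp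
    have i2: "integrable L (\<lambda>x. \<bar>\<eta> x - indicator E x\<bar> * \<bar>k x - l x\<bar>)"
    proof (rule Bochner_Integration.integrable_bound)
      show "integrable L (\<lambda>x. k x - l x)" using il ik by simp
      show "AE x in L. norm (\<bar>\<eta> x - indicator E x\<bar> * \<bar>k x - l x\<bar>) \<le> norm (k x - l x)"
      proof (rule AE_I2)
        fix x
        have "\<bar>\<eta> x - indicator E x\<bar> \<le> 1" using \<eta>(2,3)[of x] by (auto simp: indicator_def)
        then show "norm (\<bar>\<eta> x - indicator E x\<bar> * \<bar>k x - l x\<bar>) \<le> norm (k x - l x)"
          by (simp add: abs_mult mult_left_le_one_le)
      qed
    qed measurable
    have "(\<integral>x. \<bar>max (F x) (k x) - ((1 - \<eta> x) * l x + \<eta> x * k x)\<bar> \<partial>L)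
        \<le> (\<integral>x. \<bar>F x - l x\<bar> + \<bar>\<eta> x - indicator E x\<bar> * \<bar>k x - l x\<bar> \<partial>L)"
    proof (rule integral_mono_AE')
      show "integrable L (\<lambda>x. \<bar>F x - l x\<bar> + \<bar>\<eta> x - indicator E x\<bar> * \<bar>k x - l x\<bar>)"
        using i2 il iF by auto
      show "AE x in L. \<bar>max (F x) (k x) - ((1 - \<eta> x) * l x + \<eta> x * k x)\<bar> \<le> \<bar>F x - l x\<bar> + \<bar>\<eta> x - indicator E x\<bar> * \<bar>k x - l x\<bar>"
        using ae by eventually_elim (simp add: max_mix_le)
    qed auto
    also have "\<dots> = (\<integral>x. \<bar>F x - l x\<bar> \<partial>L) + (\<integral>x. \<bar>\<eta> x - indicator E x\<bar> * \<bar>k x - l x\<bar> \<partial>L)"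
      using i2 il iF by (intro Bochner_Integration.integral_add) auto
    finally show ?thesis using 1 2 by simp
  qed
  have aeL: "AE x in ?L. indicator E x = (if g x < h x then 1 else 0 :: real)"
    using N(2) AE_space by eventually_elim (auto simp: E_def indicator_def)
  have aeS: "AE x in S. indicator E x = (if g' x < h' x then 1 else 0 :: real)"
    using N(3) AE_space by eventually_elim (auto simp: E_def indicator_def)
  have 1: "(\<integral>x. \<bar>max (H x) (h x) - ((1 - \<eta> x) * g x + \<eta> x * h x)\<bar> \<partial>?L) < e"
    using AB(2) by (intro key[OF sets_leb_on i(1,2) iH _ \<eta>(4) aeL]) (simp add: g_def)
  have 2: "(\<integral>x. \<bar>max (G x) (h' x) - ((1 - \<eta> x) * g' x + \<eta> x * h' x)\<bar> \<partial>S) < e"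
    using AB(3) by (intro key[OF S i(3,4) iG _ \<eta>(5) aeS]) (simp add: g'_def)
  have e1: "(1 - \<eta> x) * g x + \<eta> x * h x = ?A x + ?B x \<bullet> a x" for x
    by (simp add: g_def h_def algebra_simps inner_add_left)
  have e2: "(1 - \<eta> x) * g' x + \<eta> x * h' x = ?B x \<bullet> p x" for x
    by (simp add: g'_def h'_def algebra_simps inner_add_left)
  show ?case
    using mix 1 2 unfolding e1 e2
    by (intro exI[of _ ?A] exI[of _ ?B]) (simp add: H_def G_def h_def h'_def)
qed

text \<open>For a single affine minorant the integral is a constant plus a weak* continuous
  functional of the measure, so it converges along the sequence while staying below the integral of
  \<Phi>.\<close>

lemma affine_minorant_lsc:
  fixes \<Omega> :: "'a::euclidean_space set" and \<mu> :: "'a set \<Rightarrow> 'b::euclidean_space"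
  assumes \<Omega>: "open \<Omega>" and \<mu>: "\<mu> \<in> radon_measures \<Omega>"
    and minor: "affine_minorant \<Omega> \<Phi> A B" and u: "\<And>j. u j \<in> L1 \<Omega>"
    and conv: "weak_star \<Omega> (\<lambda>j. leb_measure \<Omega> (u j)) \<mu>"
  shows "ennreal ((\<integral>x. A x + B x \<bullet> ac_density \<Omega> \<mu> x \<partial>leb_on \<Omega>)
      + (\<integral>x. B x \<bullet> polar \<Omega> (sing_part \<Omega> \<mu>) x \<partial>tv \<Omega> (sing_part \<Omega> \<mu>)))
    \<le> liminf (\<lambda>j. \<integral>\<^sup>+x. ennreal (\<Phi> x (u j x)) \<partial>leb_on \<Omega>)"
proof -
  let ?L = "leb_on \<Omega>"
  have m: "integrable ?L A" "continuous_on \<Omega> B" "bounded (B ` \<Omega>)" "\<And>x z. x \<in> \<Omega> \<Longrightarrow> A x + B x \<bullet> z \<le> \<Phi> x z"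
    using minor by (auto simp: affine_minorant_def)
  have Bm: "B \<in> borel_measurable (restrict_space borel \<Omega>)" by (rule borel_measurable_continuous_on_restrict[OF m(2)])
  have iu: "integrable ?L (\<lambda>x. B x \<bullet> v x)" if "integrable ?L v" for v
    by (rule integrable_bounded_inner[OF sets_leb_on that m(2,3)])
  have ui: "integrable ?L (u j)" for j using u by (simp add: L1_def)
  have "(\<lambda>j. vec_integral \<Omega> B (leb_measure \<Omega> (u j))) \<longlonglongrightarrow> vec_integral \<Omega> B \<mu>"
    using conv m(2,3) by (auto simp: weak_star_def)
  then have "(\<lambda>j. (\<integral>x. A x \<partial>?L) + (\<integral>x. B x \<bullet> u j x \<partial>?L)) \<longlonglongrightarrow> (\<integral>x. A x \<partial>?L) + vec_integral \<Omega> B \<mu>"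
    by (intro tendsto_intros) (simp add: vec_integral_leb[OF u Bm m(3)])
  then have "(\<lambda>j. ennreal (\<integral>x. A x + B x \<bullet> u j x \<partial>?L)) \<longlonglongrightarrow> ennreal ((\<integral>x. A x \<partial>?L) + vec_integral \<Omega> B \<mu>)"
    by (intro tendsto_ennrealI) (simp add: m(1) iu[OF ui])
  then have "liminf (\<lambda>j. ennreal (\<integral>x. A x + B x \<bullet> u j x \<partial>?L)) = ennreal ((\<integral>x. A x \<partial>?L) + vec_integral \<Omega> B \<mu>)"
    by (intro lim_imp_Liminf) auto
  moreover have "(\<integral>x. A x \<partial>?L) + vec_integral \<Omega> B \<mu> = (\<integral>x. A x + B x \<bullet> ac_density \<Omega> \<mu> x \<partial>?L)
      + (\<integral>x. B x \<bullet> polar \<Omega> (sing_part \<Omega> \<mu>) x \<partial>tv \<Omega> (sing_part \<Omega> \<mu>))"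
    using m(1) iu[OF integrable_ac_density[OF \<mu> \<Omega>]] by (simp add: vec_integral_decomp[OF \<mu> \<Omega> Bm m(3)])
  moreover have "liminf (\<lambda>j. ennreal (\<integral>x. A x + B x \<bullet> u j x \<partial>?L)) \<le> liminf (\<lambda>j. \<integral>\<^sup>+x. ennreal (\<Phi> x (u j x)) \<partial>?L)"
  proof (intro Liminf_mono always_eventually allI)
    fix j
    have i: "integrable ?L (\<lambda>x. A x + B x \<bullet> u j x)" using m(1) iu[OF ui] by simp
    \<comment> \<open>The affine function may be negative; its positive part is a nonnegative
      integrable function whose two integrals agree, and the truncation in \<open>ennreal\<close>
      keeps it below \<Phi>.\<close>
    have "ennreal (\<integral>x. A x + B x \<bullet> u j x \<partial>?L) \<le> ennreal (\<integral>x. max 0 (A x + B x \<bullet> u j x) \<partial>?L)"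
      using i by (intro ennreal_leI integral_mono) auto
    also have "\<dots> = (\<integral>\<^sup>+x. ennreal (max 0 (A x + B x \<bullet> u j x)) \<partial>?L)"
      using i by (intro nn_integral_eq_integral[symmetric]) auto
    also have "\<dots> \<le> (\<integral>\<^sup>+x. ennreal (\<Phi> x (u j x)) \<partial>?L)"
    proof (rule nn_integral_mono)
      fix x assume "x \<in> space ?L"
      then have "A x + B x \<bullet> u j x \<le> \<Phi> x (u j x)" using m(4) by (simp add: space_leb_on)
      then show "ennreal (max 0 (A x + B x \<bullet> u j x)) \<le> ennreal (\<Phi> x (u j x))"
        by (cases "0 \<le> A x + B x \<bullet> u j x") (auto simp: max_def intro: ennreal_leI)
    qed
    finally show "ennreal (\<integral>x. A x + B x \<bullet> u j x \<partial>?L) \<le> (\<integral>\<^sup>+x. ennreal (\<Phi> x (u j x)) \<partial>?L)" .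
  qed
  ultimately show ?thesis by simp
qed

lemma sing_part_carrier:
  assumes \<mu>: "\<mu> \<in> radon_measures \<Omega>" and \<Omega>: "open \<Omega>"
  shows "\<exists>N\<in>borel_on \<Omega>. (AE x in leb_on \<Omega>. x \<notin> N) \<and> (AE x in tv \<Omega> (sing_part \<Omega> \<mu>). x \<in> N)"
proof -
  let ?s = "sing_part \<Omega> \<mu>"
  obtain N where N: "N \<in> borel_on \<Omega>" "emeasure lborel N = 0"
    "?s = (\<lambda>A. if A \<in> borel_on \<Omega> then \<mu> (A \<inter> N) else 0)"
    using sing_part_ex[OF assms] by auto
  have "N \<in> null_sets (leb_on \<Omega>)" using N(1,2) by (intro null_setsI) (auto simp: emeasure_leb_on[OF \<Omega>] sets_leb_on)
  then have 1: "AE x in leb_on \<Omega>. x \<notin> N" by (rule AE_not_in)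
  have D: "\<Omega> - N \<in> borel_on \<Omega>" using N(1) top_in_borel_on by auto
  have "variation \<Omega> ?s (\<Omega> - N) \<le> 0"
    unfolding variation_def
  proof (rule SUP_least)
    fix P assume P: "P \<in> {P. range P \<subseteq> borel_on \<Omega> \<and> disjoint_family P \<and> (\<Union>i::nat. P i) = \<Omega> - N}"
    then have "P i \<inter> N = {}" for i by blast
    then have "?s (P i) = 0" for i by (simp add: N(3) radon_empty[OF \<mu>])
    then show "(\<Sum>i. ennreal (norm (?s (P i)))) \<le> 0" by simp
  qed
  then have "\<Omega> - N \<in> null_sets (tv \<Omega> ?s)"
    using D by (intro null_setsI) (simp_all add: emeasure_tv[OF radon_sing_part[OF assms]] sets_tv)
  then have "AE x in tv \<Omega> ?s. x \<notin> \<Omega> - N" by (rule AE_not_in)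
  then have "AE x in tv \<Omega> ?s. x \<in> N" using AE_space by eventually_elim (simp add: space_tv)
  then show ?thesis using 1 N(1) by blast
qed

lemma integral_diff_le_abs:
  fixes f g :: "'a \<Rightarrow> real"
  assumes "integrable L f" "integrable L g"
  shows "(\<integral>x. f x \<partial>L) - (\<integral>x. g x \<partial>L) \<le> (\<integral>x. \<bar>f x - g x\<bar> \<partial>L)"
  unfolding Bochner_Integration.integral_diff[OF assms, symmetric]
  using assms by (intro integral_mono) auto

lemma le_SUP_running_max: "(SUP k. ennreal (h k x)) \<le> (SUP n. ennreal (running_max h n x))"
proof (rule SUP_least)
  fix k
  have "ennreal (h k x) \<le> ennreal (running_max h (Suc k) x)" by (intro ennreal_leI) simp
  also have "\<dots> \<le> (SUP n. ennreal (running_max h n x))" by (rule SUP_upper) simp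
  finally show "ennreal (h k x) \<le> (SUP n. ennreal (running_max h n x))" .
qed

text \<open>Countability of the family reduces the supremum to running maxima by monotone
  convergence, and each of these is matched up to \<open>e\<close> by one affine minorant. On the
  singular part only slopes count, as offsets are integrated against Lebesgue measure.\<close>

lemma lsc_sup_affine:
  fixes \<Omega> :: "'a::euclidean_space set" and \<mu> :: "'a set \<Rightarrow> 'b::euclidean_space"
    and \<alpha> :: "nat \<Rightarrow> 'a \<Rightarrow> real" and \<beta> :: "nat \<Rightarrow> 'a \<Rightarrow> 'b"
  assumes \<Omega>: "open \<Omega>" and \<mu>: "\<mu> \<in> radon_measures \<Omega>"
    and \<Phi>0: "\<And>x z. x \<in> \<Omega> \<Longrightarrow> 0 \<le> \<Phi> x z"
    and minor: "\<And>k. affine_minorant \<Omega> \<Phi> (\<alpha> k) (\<beta> k)" and u: "\<And>j. u j \<in> L1 \<Omega>"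
    and conv: "weak_star \<Omega> (\<lambda>j. leb_measure \<Omega> (u j)) \<mu>"
  shows "(\<integral>\<^sup>+x. (SUP k. ennreal (\<alpha> k x + \<beta> k x \<bullet> ac_density \<Omega> \<mu> x)) \<partial>leb_on \<Omega>)
      + (\<integral>\<^sup>+x. (SUP k. ennreal (\<beta> k x \<bullet> polar \<Omega> (sing_part \<Omega> \<mu>) x)) \<partial>tv \<Omega> (sing_part \<Omega> \<mu>))
    \<le> liminf (\<lambda>j. \<integral>\<^sup>+x. ennreal (\<Phi> x (u j x)) \<partial>leb_on \<Omega>)" (is "_ \<le> ?liminf")
proof -
  let ?L = "leb_on \<Omega>" and ?S = "tv \<Omega> (sing_part \<Omega> \<mu>)" and ?a = "ac_density \<Omega> \<mu>" and ?p = "polar \<Omega> (sing_part \<Omega> \<mu>)"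
  note a = integrable_ac_density[OF \<mu> \<Omega>]
  note p = integrable_polar[OF radon_sing_part[OF \<mu> \<Omega>]]
  define h where "h k x = \<alpha> k x + \<beta> k x \<bullet> ?a x" for k :: nat and x
  define h' where "h' k x = \<beta> k x \<bullet> ?p x" for k :: nat and x
  have int: "integrable ?L (\<lambda>x. A x + B x \<bullet> ?a x)" "integrable ?S (\<lambda>x. B x \<bullet> ?p x)"
    if "affine_minorant \<Omega> \<Phi> A B" for A B
    using that integrable_bounded_inner[OF sets_leb_on a] integrable_bounded_inner[OF sets_tv p]
    by (auto simp: affine_minorant_def)
  have iH: "integrable ?L (running_max h n)" for n
    unfolding h_def using int[OF minor] by (intro integrable_running_max) auto
  have iG: "integrable ?S (running_max h' n)" for n
    unfolding h'_def using int[OF minor] by (intro integrable_running_max) auto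
  obtain N where N: "N \<in> borel_on \<Omega>" "AE x in ?L. x \<notin> N" "AE x in ?S. x \<in> N"
    using sing_part_carrier[OF \<mu> \<Omega>] by auto
  have fin: "(\<integral>\<^sup>+x. ennreal (running_max h n x) \<partial>?L) + (\<integral>\<^sup>+x. ennreal (running_max h' n x) \<partial>?S) \<le> ?liminf" for n
  proof (rule ennreal_le_epsilon)
    fix e :: real assume e: "0 < e"
    obtain A B where AB: "affine_minorant \<Omega> \<Phi> A B"
      "(\<integral>x. \<bar>running_max h n x - (A x + B x \<bullet> ?a x)\<bar> \<partial>?L) < e/2" "(\<integral>x. \<bar>running_max h' n x - B x \<bullet> ?p x\<bar> \<partial>?S) < e/2"
    proof -
      have "0 < e/2" using e by simp
      note affine_minorant_approx_max[where \<alpha> = \<alpha> and \<beta> = \<beta> and n = n, OF \<Omega> \<Phi>0 minor a sets_tv p N this]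
      then show ?thesis using that unfolding h_def[abs_def] h'_def[abs_def] by blast
    qed
    have "(\<integral>x. running_max h n x \<partial>?L) - (\<integral>x. A x + B x \<bullet> ?a x \<partial>?L) \<le> (\<integral>x. \<bar>running_max h n x - (A x + B x \<bullet> ?a x)\<bar> \<partial>?L)"
      by (rule integral_diff_le_abs[OF iH int(1)[OF AB(1)]])
    moreover have "(\<integral>x. running_max h' n x \<partial>?S) - (\<integral>x. B x \<bullet> ?p x \<partial>?S) \<le> (\<integral>x. \<bar>running_max h' n x - B x \<bullet> ?p x\<bar> \<partial>?S)"
      by (rule integral_diff_le_abs[OF iG int(2)[OF AB(1)]])
    ultimately have le: "(\<integral>x. running_max h n x \<partial>?L) + (\<integral>x. running_max h' n x \<partial>?S)
        \<le> ((\<integral>x. A x + B x \<bullet> ?a x \<partial>?L) + (\<integral>x. B x \<bullet> ?p x \<partial>?S)) + e"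
      using AB(2,3) by linarith
    have "(\<integral>\<^sup>+x. ennreal (running_max h n x) \<partial>?L) + (\<integral>\<^sup>+x. ennreal (running_max h' n x) \<partial>?S)
        = ennreal (\<integral>x. running_max h n x \<partial>?L) + ennreal (\<integral>x. running_max h' n x \<partial>?S)"
      using iH iG by (simp add: nn_integral_eq_integral running_max_nonneg)
    also have "\<dots> = ennreal ((\<integral>x. running_max h n x \<partial>?L) + (\<integral>x. running_max h' n x \<partial>?S))"
      by (intro ennreal_plus[symmetric] integral_nonneg) (auto simp: running_max_nonneg)
    also have "\<dots> \<le> ennreal (((\<integral>x. A x + B x \<bullet> ?a x \<partial>?L) + (\<integral>x. B x \<bullet> ?p x \<partial>?S)) + e)" by (intro ennreal_leI le)
    also have "\<dots> \<le> ennreal ((\<integral>x. A x + B x \<bullet> ?a x \<partial>?L) + (\<integral>x. B x \<bullet> ?p x \<partial>?S)) + ennreal e"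
      using e by (intro ennreal_plus_le) simp
    also have "\<dots> \<le> ?liminf + ennreal e"
      by (intro add_mono affine_minorant_lsc[OF \<Omega> \<mu> AB(1) u conv] order_refl)
    finally show "(\<integral>\<^sup>+x. ennreal (running_max h n x) \<partial>?L) + (\<integral>\<^sup>+x. ennreal (running_max h' n x) \<partial>?S) \<le> ?liminf + ennreal e" .
  qed
  have inc: "incseq (\<lambda>n x. ennreal (running_max f n x))" for f :: "nat \<Rightarrow> 'a \<Rightarrow> real"
    by (intro monoI le_funI ennreal_leI running_max_mono)
  have mono2: "mono (\<lambda>n. \<integral>\<^sup>+x. ennreal (running_max f n x) \<partial>M)" for f :: "nat \<Rightarrow> 'a \<Rightarrow> real" and M
    by (intro monoI nn_integral_mono ennreal_leI running_max_mono)
  have "(\<integral>\<^sup>+x. (SUP k. ennreal (h k x)) \<partial>?L) + (\<integral>\<^sup>+x. (SUP k. ennreal (h' k x)) \<partial>?S)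
      \<le> (\<integral>\<^sup>+x. (SUP n. ennreal (running_max h n x)) \<partial>?L) + (\<integral>\<^sup>+x. (SUP n. ennreal (running_max h' n x)) \<partial>?S)"
    by (intro add_mono nn_integral_mono le_SUP_running_max)
  also have "\<dots> = (SUP n. \<integral>\<^sup>+x. ennreal (running_max h n x) \<partial>?L) + (SUP n. \<integral>\<^sup>+x. ennreal (running_max h' n x) \<partial>?S)"
    using iH iG by (intro arg_cong2[of _ _ _ _ "(+)"] nn_integral_monotone_convergence_SUP inc) auto
  also have "\<dots> = (SUP n. (\<integral>\<^sup>+x. ennreal (running_max h n x) \<partial>?L) + (\<integral>\<^sup>+x. ennreal (running_max h' n x) \<partial>?S))"
    by (intro ennreal_SUP_add[symmetric] mono2)
  also have "\<dots> \<le> ?liminf" by (intro SUP_least fin)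
  finally show ?thesis unfolding h_def h'_def .
qed

lemma le_SUP_ennreal:
  assumes "\<And>r. r < y \<Longrightarrow> \<exists>k. r < (h k :: real)"
  shows "ennreal y \<le> (SUP k. ennreal (h k))"
proof (rule ennreal_le_epsilon)
  fix e :: real assume "0 < e"
  then obtain k where "y - e < h k" using assms[of "y - e"] by auto
  then have "ennreal y \<le> ennreal (h k + e)" by (intro ennreal_leI) simp
  also have "\<dots> \<le> ennreal (h k) + ennreal e"
    using \<open>0 < e\<close> by (intro ennreal_plus_le) simp
  also have "\<dots> \<le> (SUP k. ennreal (h k)) + ennreal e" by (intro add_mono SUP_upper) auto
  finally show "ennreal y \<le> (SUP k. ennreal (h k)) + ennreal e" .
qed

text \<open>The two integrands differ on purpose: the minorants lie below \<Phi>, while their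
  supremum is only known to reach \<Psi>. For the lower bound both are \<open>f\<close>; for the
  upper bound the gap is what the tangents of the area integrand lose.\<close>

lemma lsc_weak_star:
  fixes \<Omega> :: "'a::euclidean_space set" and \<mu> :: "'a set \<Rightarrow> 'b::euclidean_space"
    and \<alpha> :: "nat \<Rightarrow> 'a \<Rightarrow> real" and \<beta> :: "nat \<Rightarrow> 'a \<Rightarrow> 'b"
  assumes \<Omega>: "open \<Omega>" and \<mu>: "\<mu> \<in> radon_measures \<Omega>"
    and \<Phi>0: "\<And>x z. x \<in> \<Omega> \<Longrightarrow> 0 \<le> \<Phi> x z"
    and minor: "\<And>k. affine_minorant \<Omega> \<Phi> (\<alpha> k) (\<beta> k)" and u: "\<And>j. u j \<in> L1 \<Omega>"
    and conv: "weak_star \<Omega> (\<lambda>j. leb_measure \<Omega> (u j)) \<mu>"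
    and dense: "\<And>x z r. x \<in> \<Omega> \<Longrightarrow> r < \<Psi> x z \<Longrightarrow> \<exists>k. r < \<alpha> k x + \<beta> k x \<bullet> z"
    and rec: "\<And>x. x \<in> \<Omega> \<Longrightarrow> norm (polar \<Omega> (sing_part \<Omega> \<mu>) x) = 1 \<Longrightarrow>
      (\<lambda>n. \<Psi> x (real n *\<^sub>R polar \<Omega> (sing_part \<Omega> \<mu>) x) / real n) \<longlonglongrightarrow> \<Psi>' x"
  shows "(\<integral>\<^sup>+x. ennreal (\<Psi> x (ac_density \<Omega> \<mu> x)) \<partial>leb_on \<Omega>) + (\<integral>\<^sup>+x. ennreal (\<Psi>' x) \<partial>tv \<Omega> (sing_part \<Omega> \<mu>))
    \<le> liminf (\<lambda>j. \<integral>\<^sup>+x. ennreal (\<Phi> x (u j x)) \<partial>leb_on \<Omega>)"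
proof -
  let ?p = "polar \<Omega> (sing_part \<Omega> \<mu>)"
  have "(\<integral>\<^sup>+x. ennreal (\<Psi> x (ac_density \<Omega> \<mu> x)) \<partial>leb_on \<Omega>)
      \<le> (\<integral>\<^sup>+x. (SUP k. ennreal (\<alpha> k x + \<beta> k x \<bullet> ac_density \<Omega> \<mu> x)) \<partial>leb_on \<Omega>)"
    by (intro nn_integral_mono le_SUP_ennreal dense) (auto simp: space_leb_on)
  moreover have "(\<integral>\<^sup>+x. ennreal (\<Psi>' x) \<partial>tv \<Omega> (sing_part \<Omega> \<mu>)) \<le> (\<integral>\<^sup>+x. (SUP k. ennreal (\<beta> k x \<bullet> ?p x)) \<partial>tv \<Omega> (sing_part \<Omega> \<mu>))"
  proof (rule nn_integral_mono_AE)
    show "AE x in tv \<Omega> (sing_part \<Omega> \<mu>). ennreal (\<Psi>' x) \<le> (SUP k. ennreal (\<beta> k x \<bullet> ?p x))"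
      using norm_polar[OF radon_sing_part[OF \<mu> \<Omega>]] AE_space
    proof eventually_elim
      fix x assume x1: "norm (?p x) = 1" and "x \<in> space (tv \<Omega> (sing_part \<Omega> \<mu>))"
      then have x: "x \<in> \<Omega>" by (simp add: space_tv)
      show "ennreal (\<Psi>' x) \<le> (SUP k. ennreal (\<beta> k x \<bullet> ?p x))"
      proof (rule LIMSEQ_le_const2)
        have "(\<lambda>n. \<Psi> x (real n *\<^sub>R ?p x) / real n - (1 + \<Phi> x 0) / real n) \<longlonglongrightarrow> \<Psi>' x - 0"
          by (intro tendsto_diff rec[OF x x1] lim_const_over_n)
        then show "(\<lambda>n. ennreal (\<Psi> x (real n *\<^sub>R ?p x) / real n - (1 + \<Phi> x 0) / real n)) \<longlonglongrightarrow> ennreal (\<Psi>' x)"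
          by (intro tendsto_ennrealI) simp
        have "ennreal (\<Psi> x (real n *\<^sub>R ?p x) / real n - (1 + \<Phi> x 0) / real n) \<le> (SUP k. ennreal (\<beta> k x \<bullet> ?p x))"
          if n: "1 \<le> n" for n
        proof -
          have "\<Psi> x (real n *\<^sub>R ?p x) - 1 < \<Psi> x (real n *\<^sub>R ?p x)" by simp
          from dense[OF x this] obtain k where k: "\<Psi> x (real n *\<^sub>R ?p x) - 1 < \<alpha> k x + \<beta> k x \<bullet> (real n *\<^sub>R ?p x)"
            by blast
          \<comment> \<open>Evaluation at 0 bounds the offset by \<open>\<Phi> x 0\<close> uniformly
            in \<open>k\<close>; after division by \<open>n\<close> it disappears in the limit and
            only the slope along \<open>?p x\<close> remains.\<close>
          have "\<alpha> k x + \<beta> k x \<bullet> 0 \<le> \<Phi> x 0" using minor[of k] x unfolding affine_minorant_def by blast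
          then have "\<Psi> x (real n *\<^sub>R ?p x) - (1 + \<Phi> x 0) \<le> (\<beta> k x \<bullet> ?p x) * real n" using k by (simp add: mult.commute)
          then have "\<Psi> x (real n *\<^sub>R ?p x) / real n - (1 + \<Phi> x 0) / real n \<le> \<beta> k x \<bullet> ?p x"
            using n by (simp add: diff_divide_distrib[symmetric] pos_divide_le_eq)
          then have "ennreal (\<Psi> x (real n *\<^sub>R ?p x) / real n - (1 + \<Phi> x 0) / real n) \<le> ennreal (\<beta> k x \<bullet> ?p x)"
            by (rule ennreal_leI)
          also have "\<dots> \<le> (SUP k. ennreal (\<beta> k x \<bullet> ?p x))" by (rule SUP_upper) simp
          finally show ?thesis .
        qed
        then show "\<exists>N. \<forall>n\<ge>N. ennreal (\<Psi> x (real n *\<^sub>R ?p x) / real n - (1 + \<Phi> x 0) / real n) \<le> (SUP k. ennreal (\<beta> k x \<bullet> ?p x))"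
          by blast
      qed
    qed
  qed
  ultimately show ?thesis
    by (rule order_trans[OF add_mono lsc_sup_affine[OF \<Omega> \<mu> \<Phi>0 minor u conv]])
qed

section \<open>Convex integrands of linear growth\<close>

lemma dense_sequence:
  obtains d :: "nat \<Rightarrow> 'a::second_countable_topology" where "\<And>X. open X \<Longrightarrow> X \<noteq> {} \<Longrightarrow> \<exists>n. d n \<in> X"
proof -
  obtain D :: "'a set" where D: "countable D" "\<And>X. open X \<Longrightarrow> X \<noteq> {} \<Longrightarrow> \<exists>d\<in>D. d \<in> X"
    by (erule countable_dense_setE)
  have "\<exists>n. from_nat_into D n \<in> X" if "open X" "X \<noteq> {}" for X
    using D(2)[OF that] from_nat_into_surj[OF D(1)] by metis
  then show ?thesis by (rule that)
qed

locale convex_integrand =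
  fixes \<Omega> :: "'a::euclidean_space set" and f :: "'a \<Rightarrow> 'b::euclidean_space \<Rightarrow> real"
    and M :: real and \<omega> :: "real \<Rightarrow> real"
  assumes \<Omega>: "open \<Omega>"
    and f_nonneg: "\<And>x z. x \<in> \<Omega> \<Longrightarrow> 0 \<le> f x z"
    and f_cont: "continuous_on (\<Omega> \<times> UNIV) (\<lambda>(x, z). f x z)"
    and f_convex: "\<And>x. x \<in> \<Omega> \<Longrightarrow> convex_on UNIV (f x)"
    and M: "0 < M"
    and f_lower: "\<And>x z. x \<in> \<Omega> \<Longrightarrow> norm z - 1 \<le> M * f x z"
    and f_upper: "\<And>x z. x \<in> \<Omega> \<Longrightarrow> f x z \<le> M * (1 + norm z)"
    and \<omega>: "modulus_of_continuity \<omega>"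
    and f_\<omega>: "\<And>x y z. x \<in> \<Omega> \<Longrightarrow> y \<in> \<Omega> \<Longrightarrow> \<bar>f x z - f y z\<bar> \<le> \<omega> (norm (x - y)) * (1 + norm z)"
begin

lemma f_continuous:
  assumes "continuous_on X g" "continuous_on X h" "\<And>x. x \<in> X \<Longrightarrow> g x \<in> \<Omega>"
  shows "continuous_on X (\<lambda>x. f (g x) (h x))"
  using continuous_on_compose2[OF f_cont continuous_on_Pair[OF assms(1,2)]] assms(3) by auto

lemma f_measurable:
  assumes "sets L = borel_on \<Omega>" "h \<in> borel_measurable L"
  shows "(\<lambda>x. f x (h x)) \<in> borel_measurable L"
proof -
  have sp: "space L = \<Omega>" using sets_eq_imp_space_eq[OF assms(1)] by (simp add: space_restrict_space)
  have "(\<lambda>x. (x, h x)) \<in> measurable L (restrict_space borel (\<Omega> \<times> UNIV))"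
  proof (rule measurable_restrict_space2)
    show "(\<lambda>x. (x, h x)) \<in> space L \<rightarrow> \<Omega> \<times> UNIV" by (auto simp: sp)
    show "(\<lambda>x. (x, h x)) \<in> borel_measurable L"
      by (intro borel_measurable_Pair measurable_ident_borel_on[OF assms(1)] assms(2))
  qed
  then have "(\<lambda>x. (\<lambda>(x, z). f x z) (x, h x)) \<in> borel_measurable L"
    by (rule measurable_compose) (rule borel_measurable_continuous_on_restrict[OF f_cont])
  then show ?thesis by simp
qed

text \<open>Convexity is used on the segment from \<open>z\<close> through \<open>y\<close> to the
  far point \<open>z + (y - z) / t\<close>, where the growth bound applies. As \<open>t\<close>
  tends to 0 only the slope of that bound survives, so the Lipschitz constant is the growth constant
  \<open>M\<close>.\<close>

lemma f_lipschitz1: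
  assumes "x \<in> \<Omega>"
  shows "f x y \<le> f x z + M * norm (y - z)"
proof (rule field_le_epsilon)
  fix e :: real assume e: "0 < e"
  let ?K = "M * (1 + norm z)"
  have K: "0 < ?K" using M by (simp add: add_pos_nonneg)
  \<comment> \<open>Makes the residual \<open>t * M * (1 + norm z)\<close> at most \<open>e\<close>;
    \<open>t \<le> 1\<close> keeps the combination convex.\<close>
  define t where "t = min 1 (e / ?K)"
  have t: "0 < t" "t \<le> 1" "t * ?K \<le> e"
    using e K by (auto simp: t_def min_def divide_simps)
  have "y = (1 - t) *\<^sub>R z + t *\<^sub>R (z + (1 / t) *\<^sub>R (y - z))" using t(1) by (simp add: algebra_simps)
  then have "f x y \<le> (1 - t) * f x z + t * f x (z + (1 / t) *\<^sub>R (y - z))"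
    using convex_onD[OF f_convex[OF assms], of t z "z + (1 / t) *\<^sub>R (y - z)"] t by auto
  also have "\<dots> \<le> 1 * f x z + t * (M * (1 + (norm z + norm (y - z) / t)))"
  proof (intro add_mono mult_right_mono mult_left_mono)
    have "f x (z + (1 / t) *\<^sub>R (y - z)) \<le> M * (1 + norm (z + (1 / t) *\<^sub>R (y - z)))" by (rule f_upper[OF assms])
    also have "\<dots> \<le> M * (1 + (norm z + norm (y - z) / t))"
      using norm_triangle_ineq[of z "(1 / t) *\<^sub>R (y - z)"] t M by (intro mult_left_mono add_left_mono) auto
    finally show "f x (z + (1 / t) *\<^sub>R (y - z)) \<le> M * (1 + (norm z + norm (y - z) / t))" .
  qed (use t f_nonneg[OF assms] in auto)
  also have "\<dots> = f x z + t * ?K + M * norm (y - z)" using t(1) by (simp add: field_simps)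
  also have "\<dots> \<le> f x z + M * norm (y - z) + e" using t(3) by simp
  finally show "f x y \<le> f x z + M * norm (y - z) + e" .
qed

lemma f_lipschitz:
  assumes "x \<in> \<Omega>"
  shows "\<bar>f x y - f x z\<bar> \<le> M * norm (y - z)"
  using f_lipschitz1[OF assms, of y z] f_lipschitz1[OF assms, of z y] by (simp add: norm_minus_commute)

text \<open>\<open>modulus_of_continuity\<close> prescribes the limit from the right only;
  \<open>\<omega> 0 = 0\<close> covers the arguments with \<open>g y = x\<close>.\<close>

lemma modulus_tendsto:
  assumes "(g \<longlongrightarrow> x) F"
  shows "((\<lambda>y. \<omega> (norm (g y - x))) \<longlongrightarrow> 0) F"
proof (rule tendstoI)
  fix e :: real assume e: "0 < e"
  have "eventually (\<lambda>s. dist (\<omega> s) 0 < e) (at_right 0)"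
    using \<omega> e by (intro tendstoD) (auto simp: modulus_of_continuity_def)
  then obtain d where d: "0 < d" "\<And>s. 0 < s \<Longrightarrow> s < d \<Longrightarrow> dist (\<omega> s) 0 < e"
    by (auto simp: eventually_at_right_field)
  have "eventually (\<lambda>y. dist (g y) x < d) F" using assms d(1) by (rule tendstoD)
  then show "eventually (\<lambda>y. dist (\<omega> (norm (g y - x))) 0 < e) F"
  proof eventually_elim
    fix y assume "dist (g y) x < d"
    then have "norm (g y - x) < d" by (simp add: dist_norm)
    then show "dist (\<omega> (norm (g y - x))) 0 < e"
      using d(2)[of "norm (g y - x)"] \<omega> e by (cases "g y = x") (auto simp: modulus_of_continuity_def)
  qed
qed

lemma quotient_mono:
  assumes x: "x \<in> \<Omega>" and s: "0 < s" "s \<le> t"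
  shows "(f x (s *\<^sub>R z) - f x 0) / s \<le> (f x (t *\<^sub>R z) - f x 0) / t"
proof -
  have t: "0 < t" using s by simp
  have "s *\<^sub>R z = (1 - s / t) *\<^sub>R 0 + (s / t) *\<^sub>R (t *\<^sub>R z)" using t by simp
  then have "f x (s *\<^sub>R z) \<le> (1 - s / t) * f x 0 + (s / t) * f x (t *\<^sub>R z)"
    using convex_onD[OF f_convex[OF x], of "s / t" 0 "t *\<^sub>R z"] s t by (auto simp: divide_simps)
  then have "f x (s *\<^sub>R z) - f x 0 \<le> s * ((f x (t *\<^sub>R z) - f x 0) / t)" by (simp add: algebra_simps diff_divide_distrib)
  then show ?thesis using s(1) by (simp add: pos_divide_le_eq mult.commute)
qed

text \<open>The difference quotients at 0 increase with \<open>t\<close> by convexity and are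
  bounded by \<open>M * norm z\<close>, so they converge to their supremum; the remaining term
  \<open>f x 0 / t\<close> vanishes.\<close>

lemma quotient_tendsto:
  assumes x: "x \<in> \<Omega>"
  shows "\<exists>l. ((\<lambda>t. f x (t *\<^sub>R z) / t) \<longlongrightarrow> l) at_top"
proof -
  define D where "D t = (f x (t *\<^sub>R z) - f x 0) / t" for t
  have bound: "D t \<le> M * norm z" if "0 < t" for t
  proof -
    have "f x (t *\<^sub>R z) - f x 0 \<le> (M * norm z) * t" using f_lipschitz1[OF x, of "t *\<^sub>R z" 0] that by (simp add: mult_ac)
    then show ?thesis using that by (simp add: D_def pos_divide_le_eq)
  qed
  define l where "l = (SUP t\<in>{0<..}. D t)"
  have bdd: "bdd_above (D ` {0<..})" using bound by (intro bdd_aboveI2) auto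
  have "(D \<longlongrightarrow> l) at_top"
  proof (rule order_tendstoI)
    fix y assume "y < l"
    then obtain t0 where t0: "0 < t0" "y < D t0" unfolding l_def by (subst (asm) less_cSUP_iff[OF _ bdd]) auto
    have "eventually (\<lambda>t. t0 \<le> t) at_top" by (rule eventually_ge_at_top)
    then show "eventually (\<lambda>t. y < D t) at_top"
    proof eventually_elim
      case (elim t)
      have "D t0 \<le> D t" unfolding D_def by (rule quotient_mono[OF x t0(1) elim])
      then show ?case using t0(2) by simp
    qed
  next
    fix y assume "l < y"
    have "D t \<le> l" if "0 < t" for t unfolding l_def using that by (intro cSUP_upper bdd) auto
    then show "eventually (\<lambda>t. D t < y) at_top"
      using \<open>l < y\<close> by (intro eventually_mono[OF eventually_gt_at_top[of 0]]) (auto intro: le_less_trans)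
  qed
  moreover have "((\<lambda>t. f x 0 / t) \<longlongrightarrow> 0) at_top"
    by (intro tendsto_divide_0[OF tendsto_const] filterlim_at_top_imp_at_infinity filterlim_ident)
  ultimately have "((\<lambda>t. D t + f x 0 / t) \<longlongrightarrow> l + 0) at_top" by (rule tendsto_add)
  moreover have "D t + f x 0 / t = f x (t *\<^sub>R z) / t" for t by (simp add: D_def diff_divide_distrib)
  ultimately show ?thesis by auto
qed

text \<open>\<open>recession\<close> is defined by \<open>Lim\<close>, which means something only if
  the joint limit exists. For frozen \<open>x\<close> it exists along rays; moving the point costs
  at most \<open>\<omega> (norm (x' - x)) * (1 / t + norm z)\<close>, which tends to 0
  jointly.\<close>

lemma recession_tendsto:
  assumes x: "x \<in> \<Omega>"
  shows "((\<lambda>(x', t). f x' (t *\<^sub>R z) / t) \<longlongrightarrow> recession f x z) (nhds x \<times>\<^sub>F at_top)"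
proof -
  let ?F = "nhds x \<times>\<^sub>F (at_top :: real filter)"
  obtain l where l: "((\<lambda>t. f x (t *\<^sub>R z) / t) \<longlongrightarrow> l) at_top" using quotient_tendsto[OF x] by blast
  have fst: "filterlim fst (nhds x) ?F" and snd: "filterlim snd at_top ?F"
    by (auto intro: filterlim_fst filterlim_snd)
  have ev1: "eventually (\<lambda>p. fst p \<in> \<Omega>) ?F"
    using fst topological_tendstoD[of fst x ?F \<Omega>] \<Omega> x by blast
  have ev2: "eventually (\<lambda>p. 0 < snd p) ?F"
    using snd by (auto simp: filterlim_at_top_dense)
  have 1: "((\<lambda>p. f x (snd p *\<^sub>R z) / snd p) \<longlongrightarrow> l) ?F" by (rule filterlim_compose[OF l snd])
  have "((\<lambda>p. \<omega> (norm (fst p - x)) * (1 / snd p + norm z)) \<longlongrightarrow> 0 * (0 + norm z)) ?F"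
    by (intro tendsto_intros modulus_tendsto[OF fst] tendsto_divide_0[OF tendsto_const] filterlim_at_top_imp_at_infinity snd)
  then have 2: "((\<lambda>p. \<omega> (norm (fst p - x)) * (1 / snd p + norm z)) \<longlongrightarrow> 0) ?F" by simp
  have "((\<lambda>p. f (fst p) (snd p *\<^sub>R z) / snd p - f x (snd p *\<^sub>R z) / snd p) \<longlongrightarrow> 0) ?F"
  proof (rule Lim_null_comparison[OF _ 2])
    show "eventually (\<lambda>p. norm (f (fst p) (snd p *\<^sub>R z) / snd p - f x (snd p *\<^sub>R z) / snd p)
        \<le> \<omega> (norm (fst p - x)) * (1 / snd p + norm z)) ?F"
      using ev1 ev2
    proof eventually_elim
      case (elim p)
      have "norm (f (fst p) (snd p *\<^sub>R z) / snd p - f x (snd p *\<^sub>R z) / snd p)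
          = \<bar>f (fst p) (snd p *\<^sub>R z) - f x (snd p *\<^sub>R z)\<bar> / snd p"
        using elim by (simp add: diff_divide_distrib[symmetric])
      also have "\<dots> \<le> \<omega> (norm (fst p - x)) * (1 + norm (snd p *\<^sub>R z)) / snd p"
        using elim x by (intro divide_right_mono f_\<omega>) auto
      also have "\<dots> = \<omega> (norm (fst p - x)) * (1 / snd p + norm z)" using elim by (simp add: field_simps)
      finally show ?case .
    qed
  qed
  from tendsto_add[OF this 1] have lim: "((\<lambda>(x', t). f x' (t *\<^sub>R z) / t) \<longlongrightarrow> l) ?F" by (simp add: case_prod_unfold)
  have "?F \<noteq> bot" by (simp add: prod_filter_eq_bot)
  then have "recession f x z = l" unfolding recession_def by (intro tendsto_Lim lim)
  then show ?thesis using lim by simp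
qed

text \<open>The arguments may run to infinity along directions that reach \<open>p\<close> only in
  the limit and on any scale \<open>s\<close>; the Lipschitz bound absorbs the deviation. The scale
  will be \<open>n\<close> or the area of the argument.\<close>

lemma recession_sequentially:
  assumes x: "x \<in> \<Omega>" and xs: "xs \<longlonglongrightarrow> x" "\<And>n. xs n \<in> \<Omega>"
    and s: "filterlim s at_top sequentially" and y: "(\<lambda>n. ys n /\<^sub>R s n) \<longlonglongrightarrow> p"
  shows "(\<lambda>n. f (xs n) (ys n) / s n) \<longlonglongrightarrow> recession f x p"
proof -
  have "filterlim (\<lambda>n. (xs n, s n)) (nhds x \<times>\<^sub>F at_top) sequentially" by (intro filterlim_Pair xs(1) s)
  from filterlim_compose[OF recession_tendsto[OF x] this]
  have 1: "(\<lambda>n. f (xs n) (s n *\<^sub>R p) / s n) \<longlonglongrightarrow> recession f x p" by simp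
  have "(\<lambda>n. M * norm (ys n /\<^sub>R s n - p)) \<longlonglongrightarrow> M * norm (p - p)" by (intro tendsto_intros y)
  then have 2: "(\<lambda>n. M * norm (ys n /\<^sub>R s n - p)) \<longlonglongrightarrow> 0" by simp
  have "(\<lambda>n. f (xs n) (ys n) / s n - f (xs n) (s n *\<^sub>R p) / s n) \<longlonglongrightarrow> 0"
  proof (rule Lim_null_comparison[OF _ 2])
    have "eventually (\<lambda>n. 0 < s n) sequentially" using s by (auto simp: filterlim_at_top_dense)
    then show "eventually (\<lambda>n. norm (f (xs n) (ys n) / s n - f (xs n) (s n *\<^sub>R p) / s n) \<le> M * norm (ys n /\<^sub>R s n - p)) sequentially"
    proof eventually_elim
      case (elim n)
      have "norm (f (xs n) (ys n) / s n - f (xs n) (s n *\<^sub>R p) / s n) = \<bar>f (xs n) (ys n) - f (xs n) (s n *\<^sub>R p)\<bar> / s n"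
        using elim by (simp add: diff_divide_distrib[symmetric])
      also have "\<dots> \<le> M * norm (ys n - s n *\<^sub>R p) / s n" using elim by (intro divide_right_mono f_lipschitz xs) auto
      also have "\<dots> = M * norm ((ys n - s n *\<^sub>R p) /\<^sub>R s n)" using elim by (simp add: divide_inverse_commute)
      also have "(ys n - s n *\<^sub>R p) /\<^sub>R s n = ys n /\<^sub>R s n - p" using elim by (simp add: scaleR_diff_right)
      finally show ?case .
    qed
  qed
  from tendsto_add[OF this 1] show ?thesis by simp
qed

lemma recession_ray:
  assumes "x \<in> \<Omega>"
  shows "(\<lambda>n. f x (real n *\<^sub>R p) / real n) \<longlonglongrightarrow> recession f x p"
proof (rule recession_sequentially[OF assms tendsto_const assms filterlim_real_sequentially])
  have "eventually (\<lambda>n. (real n *\<^sub>R p) /\<^sub>R real n = p) sequentially"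
    using eventually_gt_at_top[of 0] by eventually_elim simp
  then show "(\<lambda>n. (real n *\<^sub>R p) /\<^sub>R real n) \<longlonglongrightarrow> p" by (rule tendsto_eventually)
qed

lemma recession_nonneg: "x \<in> \<Omega> \<Longrightarrow> 0 \<le> recession f x p"
  by (rule LIMSEQ_le_const[OF recession_ray]) (auto intro!: divide_nonneg_nonneg f_nonneg)

lemma recession_le:
  assumes x: "x \<in> \<Omega>"
  shows "recession f x p \<le> M * norm p"
proof (rule LIMSEQ_le[OF recession_ray[OF x]])
  have "(\<lambda>n. M / real n + M * norm p) \<longlonglongrightarrow> 0 + M * norm p"
    by (intro tendsto_intros lim_const_over_n)
  then show "(\<lambda>n. M / real n + M * norm p) \<longlonglongrightarrow> M * norm p" by simp
  have "f x (real n *\<^sub>R p) / real n \<le> M / real n + M * norm p" if "1 \<le> n" for n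
    using f_upper[OF x, of "real n *\<^sub>R p"] that by (simp add: divide_simps algebra_simps)
  then show "\<exists>N. \<forall>n\<ge>N. f x (real n *\<^sub>R p) / real n \<le> M / real n + M * norm p" by blast
qed

lemma recession_measurable:
  assumes "sets L = borel_on \<Omega>" "p \<in> borel_measurable L"
  shows "(\<lambda>x. recession f x (p x)) \<in> borel_measurable L"
proof (rule borel_measurable_LIMSEQ_real)
  have sp: "space L = \<Omega>" using sets_eq_imp_space_eq[OF assms(1)] by (simp add: space_restrict_space)
  then show "(\<lambda>n. f x (real n *\<^sub>R p x) / real n) \<longlonglongrightarrow> recession f x (p x)" if "x \<in> space L" for x
    using that recession_ray by simp
  show "(\<lambda>x. f x (real n *\<^sub>R p x) / real n) \<in> borel_measurable L" for n
    using assms(2) by (intro borel_measurable_divide f_measurable[OF assms(1)]) auto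
qed

section \<open>A countable family of affine minorants\<close>

text \<open>A hyperplane separates \<open>(z\<^sub>0, r)\<close> strictly from the closed convex
  epigraph. It is not vertical, because the epigraph contains the point
  \<open>(z\<^sub>0, f x z\<^sub>0)\<close> right above; this forces \<open>0 < v2\<close>.\<close>

lemma affine_support:
  assumes x: "x \<in> \<Omega>" and r: "r < f x z\<^sub>0"
  obtains c b where "r < c + b \<bullet> z\<^sub>0" "\<And>z. c + b \<bullet> z \<le> f x z"
proof -
  let ?E = "epigraph UNIV (f x)"
  have "closed ?E"
  proof -
    have "continuous_on UNIV (\<lambda>y. f x (fst y))" using x by (intro f_continuous continuous_intros) auto
    then have "closed {y :: 'b \<times> real. f x (fst y) \<le> snd y}" by (intro closed_Collect_le continuous_intros)
    then show ?thesis by (simp add: epigraph_def)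
  qed
  moreover have "convex ?E" using f_convex[OF x] by (simp add: convex_epigraph)
  moreover have "(z\<^sub>0, r) \<notin> ?E" using r by (simp add: epigraph_def)
  ultimately obtain v y where v: "v \<bullet> (z\<^sub>0, r) < y" "\<And>e. e \<in> ?E \<Longrightarrow> y < v \<bullet> e"
    using separating_hyperplane_closed_point[of ?E "(z\<^sub>0, r)"] by blast
  obtain v1 v2 where vv: "v = (v1, v2)" by (cases v)
  have lt: "y < v1 \<bullet> z + v2 * f x z" for z using v(2)[of "(z, f x z)"] by (simp add: epigraph_def vv)
  have r': "v1 \<bullet> z\<^sub>0 + v2 * r < y" using v(1) by (simp add: vv)
  have "0 < v2 * (f x z\<^sub>0 - r)" using lt[of z\<^sub>0] r' by (simp add: algebra_simps)
  then have v2: "0 < v2" using r by (simp add: zero_less_mult_iff)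
  show ?thesis
  proof (rule that[of "y / v2" "- (v1 /\<^sub>R v2)"])
    show "r < y / v2 + - (v1 /\<^sub>R v2) \<bullet> z\<^sub>0" using r' v2 by (simp add: divide_simps mult.commute)
    show "y / v2 + - (v1 /\<^sub>R v2) \<bullet> z \<le> f x z" for z using lt[of z] v2 by (simp add: divide_simps mult.commute)
  qed
qed

text \<open>One affine function must stay below \<open>f x\<close> for all \<open>x\<close> near
  \<open>x\<^sub>0\<close> and all \<open>z\<close> at once, although the errors from moving
  \<open>x\<close> and from adjusting the slope grow like \<open>norm z\<close>. The rational offset
  and the slope from a dense sequence make the resulting family countable.\<close>

lemma affine_support_nearby:
  fixes d :: "nat \<Rightarrow> 'b"
  assumes x: "x\<^sub>0 \<in> \<Omega>" and r: "r < f x\<^sub>0 z\<^sub>0" and d: "\<And>X. open X \<Longrightarrow> X \<noteq> {} \<Longrightarrow> \<exists>n. d n \<in> X"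
  shows "\<exists>(c::rat) j \<delta>. 0 < \<delta> \<and> r < of_rat c + d j \<bullet> z\<^sub>0 \<and>
    (\<forall>x\<in>\<Omega>. dist x x\<^sub>0 < \<delta> \<longrightarrow> (\<forall>z. of_rat c + d j \<bullet> z \<le> f x z))"
proof -
  obtain c\<^sub>0 b\<^sub>0 where 0: "r < c\<^sub>0 + b\<^sub>0 \<bullet> z\<^sub>0" "\<And>z. c\<^sub>0 + b\<^sub>0 \<bullet> z \<le> f x\<^sub>0 z"
    using affine_support[OF x r] by blast
  \<comment> \<open>A lower bound for the final value at \<open>z\<^sub>0\<close>. Absorbing the
    linear error by coercivity replaces \<open>f\<close> by \<open>(1 + \<kappa> M) f\<close>,
    whence the division; \<open>2 \<kappa>\<close> covers the constant errors,
    \<open>(1 + \<kappa> M) \<kappa>\<close> the choice of a rational offset and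
    \<open>\<kappa> / 2 * norm z\<^sub>0\<close> that of the slope.\<close>
  define G where "G \<kappa> = (c\<^sub>0 - 2 * \<kappa> - (1 + \<kappa> * M) * \<kappa> + b\<^sub>0 \<bullet> z\<^sub>0 - \<kappa> / 2 * norm z\<^sub>0) / (1 + \<kappa> * M)" for \<kappa>
  have "(G \<longlongrightarrow> c\<^sub>0 + b\<^sub>0 \<bullet> z\<^sub>0) (at_right 0)"
    unfolding G_def[abs_def] by (auto intro!: tendsto_eq_intros)
  then have "eventually (\<lambda>\<kappa>. r < G \<kappa>) (at_right 0)"
    by (rule order_tendstoD) (rule 0(1))
  then have "eventually (\<lambda>\<kappa>. 0 < \<kappa> \<and> r < G \<kappa>) (at_right 0)"
    using eventually_at_right_less[of 0] by eventually_elim simp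
  then have "\<exists>\<kappa>. 0 < \<kappa> \<and> r < G \<kappa>"
    by (rule eventually_happens'[rotated]) simp
  then obtain \<kappa> where \<kappa>': "0 < \<kappa>" "r < G \<kappa>" by blast
  have \<kappa>: "0 < \<kappa>" "r < (c\<^sub>0 - 2 * \<kappa> - (1 + \<kappa> * M) * \<kappa> + b\<^sub>0 \<bullet> z\<^sub>0 - \<kappa> / 2 * norm z\<^sub>0) / (1 + \<kappa> * M)"
    using \<kappa>' by (simp_all only: G_def)
  define q where "q = 1 + \<kappa> * M"
  have q: "0 < q" "1 \<le> q" using \<kappa>(1) M by (auto simp: q_def add_pos_pos)
  \<comment> \<open>The radius is scaled so that \<open>q *\<^sub>R d j\<close>, the slope before
    division by \<open>q\<close>, lies within \<open>\<kappa> / 2\<close> of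
    \<open>b\<^sub>0\<close>.\<close>
  obtain j where j: "d j \<in> ball (b\<^sub>0 /\<^sub>R q) (\<kappa> / (2 * q))"
  proof -
    have "0 < \<kappa> / (2 * q)" using \<kappa>(1) q by simp
    then have "ball (b\<^sub>0 /\<^sub>R q) (\<kappa> / (2 * q)) \<noteq> {}" by simp
    then show ?thesis using d[OF open_ball] that by blast
  qed
  have "norm (q *\<^sub>R d j - b\<^sub>0) = q * norm (d j - b\<^sub>0 /\<^sub>R q)"
  proof -
    have "q *\<^sub>R d j - b\<^sub>0 = q *\<^sub>R (d j - b\<^sub>0 /\<^sub>R q)" using q by (simp add: scaleR_diff_right)
    then show ?thesis using q by simp
  qed
  also have "\<dots> \<le> \<kappa> / 2" using j q by (simp add: dist_norm norm_minus_commute field_simps)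
  finally have bj: "norm (q *\<^sub>R d j - b\<^sub>0) \<le> \<kappa> / 2" .
  have near: "\<bar>(q *\<^sub>R d j) \<bullet> z - b\<^sub>0 \<bullet> z\<bar> \<le> \<kappa> / 2 * norm z" for z
  proof -
    have "\<bar>(q *\<^sub>R d j - b\<^sub>0) \<bullet> z\<bar> \<le> norm (q *\<^sub>R d j - b\<^sub>0) * norm z" by (rule Cauchy_Schwarz_ineq2)
    also have "\<dots> \<le> \<kappa> / 2 * norm z" by (intro mult_right_mono bj) simp
    finally show ?thesis by (simp add: inner_diff_left)
  qed
  have "(c\<^sub>0 - 2 * \<kappa>) / q - \<kappa> < (c\<^sub>0 - 2 * \<kappa>) / q" using \<kappa>(1) by simp
  from of_rat_dense[OF this] obtain c where c: "(c\<^sub>0 - 2 * \<kappa>) / q - \<kappa> < of_rat c" "of_rat c < (c\<^sub>0 - 2 * \<kappa>) / q"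
    by blast
  have c': "c\<^sub>0 - 2 * \<kappa> - q * \<kappa> < q * of_rat c" "q * of_rat c < c\<^sub>0 - 2 * \<kappa>"
    using c q by (simp_all add: field_simps)
  have "((\<lambda>x. \<omega> (norm (x - x\<^sub>0))) \<longlongrightarrow> 0) (nhds x\<^sub>0)" by (rule modulus_tendsto) (rule filterlim_ident)
  then have "eventually (\<lambda>x. \<omega> (norm (x - x\<^sub>0)) < \<kappa> / 2) (nhds x\<^sub>0)" using \<kappa>(1) by (intro order_tendstoD) auto
  then obtain \<delta> where \<delta>: "0 < \<delta>" "\<And>x. dist x x\<^sub>0 < \<delta> \<Longrightarrow> \<omega> (norm (x - x\<^sub>0)) < \<kappa> / 2"
    unfolding eventually_nhds_metric by blast
  have "r < of_rat c + d j \<bullet> z\<^sub>0"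
  proof -
    have "q * r < c\<^sub>0 - 2 * \<kappa> - q * \<kappa> + b\<^sub>0 \<bullet> z\<^sub>0 - \<kappa> / 2 * norm z\<^sub>0"
      using \<kappa>(2) q unfolding q_def[symmetric] by (simp add: pos_less_divide_eq mult.commute)
    also have "\<dots> \<le> q * of_rat c + q * (d j \<bullet> z\<^sub>0)" 
      using c'(1) near[of z\<^sub>0, unfolded inner_scaleR_left] by linarith
    also have "\<dots> = q * (of_rat c + d j \<bullet> z\<^sub>0)" by (simp add: algebra_simps)
    finally show ?thesis using q by simp
  qed
  moreover have "of_rat c + d j \<bullet> z \<le> f x z" if x': "x \<in> \<Omega>" and dx: "dist x x\<^sub>0 < \<delta>" for x z
  proof -
    \<comment> \<open>Coercivity absorbs the error of size \<open>\<kappa> (1 + norm z)\<close> made by freezing \<open>x\<close> and moving the slope.\<close>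
    have "f x\<^sub>0 z \<le> f x z + \<kappa> / 2 * (1 + norm z)"
    proof -
      have "\<bar>f x z - f x\<^sub>0 z\<bar> \<le> \<omega> (norm (x - x\<^sub>0)) * (1 + norm z)" by (rule f_\<omega>[OF x' x])
      also have "\<dots> \<le> \<kappa> / 2 * (1 + norm z)" using \<delta>(2)[OF dx] by (intro mult_right_mono) auto
      finally show ?thesis by linarith
    qed
    moreover have "\<kappa> * (norm z - 1) \<le> \<kappa> * (M * f x z)" using \<kappa>(1) f_lower[OF x', of z] by (intro mult_left_mono) auto
    ultimately have "c\<^sub>0 + b\<^sub>0 \<bullet> z - \<kappa> / 2 * (1 + norm z) + \<kappa> * (norm z - 1) \<le> q * f x z"
      using 0(2)[of z] by (simp add: q_def algebra_simps)
    moreover have "q * (of_rat c + d j \<bullet> z) \<le> c\<^sub>0 - 2 * \<kappa> + b\<^sub>0 \<bullet> z + \<kappa> / 2 * norm z"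

      using c'(2) near[of z, unfolded inner_scaleR_left] unfolding distrib_left by linarith
    ultimately have "q * (of_rat c + d j \<bullet> z) \<le> q * f x z"
      using \<kappa>(1) by (simp add: algebra_simps add_divide_distrib)
    then show ?thesis using q by simp
  qed
  ultimately show ?thesis using \<delta>(1) by blast
qed

text \<open>Equal to 1 within distance \<open>1 / (n + 1)\<close> of \<open>q\<close> and to 0
  beyond \<open>2 / (n + 1)\<close>. It turns an affine function that is valid near one point into a
  minorant on all of \<Omega>.\<close>

definition bump :: "'a \<Rightarrow> nat \<Rightarrow> 'a \<Rightarrow> real" where
  "bump q n x = max 0 (min 1 (2 - real (Suc n) * dist x q))"

lemma bump_bounds: "0 \<le> bump q n x" "bump q n x \<le> 1"
  by (auto simp: bump_def)

lemma bump_eq_0: "2 \<le> dist x q \<Longrightarrow> bump q n x = 0"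
proof -
  assume "2 \<le> dist x q"
  then have "2 * 1 \<le> dist x q * real (Suc n)" by (intro mult_mono) auto
  then show ?thesis by (simp add: bump_def mult.commute del: of_nat_Suc)
qed

lemma continuous_bump: "continuous_on X (bump q n)"
  unfolding bump_def by (intro continuous_intros)

text \<open>A candidate is a localised affine function coded by a centre, a radius, a slope and a
  rational offset. As \<open>f\<close> is nonnegative, a weight in \<open>[0, 1]\<close> that
  vanishes where the affine function is too large keeps it below \<open>f\<close>, and the bounded
  support makes the offset integrable.\<close>

lemma affine_minorants_dense:
  "\<exists>\<alpha> \<beta>. (\<forall>k::nat. affine_minorant \<Omega> f (\<alpha> k) (\<beta> k)) \<and>
     (\<forall>x z r. x \<in> \<Omega> \<longrightarrow> r < f x z \<longrightarrow> (\<exists>k. r < \<alpha> k x + \<beta> k x \<bullet> z))"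
proof -
  obtain dq :: "nat \<Rightarrow> 'a" where dq: "\<And>X. open X \<Longrightarrow> X \<noteq> {} \<Longrightarrow> \<exists>n. dq n \<in> X" by (erule dense_sequence)
  obtain db :: "nat \<Rightarrow> 'b" where db: "\<And>X. open X \<Longrightarrow> X \<noteq> {} \<Longrightarrow> \<exists>n. db n \<in> X" by (erule dense_sequence)
  define good where "good = (\<lambda>(i, n, j, c::rat). \<forall>x\<in>\<Omega>. \<forall>z. bump (dq i) n x * (of_rat c + db j \<bullet> z) \<le> f x z)"
  define A where "A = (\<lambda>(i, n, j :: nat, c::rat) x. bump (dq i) n x * of_rat c :: real)"
  define B where "B = (\<lambda>(i :: nat, n, j, c::rat) x. bump (dq i) n x *\<^sub>R db j)"
  define dec where "dec k = (from_nat k :: nat \<times> nat \<times> nat \<times> rat)" for k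
  \<comment> \<open>Codes that violate the bound are replaced by the zero minorant, so that every
    index is admissible.\<close>
  define \<alpha> where "\<alpha> k x = (if good (dec k) then A (dec k) x else 0)" for k x
  define \<beta> where "\<beta> k x = (if good (dec k) then B (dec k) x else 0)" for k x
  have minor: "affine_minorant \<Omega> f (A t) (B t)" if "good t" for t
  proof -
    obtain i n j c where t: "t = (i, n, j, c)" by (cases t) auto
    have [measurable]: "bump (dq i) n \<in> borel_measurable (leb_on \<Omega>)"
      by (rule borel_measurable_continuous_borel_on[OF continuous_bump sets_leb_on])
    have "integrable (leb_on \<Omega>) (\<lambda>x. bump (dq i) n x * of_rat c :: real)"
    proof (rule Bochner_Integration.integrable_bound)
      have "\<Omega> \<inter> ball (dq i) 2 \<in> borel_on \<Omega>" by (auto simp: sets_restrict_space)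
      moreover have "emeasure lborel (\<Omega> \<inter> ball (dq i) 2) < \<infinity>"
        using emeasure_bounded_finite[of "\<Omega> \<inter> ball (dq i) 2"] by (simp add: bounded_Int)
      ultimately show "integrable (leb_on \<Omega>) (\<lambda>x. of_rat c * indicator (\<Omega> \<inter> ball (dq i) 2) x :: real)"
        by (intro integrable_mult_right integrable_real_indicator) (simp_all add: sets_leb_on emeasure_leb_on[OF \<Omega>])
      show "AE x in leb_on \<Omega>. norm (bump (dq i) n x * of_rat c :: real) \<le> norm (of_rat c * indicator (\<Omega> \<inter> ball (dq i) 2) x :: real)"
      proof (rule AE_I2)
        fix x assume x: "x \<in> space (leb_on \<Omega>)"
        show "norm (bump (dq i) n x * of_rat c :: real) \<le> norm (of_rat c * indicator (\<Omega> \<inter> ball (dq i) 2) x :: real)"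
        proof (cases "dist x (dq i) < 2")
          case True
          then show ?thesis using x bump_bounds[of "dq i" n x]
            by (simp add: space_leb_on abs_mult mult_left_le_one_le dist_commute)
        qed (simp add: bump_eq_0)
      qed
    qed measurable
    moreover have "continuous_on \<Omega> (\<lambda>x. bump (dq i) n x *\<^sub>R db j)" by (intro continuous_intros continuous_bump)
    moreover have "bounded ((\<lambda>x. bump (dq i) n x *\<^sub>R db j) ` \<Omega>)"
      by (rule boundedI[of _ "norm (db j)"]) (auto simp: bump_bounds intro!: mult_left_le_one_le)
    moreover have "bump (dq i) n x * of_rat c + (bump (dq i) n x *\<^sub>R db j) \<bullet> z \<le> f x z" if "x \<in> \<Omega>" for x z
    proof -
      have "bump (dq i) n x * (of_rat c + db j \<bullet> z) \<le> f x z" using \<open>good t\<close> that unfolding t good_def by simp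
      then show ?thesis by (simp add: algebra_simps)
    qed
    ultimately show ?thesis unfolding t A_def B_def affine_minorant_def by simp
  qed
  have "affine_minorant \<Omega> f (\<alpha> k) (\<beta> k)" for k
    using minor[of "dec k"] affine_minorant_zero[of \<Omega> f] f_nonneg
    by (cases "good (dec k)") (simp_all add: \<alpha>_def[abs_def] \<beta>_def[abs_def])
  moreover have "\<exists>k. r < \<alpha> k x + \<beta> k x \<bullet> z" if x: "x \<in> \<Omega>" and r: "r < f x z" for x z r
  proof -
    obtain c j \<delta> where \<delta>: "0 < \<delta>" "r < of_rat c + db j \<bullet> z"
      "\<And>y z. y \<in> \<Omega> \<Longrightarrow> dist y x < \<delta> \<Longrightarrow> of_rat c + db j \<bullet> z \<le> f y z"
      using affine_support_nearby[OF x r db] by blast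
    \<comment> \<open>A third of \<delta>: the centre \<open>dq i\<close> is within
      \<open>1 / (n + 1)\<close> of \<open>x\<close>, so a point at distance \<delta> or more from
      \<open>x\<close> is farther than \<open>2 / (n + 1)\<close> from \<open>dq i\<close>, where
      the bump vanishes; at \<open>x\<close> itself it equals 1.\<close>
    obtain n where n: "1 / real (Suc n) < \<delta> / 3" using reals_Archimedean[of "\<delta> / 3"] \<delta>(1) by (auto simp: inverse_eq_divide)
    obtain i where "dq i \<in> ball x (1 / real (Suc n))" using dq[of "ball x (1 / real (Suc n))"] by auto
    then have i: "dist x (dq i) * real (Suc n) < 1" by (simp add: pos_less_divide_eq del: of_nat_Suc)
    have g: "good (i, n, j, c)"
      unfolding good_def
    proof (clarsimp simp del: of_nat_Suc)
      fix y z' assume y: "y \<in> \<Omega>"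
      show "bump (dq i) n y * (real_of_rat c + db j \<bullet> z') \<le> f y z'"
      proof (cases "dist y x < \<delta>")
        case True
        have "bump (dq i) n y * (real_of_rat c + db j \<bullet> z') \<le> bump (dq i) n y * f y z'"
          using \<delta>(3)[OF y True] bump_bounds by (intro mult_left_mono)
        also have "\<dots> \<le> f y z'" using bump_bounds f_nonneg[OF y] by (intro mult_left_le_one_le)
        finally show ?thesis .
      next
        case False
        have "3 < \<delta> * real (Suc n)" using n by (simp add: field_simps)
        also have "\<dots> \<le> dist y x * real (Suc n)" using False by (intro mult_right_mono) auto
        also have "\<dots> \<le> (dist y (dq i) + dist x (dq i)) * real (Suc n)"
          by (intro mult_right_mono dist_triangle2) simp
        finally have "2 < real (Suc n) * dist y (dq i)" using i by (simp add: algebra_simps)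
        then have "bump (dq i) n y = 0" by (simp add: bump_def)
        then show ?thesis using f_nonneg[OF y] by simp
      qed
    qed
    have b1: "bump (dq i) n x = 1" using i by (simp add: bump_def mult.commute)
    obtain k where k: "dec k = (i, n, j, c)" unfolding dec_def by (metis from_nat_to_nat)
    have "\<alpha> k x + \<beta> k x \<bullet> z = of_rat c + db j \<bullet> z"
      using g k b1 by (simp add: \<alpha>_def \<beta>_def A_def B_def)
    then show ?thesis using \<delta>(2) by (intro exI[of _ k]) simp
  qed
  ultimately show ?thesis by blast
qed

lemma lower_bound:
  assumes \<mu>: "\<mu> \<in> radon_measures \<Omega>" and u: "\<And>j. u j \<in> L1 \<Omega>"
    and conv: "weak_star \<Omega> (\<lambda>j. leb_measure \<Omega> (u j)) \<mu>"
  shows "(\<integral>\<^sup>+x. ennreal (f x (ac_density \<Omega> \<mu> x)) \<partial>leb_on \<Omega>)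
      + (\<integral>\<^sup>+x. ennreal (recession f x (polar \<Omega> (sing_part \<Omega> \<mu>) x)) \<partial>tv \<Omega> (sing_part \<Omega> \<mu>))
    \<le> liminf (\<lambda>j. functional \<Omega> f (u j))"
proof -
  obtain \<alpha> \<beta> where "\<And>k::nat. affine_minorant \<Omega> f (\<alpha> k) (\<beta> k)"
     "\<And>x z r. x \<in> \<Omega> \<Longrightarrow> r < f x z \<Longrightarrow> \<exists>k. r < \<alpha> k x + \<beta> k x \<bullet> z"
    using affine_minorants_dense by blast
  then show ?thesis
    unfolding functional_def
    by (intro lsc_weak_star[OF \<Omega> \<mu> f_nonneg _ u conv, where \<alpha> = \<alpha> and \<beta> = \<beta>] recession_ray)
qed

end

section \<open>Weakly* convergent sequences are tight\<close>

text \<open>An exhaustion function: inside \<Omega> it blows up at infinity and at the boundary. If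
  \<Omega> is the whole space, \<open>infdist\<close> to the empty complement is 0 and
  \<open>inverse 0 = 0\<close>, so it reduces to the norm.\<close>

definition depth :: "'a::euclidean_space set \<Rightarrow> 'a \<Rightarrow> real" where
  "depth \<Omega> x = norm x + inverse (infdist x (- \<Omega>))"

text \<open>Equal to 1 up to depth \<open>n\<close> and to 0 from depth \<open>n + 1\<close> on,
  hence on \<Omega> supported in a compact sublevel set of \<open>depth\<close>.\<close>

definition cutoff :: "'a::euclidean_space set \<Rightarrow> nat \<Rightarrow> 'a \<Rightarrow> real" where
  "cutoff \<Omega> n x = max 0 (min 1 (real n + 1 - depth \<Omega> x))"

lemma depth_nonneg: "0 \<le> depth \<Omega> x"
  by (simp add: depth_def infdist_nonneg)

lemma infdist_compl_pos:
  assumes "open \<Omega>" "x \<in> \<Omega>" "\<Omega> \<noteq> UNIV"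
  shows "0 < infdist x (- \<Omega>)"
  using assms in_closed_iff_infdist_zero[of "- \<Omega>" x] infdist_nonneg[of x "- \<Omega>"] by force

lemma continuous_depth:
  assumes "open \<Omega>"
  shows "continuous_on \<Omega> (depth \<Omega>)"
proof (cases "\<Omega> = UNIV")
  case True
  then have "depth \<Omega> = norm" by (simp add: depth_def[abs_def] infdist_def)
  then show ?thesis by (simp add: continuous_on_norm_id)
next
  case False
  then show ?thesis
    unfolding depth_def[abs_def] using infdist_compl_pos[OF assms]
    by (intro continuous_intros continuous_on_infdist) force
qed

lemma compact_depth_le:
  assumes "open \<Omega>"
  shows "compact {x \<in> \<Omega>. depth \<Omega> x \<le> c}"
proof (cases "\<Omega> = UNIV")
  case True
  then have "{x \<in> \<Omega>. depth \<Omega> x \<le> c} = cball 0 c" by (auto simp: depth_def infdist_def)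
  then show ?thesis by simp
next
  case False
  \<comment> \<open>\<open>depth\<close> is known to be continuous only on \<Omega>, so closedness
    in the whole space needs a closed subset of \<Omega> that contains the sublevel set; the bound
    on \<open>inverse (infdist x (- \<Omega>))\<close> provides it.\<close>
  define F where "F = {x. 1 \<le> c * infdist x (- \<Omega>)}"
  have "closed F" unfolding F_def by (intro closed_Collect_le continuous_intros continuous_on_infdist)
  have F: "F \<subseteq> \<Omega>"
  proof
    fix x assume "x \<in> F"
    then have "infdist x (- \<Omega>) \<noteq> 0" by (auto simp: F_def)
    then show "x \<in> \<Omega>" using infdist_zero[of x "- \<Omega>"] by blast
  qed
  have eq: "{x \<in> \<Omega>. depth \<Omega> x \<le> c} = F \<inter> depth \<Omega> -` {..c}"
  proof -
    have "x \<in> F" if "x \<in> \<Omega>" "depth \<Omega> x \<le> c" for x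
    proof -
      have p: "0 < infdist x (- \<Omega>)" by (rule infdist_compl_pos[OF assms that(1) False])
      have "inverse (infdist x (- \<Omega>)) \<le> c" using that(2) norm_ge_zero[of x] unfolding depth_def by linarith
      then show ?thesis using p by (simp add: F_def field_simps)
    qed
    then show ?thesis using F by auto
  qed
  have "closed {x \<in> \<Omega>. depth \<Omega> x \<le> c}"
    unfolding eq using continuous_on_subset[OF continuous_depth[OF assms] F] \<open>closed F\<close>
    by (intro continuous_closed_preimage) auto
  moreover have "bounded {x \<in> \<Omega>. depth \<Omega> x \<le> c}"
  proof (rule boundedI[of _ c])
    fix x assume "x \<in> {x \<in> \<Omega>. depth \<Omega> x \<le> c}"
    moreover have "norm x \<le> depth \<Omega> x" by (simp add: depth_def infdist_nonneg)
    ultimately show "norm x \<le> c" by simp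
  qed
  ultimately show ?thesis by (simp add: compact_eq_bounded_closed)
qed

lemma cutoff_bounds: "0 \<le> cutoff \<Omega> n x" "cutoff \<Omega> n x \<le> 1"
  by (auto simp: cutoff_def)

lemma cutoff_eq_1: "depth \<Omega> x \<le> real n \<Longrightarrow> cutoff \<Omega> n x = 1"
  by (auto simp: cutoff_def)

lemma cutoff_eq_0: "real n + 1 \<le> depth \<Omega> x \<Longrightarrow> cutoff \<Omega> n x = 0"
  by (auto simp: cutoff_def)

lemma cutoff_mono: "m \<le> n \<Longrightarrow> cutoff \<Omega> m x \<le> cutoff \<Omega> n x"
  by (auto simp: cutoff_def)

lemma continuous_cutoff: "open \<Omega> \<Longrightarrow> continuous_on \<Omega> (cutoff \<Omega> n)"
  unfolding cutoff_def[abs_def] by (intro continuous_intros continuous_depth)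

lemma cutoff_tendsto: "(\<lambda>n. cutoff \<Omega> n x) \<longlonglongrightarrow> 1"
proof (rule tendsto_eventually)
  obtain m where "depth \<Omega> x \<le> real m" using real_arch_simple by blast
  then show "eventually (\<lambda>n. cutoff \<Omega> n x = 1) sequentially"
    by (intro eventually_sequentiallyI[of m] cutoff_eq_1) simp
qed

lemma measurable_cutoff:
  "open \<Omega> \<Longrightarrow> sets L = borel_on \<Omega> \<Longrightarrow> cutoff \<Omega> n \<in> borel_measurable L"
  by (intro borel_measurable_continuous_borel_on[OF continuous_cutoff])

lemma integrable_cutoff_mult:
  assumes "open \<Omega>" "sets L = borel_on \<Omega>" "integrable L (g :: _ \<Rightarrow> real)"
  shows "integrable L (\<lambda>x. cutoff \<Omega> n x * g x)" "integrable L (\<lambda>x. (1 - cutoff \<Omega> n x) * g x)"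
proof -
  have [measurable]: "cutoff \<Omega> n \<in> borel_measurable L" by (rule measurable_cutoff[OF assms(1,2)])
  have [measurable]: "g \<in> borel_measurable L" using assms(3) by simp
  show "integrable L (\<lambda>x. cutoff \<Omega> n x * g x)"
    by (rule Bochner_Integration.integrable_bound[OF assms(3)])
      (auto simp: abs_mult cutoff_bounds intro!: mult_left_le_one_le)
  show "integrable L (\<lambda>x. (1 - cutoff \<Omega> n x) * g x)"
    by (rule Bochner_Integration.integrable_bound[OF assms(3)])
      (auto simp: abs_mult cutoff_bounds intro!: mult_left_le_one_le)
qed

lemma integrable_cutoff:
  assumes "open \<Omega>"
  shows "integrable (leb_on \<Omega>) (cutoff \<Omega> n)"
proof (rule Bochner_Integration.integrable_bound)
  let ?K = "{x \<in> \<Omega>. depth \<Omega> x \<le> real n + 1}"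
  have K: "compact ?K" by (rule compact_depth_le[OF assms])
  then have Kb: "?K \<in> borel_on \<Omega>" by (auto simp: sets_restrict_space intro!: image_eqI[of _ _ ?K] borel_compact)
  have "emeasure (leb_on \<Omega>) ?K < \<infinity>"
    unfolding emeasure_leb_on[OF assms Kb] using emeasure_compact_finite[OF K] by simp
  then show "integrable (leb_on \<Omega>) (indicator ?K :: _ \<Rightarrow> real)"
    using Kb by (intro integrable_real_indicator) (auto simp: sets_leb_on)
  show "cutoff \<Omega> n \<in> borel_measurable (leb_on \<Omega>)" by (rule measurable_cutoff[OF assms sets_leb_on])
  show "AE x in leb_on \<Omega>. norm (cutoff \<Omega> n x) \<le> norm (indicator ?K x :: real)"
    by (intro AE_I2) (auto simp: space_leb_on indicator_def cutoff_bounds cutoff_eq_0)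
qed

lemma cutoff_tail_tendsto:
  assumes "open \<Omega>" "sets L = borel_on \<Omega>" "integrable L (g :: _ \<Rightarrow> real)"
  shows "(\<lambda>n. \<integral>x. (1 - cutoff \<Omega> n x) * g x \<partial>L) \<longlonglongrightarrow> 0"
proof -
  have "(\<lambda>n. \<integral>x. (1 - cutoff \<Omega> n x) * g x \<partial>L) \<longlonglongrightarrow> (\<integral>x. (1 - 1) * g x \<partial>L)"
  proof (rule integral_dominated_convergence[where w = "\<lambda>x. norm (g x)"])
    show "AE x in L. (\<lambda>n. (1 - cutoff \<Omega> n x) * g x) \<longlonglongrightarrow> (1 - 1) * g x"
      by (intro AE_I2 tendsto_intros cutoff_tendsto)
    show "AE x in L. norm ((1 - cutoff \<Omega> n x) * g x) \<le> norm (g x)" for n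
      by (intro AE_I2) (auto simp: abs_mult cutoff_bounds intro!: mult_left_le_one_le)
  qed (use assms integrable_cutoff_mult(2)[OF assms] in auto)
  then show ?thesis by simp
qed

section \<open>The gliding hump\<close>

lemma abs_vec_integral_le:
  fixes \<nu> :: "'a::euclidean_space set \<Rightarrow> 'b::euclidean_space"
  assumes \<nu>: "\<nu> \<in> radon_measures \<Omega>" and \<Omega>: "open \<Omega>"
    and \<phi>: "continuous_on \<Omega> \<phi>" "\<And>x. x \<in> \<Omega> \<Longrightarrow> norm (\<phi> x) \<le> 1 - cutoff \<Omega> n x"
  shows "\<bar>vec_integral \<Omega> \<phi> \<nu>\<bar> \<le> (\<integral>x. (1 - cutoff \<Omega> n x) * norm (polar \<Omega> \<nu> x) \<partial>tv \<Omega> \<nu>)"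
proof -
  let ?T = "tv \<Omega> \<nu>" and ?p = "polar \<Omega> \<nu>"
  have b: "bounded (\<phi> ` \<Omega>)"
  proof (rule boundedI[of _ 1])
    fix y assume "y \<in> \<phi> ` \<Omega>"
    then obtain x where "x \<in> \<Omega>" "y = \<phi> x" by blast
    then show "norm y \<le> 1" using \<phi>(2)[of x] cutoff_bounds(1)[of \<Omega> n x] by simp
  qed
  have i: "integrable ?T (\<lambda>x. \<phi> x \<bullet> ?p x)"
    by (rule integrable_bounded_inner[OF sets_tv integrable_polar[OF \<nu>] \<phi>(1) b])
  have "\<bar>vec_integral \<Omega> \<phi> \<nu>\<bar> \<le> (\<integral>x. \<bar>\<phi> x \<bullet> ?p x\<bar> \<partial>?T)"
    unfolding vec_integral_def by (rule integral_abs_bound)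
  also have "\<dots> \<le> (\<integral>x. (1 - cutoff \<Omega> n x) * norm (?p x) \<partial>?T)"
  proof (rule integral_mono)
    show "integrable ?T (\<lambda>x. (1 - cutoff \<Omega> n x) * norm (?p x))"
      by (rule integrable_cutoff_mult(2)[OF \<Omega> sets_tv]) (use integrable_polar[OF \<nu>] in simp)
    fix x assume "x \<in> space ?T"
    then have "norm (\<phi> x) * norm (?p x) \<le> (1 - cutoff \<Omega> n x) * norm (?p x)"
      using \<phi>(2) by (intro mult_right_mono) (auto simp: space_tv)
    then show "\<bar>\<phi> x \<bullet> ?p x\<bar> \<le> (1 - cutoff \<Omega> n x) * norm (?p x)"
      using Cauchy_Schwarz_ineq2[of "\<phi> x" "?p x"] by linarith
  qed (use i in auto)
  finally show ?thesis .
qed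

lemma abs_integral_inner_le:
  fixes u :: "'a::euclidean_space \<Rightarrow> 'b::euclidean_space"
  assumes u: "integrable (leb_on \<Omega>) u" and \<Omega>: "open \<Omega>"
    and \<phi>: "continuous_on \<Omega> \<phi>" "\<And>x. x \<in> \<Omega> \<Longrightarrow> norm (\<phi> x) \<le> 1 - cutoff \<Omega> n x"
  shows "\<bar>\<integral>x. \<phi> x \<bullet> u x \<partial>leb_on \<Omega>\<bar> \<le> (\<integral>x. (1 - cutoff \<Omega> n x) * norm (u x) \<partial>leb_on \<Omega>)"
proof -
  let ?L = "leb_on \<Omega>"
  have b: "bounded (\<phi> ` \<Omega>)"
  proof (rule boundedI[of _ 1])
    fix y assume "y \<in> \<phi> ` \<Omega>"
    then obtain x where "x \<in> \<Omega>" "y = \<phi> x" by blast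
    then show "norm y \<le> 1" using \<phi>(2)[of x] cutoff_bounds(1)[of \<Omega> n x] by simp
  qed
  have i: "integrable ?L (\<lambda>x. \<phi> x \<bullet> u x)"
    by (rule integrable_bounded_inner[OF sets_leb_on u \<phi>(1) b])
  have "\<bar>\<integral>x. \<phi> x \<bullet> u x \<partial>?L\<bar> \<le> (\<integral>x. \<bar>\<phi> x \<bullet> u x\<bar> \<partial>?L)" by (rule integral_abs_bound)
  also have "\<dots> \<le> (\<integral>x. (1 - cutoff \<Omega> n x) * norm (u x) \<partial>?L)"
  proof (rule integral_mono)
    show "integrable ?L (\<lambda>x. (1 - cutoff \<Omega> n x) * norm (u x))"
      by (rule integrable_cutoff_mult(2)[OF \<Omega> sets_leb_on]) (use u in simp)
    fix x assume "x \<in> space ?L"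
    then have "norm (\<phi> x) * norm (u x) \<le> (1 - cutoff \<Omega> n x) * norm (u x)"
      using \<phi>(2) by (intro mult_right_mono) (auto simp: space_leb_on)
    then show "\<bar>\<phi> x \<bullet> u x\<bar> \<le> (1 - cutoff \<Omega> n x) * norm (u x)"
      using Cauchy_Schwarz_ineq2[of "\<phi> x" "u x"] by linarith
  qed (use i in auto)
  finally show ?thesis .
qed

text \<open>The ideal field is \<open>u / norm u\<close>, which is not continuous. A continuous
  \<open>w\<close> close to \<open>u\<close> in \<open>L\<^sup>1\<close> replaces \<open>u\<close>,
  and \<delta> in the denominator keeps the quotient continuous where \<open>w\<close> vanishes. The
  weight confines the field to the shell between depths \<open>n\<close> and
  \<open>m + 1\<close>.\<close>

lemma hump_exists:
  fixes u :: "'a::euclidean_space \<Rightarrow> 'b::euclidean_space"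
  assumes u: "integrable (leb_on \<Omega>) u" and \<Omega>: "open \<Omega>" and e: "0 < e"
  shows "\<exists>\<phi>. continuous_on \<Omega> \<phi> \<and> (\<forall>x\<in>\<Omega>. norm (\<phi> x) \<le> (1 - cutoff \<Omega> n x) * cutoff \<Omega> m x) \<and>
    (\<integral>x. (1 - cutoff \<Omega> n x) * norm (u x) \<partial>leb_on \<Omega>) - (\<integral>x. (1 - cutoff \<Omega> m x) * norm (u x) \<partial>leb_on \<Omega>) - e
      \<le> (\<integral>x. \<phi> x \<bullet> u x \<partial>leb_on \<Omega>)"
proof -
  let ?L = "leb_on \<Omega>"
  define c where "c = (\<integral>x. cutoff \<Omega> m x \<partial>?L)"
  have c0: "0 \<le> c" unfolding c_def by (rule Bochner_Integration.integral_nonneg) (rule cutoff_bounds)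
  \<comment> \<open>The regularisation costs \<delta> times the weight, in total at most
    \<open>\<delta> * c \<le> e / 2\<close>; the distance between \<open>u\<close> and
    \<open>w\<close> enters twice and costs at most \<open>2 * e / 4\<close>.\<close>
  define \<delta> where "\<delta> = e / (2 * (c + 1))"
  have \<delta>: "0 < \<delta>" "\<delta> * c \<le> e / 2" using e c0 by (auto simp: \<delta>_def field_simps)
  obtain w where w: "continuous_on UNIV w" "integrable ?L w" "(\<integral>x. norm (u x - w x) \<partial>?L) < e / 4"
    using continuous_dense_L1[OF \<Omega> u, of "e/4"] e by auto
  define s where "s x = (1 - cutoff \<Omega> n x) * cutoff \<Omega> m x" for x
  have s: "0 \<le> s x" "s x \<le> 1" "s x \<le> cutoff \<Omega> m x" for x
    using cutoff_bounds[of \<Omega> n x] cutoff_bounds[of \<Omega> m x]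
    by (auto simp: s_def intro!: mult_le_one mult_left_le_one_le)
  define \<phi> where "\<phi> x = (s x / (norm (w x) + \<delta>)) *\<^sub>R w x" for x
  have pos: "0 < norm (w x) + \<delta>" for x using \<delta>(1) by (simp add: add_nonneg_pos)
  have cont: "continuous_on \<Omega> \<phi>"
    unfolding \<phi>_def[abs_def] s_def using pos continuous_on_subset[OF w(1)]
    by (intro continuous_intros continuous_cutoff[OF \<Omega>]) (auto simp: less_imp_neq[THEN not_sym])
  have n\<phi>: "norm (\<phi> x) \<le> s x" for x
  proof -
    have "norm (\<phi> x) = s x * (norm (w x) / (norm (w x) + \<delta>))" using s(1)[of x] pos[of x] by (simp add: \<phi>_def)
    also have "\<dots> \<le> s x * 1" using s(1)[of x] pos[of x] \<delta>(1) by (intro mult_left_mono) auto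
    finally show ?thesis by simp
  qed
  have b: "bounded (\<phi> ` \<Omega>)" using n\<phi> s(2) by (intro boundedI[of _ 1]) (auto intro: order_trans)
  have key: "(1 - cutoff \<Omega> n x) * norm (u x) - (1 - cutoff \<Omega> m x) * norm (u x) - 2 * norm (u x - w x) - \<delta> * cutoff \<Omega> m x
      \<le> \<phi> x \<bullet> u x" for x
  proof -
    have 1: "s x * (norm (w x) - \<delta>) \<le> \<phi> x \<bullet> w x"
    proof -
      have "norm (w x) - \<delta> \<le> (norm (w x))\<^sup>2 / (norm (w x) + \<delta>)"
        unfolding pos_le_divide_eq[OF pos] by (simp add: power2_eq_square algebra_simps)
      then have "s x * (norm (w x) - \<delta>) \<le> s x * ((norm (w x))\<^sup>2 / (norm (w x) + \<delta>))" using s(1) by (intro mult_left_mono)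
      then show ?thesis by (simp add: \<phi>_def power2_norm_eq_inner)
    qed
    have 2: "\<phi> x \<bullet> w x - norm (u x - w x) \<le> \<phi> x \<bullet> u x"
    proof -
      have "\<bar>\<phi> x \<bullet> (u x - w x)\<bar> \<le> norm (\<phi> x) * norm (u x - w x)" by (rule Cauchy_Schwarz_ineq2)
      also have "\<dots> \<le> 1 * norm (u x - w x)" using n\<phi>[of x] s(2)[of x] by (intro mult_right_mono) auto
      finally show ?thesis by (simp add: inner_diff_right)
    qed
    have 3: "s x * norm (u x) - norm (u x - w x) \<le> s x * norm (w x)"
    proof -
      have "s x * norm (u x) \<le> s x * (norm (w x) + norm (u x - w x))"
        using s(1) norm_triangle_sub[of "u x" "w x"] by (intro mult_left_mono) auto
      also have "\<dots> \<le> s x * norm (w x) + 1 * norm (u x - w x)"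
        unfolding distrib_left using s(2) by (intro add_left_mono mult_right_mono) auto
      finally show ?thesis by simp
    qed
    have 4: "s x * \<delta> \<le> \<delta> * cutoff \<Omega> m x" using s(3)[of x] \<delta>(1) by (simp add: mult.commute)
    have 5: "(1 - cutoff \<Omega> n x) * norm (u x) - (1 - cutoff \<Omega> m x) * norm (u x) \<le> s x * norm (u x)"
    proof -
      have "(1 - cutoff \<Omega> n x) * (1 - cutoff \<Omega> m x) \<le> 1 - cutoff \<Omega> m x"
        using cutoff_bounds[of \<Omega> n x] cutoff_bounds[of \<Omega> m x] by (intro mult_left_le_one_le) auto
      then have "(1 - cutoff \<Omega> n x) - (1 - cutoff \<Omega> m x) \<le> s x" by (simp add: s_def algebra_simps)
      then have "((1 - cutoff \<Omega> n x) - (1 - cutoff \<Omega> m x)) * norm (u x) \<le> s x * norm (u x)" by (rule mult_right_mono) simp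
      then show ?thesis by (simp add: left_diff_distrib)
    qed
    show ?thesis using 1 2 3 4 5 unfolding right_diff_distrib by linarith
  qed
  have i1: "integrable ?L (\<lambda>x. (1 - cutoff \<Omega> n x) * norm (u x))" for n
    by (rule integrable_cutoff_mult(2)[OF \<Omega> sets_leb_on]) (use u in simp)
  have i2: "integrable ?L (\<lambda>x. 2 * norm (u x - w x))" "integrable ?L (\<lambda>x. \<delta> * cutoff \<Omega> m x)"
    using u w(2) integrable_cutoff[OF \<Omega>] by auto
  have i3: "integrable ?L (\<lambda>x. \<phi> x \<bullet> u x)" by (rule integrable_bounded_inner[OF sets_leb_on u cont b])
  have "(\<integral>x. (1 - cutoff \<Omega> n x) * norm (u x) - (1 - cutoff \<Omega> m x) * norm (u x) - 2 * norm (u x - w x) - \<delta> * cutoff \<Omega> m x \<partial>?L)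
     \<le> (\<integral>x. \<phi> x \<bullet> u x \<partial>?L)"
    using i1 i2 i3 by (intro integral_mono key Bochner_Integration.integrable_diff) auto
  also have "(\<integral>x. (1 - cutoff \<Omega> n x) * norm (u x) - (1 - cutoff \<Omega> m x) * norm (u x) - 2 * norm (u x - w x) - \<delta> * cutoff \<Omega> m x \<partial>?L)
     = (\<integral>x. (1 - cutoff \<Omega> n x) * norm (u x) \<partial>?L) - (\<integral>x. (1 - cutoff \<Omega> m x) * norm (u x) \<partial>?L)
       - (\<integral>x. 2 * norm (u x - w x) \<partial>?L) - (\<integral>x. \<delta> * cutoff \<Omega> m x \<partial>?L)"
    using i1 i2 by (simp only: Bochner_Integration.integral_diff Bochner_Integration.integrable_diff)
  finally have "(\<integral>x. (1 - cutoff \<Omega> n x) * norm (u x) \<partial>?L) - (\<integral>x. (1 - cutoff \<Omega> m x) * norm (u x) \<partial>?L) - e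
      \<le> (\<integral>x. \<phi> x \<bullet> u x \<partial>?L)"
    using w(3) \<delta>(2) by (simp add: c_def)
  then show ?thesis using cont n\<phi> unfolding s_def by blast
qed

text \<open>The state of the inductive construction: a test field that is finished up to depth
  \<open>n\<close> and still zero beyond.\<close>

definition test_inside :: "'a::euclidean_space set \<Rightarrow> nat \<Rightarrow> ('a \<Rightarrow> 'b::euclidean_space) \<Rightarrow> bool" where
  "test_inside \<Omega> n \<phi> \<longleftrightarrow> continuous_on \<Omega> \<phi> \<and> (\<forall>x\<in>\<Omega>. norm (\<phi> x) \<le> 1) \<and>
     (\<forall>x\<in>\<Omega>. real n \<le> depth \<Omega> x \<longrightarrow> \<phi> x = 0)"

text \<open>The new hump occupies depths between \<open>n\<close> and \<open>n' = m + 1\<close>,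
  where \<Phi> vanishes, so the norm stays at most 1. The estimate is claimed for every continuation
  \<Psi> in the unit ball because later humps are not known yet; beyond depth \<open>n'\<close> they
  meet only mass of \<open>v j\<close> that the choice of \<open>m\<close> has made small.\<close>

lemma hump_step:
  fixes v :: "nat \<Rightarrow> 'a::euclidean_space \<Rightarrow> 'b::euclidean_space"
  assumes \<Omega>: "open \<Omega>" and \<nu>: "\<nu> \<in> radon_measures \<Omega>" and v: "\<And>j. v j \<in> L1 \<Omega>"
    and conv: "weak_star \<Omega> (\<lambda>j. leb_measure \<Omega> (v j)) \<nu>" and e: "0 < e"
    and tail: "(\<integral>x. (1 - cutoff \<Omega> n\<^sub>0 x) * norm (polar \<Omega> \<nu> x) \<partial>tv \<Omega> \<nu>) \<le> e / 8"
    and bad: "\<And>n J. \<exists>j\<ge>J. e < (\<integral>x. (1 - cutoff \<Omega> n x) * norm (v j x) \<partial>leb_on \<Omega>)"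
    and n: "n\<^sub>0 < n" and \<Phi>: "test_inside \<Omega> n \<Phi>"
  shows "\<exists>n' \<Phi>'. n < n' \<and> test_inside \<Omega> n' \<Phi>' \<and> (\<forall>x\<in>\<Omega>. depth \<Omega> x \<le> real n \<longrightarrow> \<Phi>' x = \<Phi> x) \<and>
    (\<exists>j\<ge>J. \<forall>\<Psi>. continuous_on \<Omega> \<Psi> \<and> (\<forall>x\<in>\<Omega>. norm (\<Psi> x) \<le> 1) \<and> (\<forall>x\<in>\<Omega>. depth \<Omega> x \<le> real n' \<longrightarrow> \<Psi> x = \<Phi>' x) \<longrightarrow>
       e / 4 \<le> (\<integral>x. \<Psi> x \<bullet> v j x \<partial>leb_on \<Omega>) - vec_integral \<Omega> \<Psi> \<nu>)"
proof -
  let ?L = "leb_on \<Omega>"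
  let ?I = "\<lambda>j n. \<integral>x. (1 - cutoff \<Omega> n x) * norm (v j x) \<partial>?L"
  have vi: "integrable ?L (v j)" for j using v by (simp add: L1_def)
  have \<Phi>': "continuous_on \<Omega> \<Phi>" "\<And>x. x \<in> \<Omega> \<Longrightarrow> norm (\<Phi> x) \<le> 1" "\<And>x. x \<in> \<Omega> \<Longrightarrow> real n \<le> depth \<Omega> x \<Longrightarrow> \<Phi> x = 0"
    using \<Phi> by (auto simp: test_inside_def)
  have \<Phi>b: "bounded (\<Phi> ` \<Omega>)" using \<Phi>'(2) by (intro boundedI[of _ 1]) auto
  have "(\<lambda>j. vec_integral \<Omega> \<Phi> (leb_measure \<Omega> (v j))) \<longlonglongrightarrow> vec_integral \<Omega> \<Phi> \<nu>"
    using conv \<Phi>'(1) \<Phi>b by (simp add: weak_star_def)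
  then have "(\<lambda>j. \<integral>x. \<Phi> x \<bullet> v j x \<partial>?L) \<longlonglongrightarrow> vec_integral \<Omega> \<Phi> \<nu>"
    by (simp add: vec_integral_leb[OF v borel_measurable_continuous_on_restrict[OF \<Phi>'(1)] \<Phi>b])
  then have "eventually (\<lambda>j. vec_integral \<Omega> \<Phi> \<nu> - e / 8 < (\<integral>x. \<Phi> x \<bullet> v j x \<partial>?L)) sequentially"
    using e by (intro order_tendstoD) auto
  then obtain J' where J': "\<And>j. J' \<le> j \<Longrightarrow> vec_integral \<Omega> \<Phi> \<nu> - e / 8 < (\<integral>x. \<Phi> x \<bullet> v j x \<partial>?L)"
    by (auto simp: eventually_sequentially)
  obtain j where j: "max J J' \<le> j" "e < ?I j n" using bad by blast
  have "(\<lambda>m. ?I j m) \<longlonglongrightarrow> 0" by (rule cutoff_tail_tendsto[OF \<Omega> sets_leb_on]) (use vi in simp)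
  then have "eventually (\<lambda>m. ?I j m < e / 16) sequentially" using e by (intro order_tendstoD) auto
  then have "eventually (\<lambda>m. n < m \<and> ?I j m < e / 16) sequentially"
    using eventually_gt_at_top[of n] by eventually_elim simp
  then obtain m where m: "n < m" "?I j m < e / 16" by (auto simp: eventually_sequentially)
  have e8: "0 < e / 8" using e by simp
  from hump_exists[OF vi \<Omega> e8, of n m j] obtain \<phi> where \<phi>: "continuous_on \<Omega> \<phi>"
    "\<And>x. x \<in> \<Omega> \<Longrightarrow> norm (\<phi> x) \<le> (1 - cutoff \<Omega> n x) * cutoff \<Omega> m x"
    "?I j n - ?I j m - e / 8 \<le> (\<integral>x. \<phi> x \<bullet> v j x \<partial>?L)" by blast
  have \<phi>0: "\<phi> x = 0" if "x \<in> \<Omega>" "depth \<Omega> x \<le> real n \<or> real m + 1 \<le> depth \<Omega> x" for x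
    using \<phi>(2)[OF that(1)] that(2) by (auto simp: cutoff_eq_1 cutoff_eq_0)
  have \<phi>1: "norm (\<phi> x) \<le> 1" if "x \<in> \<Omega>" for x
    using \<phi>(2)[OF that] mult_le_one[of "1 - cutoff \<Omega> n x" "cutoff \<Omega> m x"] cutoff_bounds[of \<Omega> _ x] by (smt (verit))
  have \<phi>b: "bounded (\<phi> ` \<Omega>)" using \<phi>1 by (intro boundedI[of _ 1]) auto
  let ?\<Phi> = "\<lambda>x. \<Phi> x + \<phi> x" and ?n = "Suc m"
  have "test_inside \<Omega> ?n ?\<Phi>"
    unfolding test_inside_def
  proof (intro conjI ballI impI)
    show "continuous_on \<Omega> ?\<Phi>" by (intro continuous_intros \<phi>(1) \<Phi>'(1))
    show "norm (?\<Phi> x) \<le> 1" if "x \<in> \<Omega>" for x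
    proof (cases "depth \<Omega> x \<le> real n")
      case True then show ?thesis using \<phi>0[OF that] \<Phi>'(2)[OF that] by simp
    next
      case False then show ?thesis using \<Phi>'(3)[OF that] \<phi>1[OF that] by simp
    qed
    show "?\<Phi> x = 0" if "x \<in> \<Omega>" "real ?n \<le> depth \<Omega> x" for x
      using \<phi>0[OF that(1)] \<Phi>'(3)[OF that(1)] that(2) m(1) by simp
  qed
  moreover have "?\<Phi> x = \<Phi> x" if "x \<in> \<Omega>" "depth \<Omega> x \<le> real n" for x using \<phi>0 that by simp
  moreover have "e / 4 \<le> (\<integral>x. \<Psi> x \<bullet> v j x \<partial>?L) - vec_integral \<Omega> \<Psi> \<nu>"
    if \<Psi>: "continuous_on \<Omega> \<Psi>" "\<And>x. x \<in> \<Omega> \<Longrightarrow> norm (\<Psi> x) \<le> 1"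
      and eq: "\<And>x. x \<in> \<Omega> \<Longrightarrow> depth \<Omega> x \<le> real ?n \<Longrightarrow> \<Psi> x = ?\<Phi> x" for \<Psi>
  proof -
    have \<Psi>b: "bounded (\<Psi> ` \<Omega>)" using \<Psi>(2) by (intro boundedI[of _ 1]) auto
    have c1: "continuous_on \<Omega> (\<lambda>x. \<Psi> x - \<Phi> x)" "continuous_on \<Omega> (\<lambda>x. \<Psi> x - ?\<Phi> x)"
      by (intro continuous_intros \<Psi>(1) \<Phi>'(1) \<phi>(1))+
    have d1: "norm (\<Psi> x - \<Phi> x) \<le> 1 - cutoff \<Omega> n\<^sub>0 x" if x: "x \<in> \<Omega>" for x
    proof (cases "depth \<Omega> x \<le> real n")
      case True
      then have "depth \<Omega> x \<le> real ?n" using m(1) by simp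
      then have "\<Psi> x = \<Phi> x" using eq[OF x] \<phi>0[OF x] True by simp
      then show ?thesis by (simp add: cutoff_bounds)
    next
      case False
      then have "\<Phi> x = 0" "real n\<^sub>0 + 1 \<le> depth \<Omega> x" using \<Phi>'(3)[OF x] n by auto
      then show ?thesis using \<Psi>(2)[OF x] by (simp add: cutoff_eq_0)
    qed
    have d2: "norm (\<Psi> x - ?\<Phi> x) \<le> 1 - cutoff \<Omega> m x" if x: "x \<in> \<Omega>" for x
    proof (cases "depth \<Omega> x \<le> real ?n")
      case True
      then show ?thesis using eq[OF x] by (simp add: cutoff_bounds)
    next
      case False
      then have "real n \<le> depth \<Omega> x" "real m + 1 \<le> depth \<Omega> x" using m(1) by auto
      then have "\<Phi> x = 0" "\<phi> x = 0" "real m + 1 \<le> depth \<Omega> x" using \<Phi>'(3)[OF x] \<phi>0[OF x] by auto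
      then show ?thesis using \<Psi>(2)[OF x] by (simp add: cutoff_eq_0)
    qed
    have "\<bar>vec_integral \<Omega> (\<lambda>x. \<Psi> x - \<Phi> x) \<nu>\<bar> \<le> e / 8"
      using abs_vec_integral_le[OF \<nu> \<Omega> c1(1) d1] tail by linarith
    moreover have "vec_integral \<Omega> (\<lambda>x. \<Psi> x - \<Phi> x) \<nu> = vec_integral \<Omega> \<Psi> \<nu> - vec_integral \<Omega> \<Phi> \<nu>"
      unfolding vec_integral_def inner_diff_left
      by (intro Bochner_Integration.integral_diff integrable_bounded_inner[OF sets_tv integrable_polar[OF \<nu>]] \<Psi>(1) \<Psi>b \<Phi>'(1) \<Phi>b)
    moreover have "\<bar>\<integral>x. (\<Psi> x - ?\<Phi> x) \<bullet> v j x \<partial>?L\<bar> \<le> ?I j m"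
      by (rule abs_integral_inner_le[OF vi \<Omega> c1(2) d2])
    moreover have "(\<integral>x. (\<Psi> x - ?\<Phi> x) \<bullet> v j x \<partial>?L) = (\<integral>x. \<Psi> x \<bullet> v j x \<partial>?L) - ((\<integral>x. \<Phi> x \<bullet> v j x \<partial>?L) + (\<integral>x. \<phi> x \<bullet> v j x \<partial>?L))"
    proof -
      note i = integrable_bounded_inner[OF sets_leb_on vi[of j] \<Psi>(1) \<Psi>b]
        integrable_bounded_inner[OF sets_leb_on vi[of j] \<Phi>'(1) \<Phi>b] integrable_bounded_inner[OF sets_leb_on vi[of j] \<phi>(1) \<phi>b]
      show ?thesis unfolding inner_diff_left inner_add_left using i
        by (simp only: Bochner_Integration.integral_diff Bochner_Integration.integral_add Bochner_Integration.integrable_add)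
    qed
    moreover have "vec_integral \<Omega> \<Phi> \<nu> - e / 8 < (\<integral>x. \<Phi> x \<bullet> v j x \<partial>?L)" using J' j(1) by simp
    \<comment> \<open>The hump contributes at least \<open>e - e/16 - e/8\<close>. The continuation
      costs \<open>e/16\<close>, the convergence for \<Phi> costs \<open>e/8\<close> and replacing
      \<Phi> by \<Psi> against \<nu> another \<open>e/8\<close>, which leaves
      \<open>e/2\<close>.\<close>
    ultimately show ?thesis using \<phi>(3) j(2) m(2) e by linarith
  qed
  moreover have "J \<le> j" using j(1) by simp
  ultimately show ?thesis
    using m(1) by (intro exI[of _ ?n] exI[of _ ?\<Phi>] conjI exI[of _ j]) auto
qed

text \<open>Testing with all bounded continuous fields, not only those of compact support, excludes
  an escape of mass to the boundary or to infinity. If mass escaped, infinitely many humps glued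
  into one field would keep its integrals away from their limit.\<close>

lemma weak_star_tight:
  fixes v :: "nat \<Rightarrow> 'a::euclidean_space \<Rightarrow> 'b::euclidean_space"
  assumes \<Omega>: "open \<Omega>" and \<nu>: "\<nu> \<in> radon_measures \<Omega>" and v: "\<And>j. v j \<in> L1 \<Omega>"
    and conv: "weak_star \<Omega> (\<lambda>j. leb_measure \<Omega> (v j)) \<nu>" and e: "0 < e"
  shows "\<exists>n. eventually (\<lambda>j. (\<integral>x. (1 - cutoff \<Omega> n x) * norm (v j x) \<partial>leb_on \<Omega>) \<le> e) sequentially"
proof (rule ccontr)
  let ?I = "\<lambda>j n. \<integral>x. (1 - cutoff \<Omega> n x) * norm (v j x) \<partial>leb_on \<Omega>"
  assume "\<not> ?thesis"
  then have bad: "\<exists>j\<ge>J. e < ?I j n" for n J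
    unfolding eventually_sequentially by (meson not_le)
  have "(\<lambda>n. \<integral>x. (1 - cutoff \<Omega> n x) * norm (polar \<Omega> \<nu> x) \<partial>tv \<Omega> \<nu>) \<longlonglongrightarrow> 0"
    by (rule cutoff_tail_tendsto[OF \<Omega> sets_tv]) (use integrable_polar[OF \<nu>] in simp)
  then have "eventually (\<lambda>n. (\<integral>x. (1 - cutoff \<Omega> n x) * norm (polar \<Omega> \<nu> x) \<partial>tv \<Omega> \<nu>) < e / 8) sequentially"
    using e by (intro order_tendstoD) auto
  then obtain n\<^sub>0 where tail: "(\<integral>x. (1 - cutoff \<Omega> n\<^sub>0 x) * norm (polar \<Omega> \<nu> x) \<partial>tv \<Omega> \<nu>) \<le> e / 8"
    by (auto simp: eventually_sequentially intro: less_imp_le)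
  \<comment> \<open>\<open>k \<le> fst s\<close> makes the finished depths tend to infinity, so that
    the glued field is determined everywhere; \<open>n\<^sub>0 < fst s\<close> is the hypothesis of
    \<open>hump_step\<close>.\<close>
  define P where "P k s \<longleftrightarrow> n\<^sub>0 < fst s \<and> k \<le> fst s \<and> test_inside \<Omega> (fst s) (snd s)" for k and s :: "nat \<times> ('a \<Rightarrow> 'b)"
  define Q where "Q k s t \<longleftrightarrow> fst s < fst t \<and> (\<forall>x\<in>\<Omega>. depth \<Omega> x \<le> real (fst s) \<longrightarrow> snd t x = snd s x) \<and>
    (\<exists>j\<ge>k. \<forall>\<Psi>. continuous_on \<Omega> \<Psi> \<and> (\<forall>x\<in>\<Omega>. norm (\<Psi> x) \<le> 1) \<and> (\<forall>x\<in>\<Omega>. depth \<Omega> x \<le> real (fst t) \<longrightarrow> \<Psi> x = snd t x) \<longrightarrow>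
       e / 4 \<le> (\<integral>x. \<Psi> x \<bullet> v j x \<partial>leb_on \<Omega>) - vec_integral \<Omega> \<Psi> \<nu>)" for k :: nat and s t :: "nat \<times> ('a \<Rightarrow> 'b)"
  have "\<exists>F. \<forall>k. P k (F k) \<and> Q k (F k) (F (Suc k))"
  proof (rule dependent_nat_choice)
    have "P 0 (Suc n\<^sub>0, \<lambda>x. 0)" by (simp add: P_def test_inside_def)
    then show "\<exists>s. P 0 s" by blast
    fix s k assume s: "P k s"
    obtain n' \<Phi>' where "fst s < n'" "test_inside \<Omega> n' \<Phi>'" "Q k s (n', \<Phi>')"
      using hump_step[OF \<Omega> \<nu> v conv e tail bad, of "fst s" "snd s" k] s unfolding P_def Q_def fst_conv snd_conv by blast
    then have "P (Suc k) (n', \<Phi>') \<and> Q k s (n', \<Phi>')" using s by (simp add: P_def)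
    then show "\<exists>t. P (Suc k) t \<and> Q k s t" by blast
  qed
  then obtain F where F: "\<And>k. P k (F k)" "\<And>k. Q k (F k) (F (Suc k))" by blast
  define n where "n k = fst (F k)" for k
  define \<Phi> where "\<Phi> k = snd (F k)" for k
  have n: "k \<le> n k" "n k < n (Suc k)" and \<Phi>: "test_inside \<Omega> (n k) (\<Phi> k)" for k
    using F(1)[of k] F(2)[of k] by (simp_all add: P_def Q_def n_def \<Phi>_def)
  have step: "\<Phi> (Suc k) x = \<Phi> k x" if "x \<in> \<Omega>" "depth \<Omega> x \<le> real (n k)" for k x
    using F(2)[of k] that by (simp add: Q_def n_def \<Phi>_def)
  have nm: "n k \<le> n l" if "k \<le> l" for k l
    by (rule lift_Suc_mono_le[of n, OF less_imp_le[OF n(2)] that])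
  have agree: "\<Phi> l x = \<Phi> k x" if "x \<in> \<Omega>" "depth \<Omega> x \<le> real (n k)" "k \<le> l" for k l x
    using that(3)
  proof (induction l rule: dec_induct)
    case (step l)
    have "depth \<Omega> x \<le> real (n l)" using that(2) nm[OF step(1)] by simp
    then show ?case using \<open>\<And>k x. x \<in> \<Omega> \<Longrightarrow> depth \<Omega> x \<le> real (n k) \<Longrightarrow> \<Phi> (Suc k) x = \<Phi> k x\<close>[OF that(1)] step by simp
  qed simp
  \<comment> \<open>The index is the depth rounded up; by \<open>k \<le> n k\<close> the field with
    that index is already final at \<open>x\<close>.\<close>
  define \<Psi> where "\<Psi> x = \<Phi> (nat \<lceil>depth \<Omega> x\<rceil>) x" for x
  have \<Psi>_eq: "\<Psi> x = \<Phi> k x" if "x \<in> \<Omega>" "depth \<Omega> x \<le> real (n k)" for k x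
  proof -
    let ?k = "nat \<lceil>depth \<Omega> x\<rceil>"
    have "depth \<Omega> x \<le> real ?k" using depth_nonneg[of \<Omega> x] by linarith
    then have "depth \<Omega> x \<le> real (n ?k)" using n(1)[of ?k] by linarith
    then show ?thesis unfolding \<Psi>_def using agree[OF that(1)] that(2) by (metis le_cases)
  qed
  have norm\<Psi>: "norm (\<Psi> x) \<le> 1" if "x \<in> \<Omega>" for x
    unfolding \<Psi>_def using \<Phi> that by (simp add: test_inside_def)
  have cont: "continuous_on \<Omega> \<Psi>"
    unfolding continuous_on_eq_continuous_at[OF \<Omega>]
  proof
    fix x assume x: "x \<in> \<Omega>"
    \<comment> \<open>Near \<open>x\<close> the depth stays below \<open>k\<close>, so \<Psi>
      coincides there with the single continuous field \<open>\<Phi> k\<close>.\<close>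
    obtain k where k: "depth \<Omega> x < real k" using reals_Archimedean2 by blast
    have "isCont (depth \<Omega>) x" using continuous_depth[OF \<Omega>] x by (simp add: continuous_on_eq_continuous_at[OF \<Omega>])
    then have "(depth \<Omega> \<longlongrightarrow> depth \<Omega> x) (nhds x)" by (simp add: tendsto_nhds_iff isCont_def)
    then have "eventually (\<lambda>y. depth \<Omega> y < real k) (nhds x)" using k by (rule order_tendstoD)
    moreover have "eventually (\<lambda>y. y \<in> \<Omega>) (nhds x)" using \<Omega> x by (rule eventually_nhds_in_open)
    ultimately have "eventually (\<lambda>y. \<Psi> y = \<Phi> k y) (nhds x)"
    proof eventually_elim
      case (elim y)
      have "depth \<Omega> y \<le> real (n k)" using elim(1) n(1)[of k] by linarith
      then show ?case using \<Psi>_eq elim(2) by blast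
    qed
    moreover have "isCont (\<Phi> k) x"
      using \<Phi>[of k] x by (auto simp: test_inside_def continuous_on_eq_continuous_at[OF \<Omega>])
    ultimately show "isCont \<Psi> x" using isCont_cong by blast
  qed
  have b: "bounded (\<Psi> ` \<Omega>)" using norm\<Psi> by (intro boundedI[of _ 1]) auto
  have "(\<lambda>j. vec_integral \<Omega> \<Psi> (leb_measure \<Omega> (v j))) \<longlonglongrightarrow> vec_integral \<Omega> \<Psi> \<nu>"
    using conv cont b by (simp add: weak_star_def)
  then have "(\<lambda>j. \<integral>x. \<Psi> x \<bullet> v j x \<partial>leb_on \<Omega>) \<longlonglongrightarrow> vec_integral \<Omega> \<Psi> \<nu>"
    by (simp add: vec_integral_leb[OF v borel_measurable_continuous_on_restrict[OF cont] b])
  then have "eventually (\<lambda>j. (\<integral>x. \<Psi> x \<bullet> v j x \<partial>leb_on \<Omega>) < vec_integral \<Omega> \<Psi> \<nu> + e / 4) sequentially"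
    using e by (intro order_tendstoD) auto
  then obtain J where J: "\<And>j. J \<le> j \<Longrightarrow> (\<integral>x. \<Psi> x \<bullet> v j x \<partial>leb_on \<Omega>) < vec_integral \<Omega> \<Psi> \<nu> + e / 4"
    by (auto simp: eventually_sequentially)
  have "\<Psi> x = snd (F (Suc J)) x" if "x \<in> \<Omega>" "depth \<Omega> x \<le> real (fst (F (Suc J)))" for x
    using \<Psi>_eq that by (simp add: n_def \<Phi>_def)
  then obtain j where "J \<le> j" "e / 4 \<le> (\<integral>x. \<Psi> x \<bullet> v j x \<partial>leb_on \<Omega>) - vec_integral \<Omega> \<Psi> \<nu>"
    using F(2)[of J] cont norm\<Psi> unfolding Q_def by blast
  then show False using J[of j] by simp
qed

section \<open>Tangents of the area integrand\<close>

definition area_fun :: "'b::real_normed_vector \<Rightarrow> real" where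
  "area_fun z = sqrt (1 + (norm z)\<^sup>2)"

text \<open>The affine function \<open>area_fun y + y \<bullet> (z - y) / area_fun y\<close>,
  simplified by \<open>(area_fun y)^2 = 1 + (norm y)^2\<close>. It is also the inner product of the
  unit vector \<open>(y, 1) / area_fun y\<close> with \<open>(z, 1)\<close>.\<close>

definition area_tangent :: "'b::real_inner \<Rightarrow> 'b \<Rightarrow> real" where
  "area_tangent y z = (1 + y \<bullet> z) / area_fun y"

lemma area_fun_ge_1: "1 \<le> area_fun z"
  by (simp add: area_fun_def)

lemma area_fun_pos: "0 < area_fun z"
  using area_fun_ge_1[of z] by linarith

lemma norm_le_area_fun: "norm z \<le> area_fun z"
  unfolding area_fun_def by (rule real_le_rsqrt) simp

lemma area_fun_le: "area_fun z \<le> 1 + norm z"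
  unfolding area_fun_def by (rule real_le_lsqrt) (auto simp: power2_sum)

lemma area_fun_sq: "area_fun z * area_fun z = 1 + (norm z)\<^sup>2"
  unfolding area_fun_def by (simp add: add_nonneg_nonneg)

lemma continuous_on_area_fun [continuous_intros]: "continuous_on X g \<Longrightarrow> continuous_on X (\<lambda>x. area_fun (g x))"
  unfolding area_fun_def by (intro continuous_intros)

lemma borel_measurable_area_fun: "g \<in> borel_measurable L \<Longrightarrow> (\<lambda>x. area_fun (g x)) \<in> borel_measurable L"
  unfolding area_fun_def by measurable

text \<open>The Cauchy-Schwarz inequality for the lifted vectors \<open>(y, 1)\<close> and
  \<open>(z, 1)\<close>.\<close>

lemma abs_inner_le_area_fun: "\<bar>1 + y \<bullet> z\<bar> \<le> area_fun y * area_fun z"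
proof -
  have "\<bar>1 + y \<bullet> z\<bar> \<le> 1 + norm y * norm z"
    using Cauchy_Schwarz_ineq2[of y z] by linarith
  also have "\<dots> \<le> area_fun y * area_fun z"
  proof (rule power2_le_imp_le)
    have "0 \<le> (norm y - norm z)\<^sup>2" by simp
    then have "(1 + norm y * norm z)\<^sup>2 \<le> (1 + (norm y)\<^sup>2) * (1 + (norm z)\<^sup>2)"
      by (simp add: power2_eq_square algebra_simps)
    also have "\<dots> = (area_fun y * area_fun z)\<^sup>2" by (simp add: power2_eq_square area_fun_sq[unfolded power2_eq_square, symmetric] mult_ac)
    finally show "(1 + norm y * norm z)\<^sup>2 \<le> (area_fun y * area_fun z)\<^sup>2" .
    show "0 \<le> area_fun y * area_fun z" using area_fun_pos[of y] area_fun_pos[of z] by simp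
  qed
  finally show ?thesis .
qed

lemma abs_area_tangent_le: "\<bar>area_tangent y z\<bar> \<le> area_fun z"
  using abs_inner_le_area_fun[of y z] area_fun_pos[of y] by (simp add: area_tangent_def pos_divide_le_eq mult.commute)

lemma area_tangent_le: "area_tangent y z \<le> area_fun z"
  using abs_area_tangent_le[of y z] by linarith

lemma area_tangent_self: "area_tangent z z = area_fun z"
  using area_fun_sq[of z] area_fun_pos[of z] by (simp add: area_tangent_def dot_square_norm field_simps)

text \<open>For unit vectors \<open>(norm (a - b))^2 = 2 * (1 - a \<bullet> b)\<close>, written out
  for the hemisphere points of \<open>y\<close> and \<open>z\<close>. A small relative gap between
  the area and its tangent thus means that directions and heights are close.\<close>

lemma norm_area_fun_direction:
  "(norm (y /\<^sub>R area_fun y - z /\<^sub>R area_fun z))\<^sup>2 + (inverse (area_fun y) - inverse (area_fun z))\<^sup>2 = 2 * (1 - area_tangent y z / area_fun z)"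
proof -
  have 1: "(norm y)\<^sup>2 = area_fun y * area_fun y - 1" "(norm z)\<^sup>2 = area_fun z * area_fun z - 1" using area_fun_sq[of y] area_fun_sq[of z] by auto
  have "(norm (y /\<^sub>R area_fun y - z /\<^sub>R area_fun z))\<^sup>2
      = (norm y)\<^sup>2 / (area_fun y * area_fun y) - 2 * (y \<bullet> z) / (area_fun y * area_fun z) + (norm z)\<^sup>2 / (area_fun z * area_fun z)"
    by (simp add: power2_norm_eq_inner inner_diff_left inner_diff_right inner_commute field_simps)
  then show ?thesis
    using area_fun_pos[of y] area_fun_pos[of z] unfolding 1
    by (simp add: area_tangent_def power2_eq_square field_simps)
qed

section \<open>The integrand on the hemisphere and its tangent majorants\<close>

context convex_integrand
begin

text \<open>Viewed on the hemisphere points \<open>(y, 1) / area_fun y\<close>, this function has a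
  continuous extension to the equator. The shift \<open>w\<close> stands for the continuous
  replacement of \<open>u\<^sub>0\<close>.\<close>

definition area_fun_ratio :: "('a \<Rightarrow> 'b) \<Rightarrow> 'a \<Rightarrow> 'b \<Rightarrow> real" where
  "area_fun_ratio w x y = f x (w x + y) / area_fun y"

text \<open>Here \<open>(p, t)\<close> is the limit on the closed hemisphere. On the equator,
  \<open>t = 0\<close>, the arguments escape to infinity and the shift, divided by the area,
  disappears; above it they converge to \<open>p /\<^sub>R t\<close> and the continuity of
  \<open>f\<close> suffices.\<close>

lemma area_fun_ratio_tendsto:
  assumes w: "continuous_on \<Omega> w" and x: "x \<in> \<Omega>" and xs: "xs \<longlonglongrightarrow> x" "\<And>n. xs n \<in> \<Omega>"
    and p: "(\<lambda>n. ys n /\<^sub>R area_fun (ys n)) \<longlonglongrightarrow> p" and t: "(\<lambda>n. inverse (area_fun (ys n))) \<longlonglongrightarrow> t"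
  shows "(\<lambda>n. area_fun_ratio w (xs n) (ys n)) \<longlonglongrightarrow> (if t = 0 then recession f x p else f x (w x + p /\<^sub>R t) * t)"
proof -
  have wx: "(\<lambda>n. w (xs n)) \<longlonglongrightarrow> w x"
    using continuous_on_tendsto_compose[OF w xs(1) x] xs(2) by simp
  show ?thesis
  proof (cases "t = 0")
    case True
    have s: "filterlim (\<lambda>n. area_fun (ys n)) at_top sequentially"
    proof -
      have "filterlim (\<lambda>n. inverse (inverse (area_fun (ys n)))) at_top sequentially"
        by (rule filterlim_inverse_at_top) (use t True in \<open>auto simp: area_fun_pos\<close>)
      then show ?thesis by simp
    qed
    have "(\<lambda>n. inverse (area_fun (ys n)) *\<^sub>R w (xs n) + ys n /\<^sub>R area_fun (ys n)) \<longlonglongrightarrow> 0 *\<^sub>R w x + p"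
      using t True by (intro tendsto_intros wx p) simp
    then have "(\<lambda>n. (w (xs n) + ys n) /\<^sub>R area_fun (ys n)) \<longlonglongrightarrow> p" by (simp add: scaleR_add_right)
    from recession_sequentially[OF x xs s this] show ?thesis using True by (simp add: area_fun_ratio_def)
  next
    case False
    have h: "(\<lambda>n. inverse (inverse (area_fun (ys n)))) \<longlonglongrightarrow> inverse t" using t False by (rule tendsto_inverse)
    have "(\<lambda>n. inverse (inverse (area_fun (ys n))) *\<^sub>R (ys n /\<^sub>R area_fun (ys n))) \<longlonglongrightarrow> inverse t *\<^sub>R p"
      by (intro tendsto_scaleR h p)
    moreover have "inverse (inverse (area_fun (ys n))) *\<^sub>R (ys n /\<^sub>R area_fun (ys n)) = ys n" for n
      using area_fun_pos[of "ys n"] by simp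
    ultimately have y: "ys \<longlonglongrightarrow> p /\<^sub>R t" by simp
    have "(\<lambda>n. (xs n, w (xs n) + ys n)) \<longlonglongrightarrow> (x, w x + p /\<^sub>R t)"
      by (intro tendsto_Pair xs tendsto_add wx y)
    from continuous_on_tendsto_compose[OF f_cont this]
    have "(\<lambda>n. f (xs n) (w (xs n) + ys n)) \<longlonglongrightarrow> f x (w x + p /\<^sub>R t)" using x xs(2) by simp
    then have "(\<lambda>n. f (xs n) (w (xs n) + ys n) * inverse (area_fun (ys n))) \<longlonglongrightarrow> f x (w x + p /\<^sub>R t) * t"
      by (intro tendsto_mult t)
    then show ?thesis using False by (simp add: area_fun_ratio_def divide_inverse)
  qed
qed

text \<open>Uniform continuity on a compact set, by contradiction. Along a subsequence both families
  converge to the same triple \<open>(x, p, t)\<close>, and the limit of the ratio depends on that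
  triple alone.\<close>

lemma area_fun_ratio_uniform:
  assumes w: "continuous_on \<Omega> w" and K: "compact K" "K \<subseteq> \<Omega>" and \<eta>: "0 < \<eta>"
  shows "\<exists>\<delta>>0. \<forall>x\<in>K. \<forall>y z. 1 - area_tangent y z / area_fun z < \<delta> \<longrightarrow> \<bar>area_fun_ratio w x y - area_fun_ratio w x z\<bar> < \<eta>"
proof (rule ccontr)
  assume "\<not> ?thesis"
  then have "\<forall>n. \<exists>x y z. x \<in> K \<and> 1 - area_tangent y z / area_fun z < 1 / real (Suc n) \<and> \<eta> \<le> \<bar>area_fun_ratio w x y - area_fun_ratio w x z\<bar>"
    by (metis not_le of_nat_0_less_iff zero_less_Suc zero_less_divide_1_iff)
  then obtain xs ys zs where s: "\<And>n. xs n \<in> K" "\<And>n. 1 - area_tangent (ys n) (zs n) / area_fun (zs n) < 1 / real (Suc n)"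
     "\<And>n. \<eta> \<le> \<bar>area_fun_ratio w (xs n) (ys n) - area_fun_ratio w (xs n) (zs n)\<bar>" by metis
  define e where "e y = (y /\<^sub>R area_fun y, inverse (area_fun y))" for y :: 'b
  let ?S = "K \<times> (cball (0::'b) 1 \<times> {0..1::real})"
  have cS: "compact ?S" by (intro compact_Times K(1) compact_cball compact_Icc)
  have inS: "\<forall>n. (xs n, e (ys n)) \<in> ?S"
  proof
    fix n
    show "(xs n, e (ys n)) \<in> ?S"
      using s(1) norm_le_area_fun[of "ys n"] area_fun_ge_1[of "ys n"] by (simp add: e_def field_simps)
  qed
  obtain l r where l: "l \<in> ?S" "strict_mono r" "((\<lambda>n. (xs n, e (ys n))) \<circ> r) \<longlonglongrightarrow> l"
    by (rule seq_compactE[OF compact_imp_seq_compact[OF cS] inS])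
  obtain x p t where lx: "l = (x, (p, t))" by (cases l) auto
  have x: "x \<in> \<Omega>" using l(1) K(2) by (auto simp: lx)
  have lim: "(\<lambda>n. (xs (r n), e (ys (r n)))) \<longlonglongrightarrow> (x, (p, t))" using l(3) by (simp add: lx o_def)
  have xs: "(\<lambda>n. xs (r n)) \<longlonglongrightarrow> x" using tendsto_fst[OF lim] by simp
  have p: "(\<lambda>n. ys (r n) /\<^sub>R area_fun (ys (r n))) \<longlonglongrightarrow> p" using tendsto_fst[OF tendsto_snd[OF lim]] by (simp add: e_def)
  have t: "(\<lambda>n. inverse (area_fun (ys (r n)))) \<longlonglongrightarrow> t" using tendsto_snd[OF tendsto_snd[OF lim]] by (simp add: e_def)
  have sq: "(\<lambda>n. sqrt (2 * (1 / real (Suc (r n))))) \<longlonglongrightarrow> 0"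
  proof -
    have "(\<lambda>n. 1 / real (Suc n)) \<longlonglongrightarrow> 0" using LIMSEQ_inverse_real_of_nat by (simp add: inverse_eq_divide)
    then have "(\<lambda>n. 1 / real (Suc (r n))) \<longlonglongrightarrow> 0" using LIMSEQ_subseq_LIMSEQ[OF _ l(2)] by (fastforce simp: o_def)
    then have "(\<lambda>n. sqrt (2 * (1 / real (Suc (r n))))) \<longlonglongrightarrow> sqrt (2 * 0)" by (intro tendsto_intros)
    then show ?thesis by simp
  qed
  have arith: "b + c = 2 * g \<Longrightarrow> g < h \<Longrightarrow> 0 \<le> c \<Longrightarrow> b \<le> 2 * h"
    "b + c = 2 * g \<Longrightarrow> g < h \<Longrightarrow> 0 \<le> b \<Longrightarrow> c \<le> 2 * h" for b c g h :: real by linarith+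
  have d1: "norm (ys n /\<^sub>R area_fun (ys n) - zs n /\<^sub>R area_fun (zs n)) \<le> sqrt (2 * (1 / real (Suc n)))" for n
  proof (rule real_le_rsqrt)
    show "(norm (ys n /\<^sub>R area_fun (ys n) - zs n /\<^sub>R area_fun (zs n)))\<^sup>2 \<le> 2 * (1 / real (Suc n))"
      by (rule arith(1)[OF norm_area_fun_direction s(2) zero_le_power2])
  qed
  have d2: "norm (inverse (area_fun (ys n)) - inverse (area_fun (zs n))) \<le> sqrt (2 * (1 / real (Suc n)))" for n
  proof (rule real_le_rsqrt)
    show "(norm (inverse (area_fun (ys n)) - inverse (area_fun (zs n))))\<^sup>2 \<le> 2 * (1 / real (Suc n))"
      unfolding real_norm_def power2_abs
      by (rule arith(2)[OF norm_area_fun_direction s(2) zero_le_power2])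
  qed
  have "(\<lambda>n. ys (r n) /\<^sub>R area_fun (ys (r n)) - zs (r n) /\<^sub>R area_fun (zs (r n))) \<longlonglongrightarrow> 0"
    by (rule Lim_null_comparison[OF _ sq]) (use d1 in \<open>auto intro: always_eventually\<close>)
  from tendsto_diff[OF p this] have p': "(\<lambda>n. zs (r n) /\<^sub>R area_fun (zs (r n))) \<longlonglongrightarrow> p" by simp
  have "(\<lambda>n. inverse (area_fun (ys (r n))) - inverse (area_fun (zs (r n)))) \<longlonglongrightarrow> 0"
    by (rule Lim_null_comparison[OF _ sq]) (use d2 in \<open>auto intro: always_eventually\<close>)
  from tendsto_diff[OF t this] have t': "(\<lambda>n. inverse (area_fun (zs (r n)))) \<longlonglongrightarrow> t" by simp
  have xK: "xs (r n) \<in> \<Omega>" for n using s(1) K(2) by blast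
  from tendsto_diff[OF area_fun_ratio_tendsto[OF w x xs xK p t] area_fun_ratio_tendsto[OF w x xs xK p' t']]
  have "(\<lambda>n. area_fun_ratio w (xs (r n)) (ys (r n)) - area_fun_ratio w (xs (r n)) (zs (r n))) \<longlonglongrightarrow> 0" by simp
  then have "eventually (\<lambda>n. dist (area_fun_ratio w (xs (r n)) (ys (r n)) - area_fun_ratio w (xs (r n)) (zs (r n))) 0 < \<eta>) sequentially"
    using \<eta> by (rule tendstoD)
  then obtain n where "\<bar>area_fun_ratio w (xs (r n)) (ys (r n)) - area_fun_ratio w (xs (r n)) (zs (r n))\<bar> < \<eta>"
    by (auto simp: eventually_sequentially dist_real_def)
  then show False using s(3)[of "r n"] by simp
qed

text \<open>The bound is arranged to be at least \<open>M\<close>, which also dominates the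
  recession function at unit vectors.\<close>

lemma area_fun_ratio_bound:
  assumes w: "continuous_on \<Omega> w" and K: "compact K" "K \<subseteq> \<Omega>"
  shows "\<exists>\<Gamma>\<ge>M. \<forall>x\<in>K. \<forall>y. area_fun_ratio w x y \<le> \<Gamma>"
proof -
  have "bounded (w ` K)" using continuous_on_subset[OF w K(2)] K(1) by (intro compact_imp_bounded compact_continuous_image)
  then obtain W where W: "\<And>x. x \<in> K \<Longrightarrow> norm (w x) \<le> W" by (auto simp: bounded_iff)
  have "area_fun_ratio w x y \<le> M * (2 + \<bar>W\<bar>)" if x: "x \<in> K" for x y
  proof -
    have "f x (w x + y) \<le> M * (1 + norm (w x + y))" using f_upper x K(2) by blast
    also have "\<dots> \<le> M * ((2 + \<bar>W\<bar>) * area_fun y)"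
    proof (rule mult_left_mono)
      have "1 * (1 + \<bar>W\<bar>) \<le> area_fun y * (1 + \<bar>W\<bar>)" using area_fun_ge_1[of y] by (intro mult_right_mono) auto
      then have "1 + \<bar>W\<bar> + norm y \<le> (2 + \<bar>W\<bar>) * area_fun y" using norm_le_area_fun[of y] by (simp add: algebra_simps)
      moreover have "norm (w x + y) \<le> \<bar>W\<bar> + norm y" using norm_triangle_ineq[of "w x" y] W[OF x] by linarith
      ultimately show "1 + norm (w x + y) \<le> (2 + \<bar>W\<bar>) * area_fun y" by linarith
    qed (use M in simp)
    finally show ?thesis using area_fun_pos[of y] by (simp add: area_fun_ratio_def pos_divide_le_eq mult_ac)
  qed
  moreover have "M * 1 \<le> M * (2 + \<bar>W\<bar>)" using M by (intro mult_left_mono) auto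
  ultimately show ?thesis by (intro exI[of _ "M * (2 + \<bar>W\<bar>)"]) auto
qed

lemma area_fun_ratio_nonneg: "x \<in> \<Omega> \<Longrightarrow> 0 \<le> area_fun_ratio w x y"
  using f_nonneg[of x] area_fun_pos[of y] by (simp add: area_fun_ratio_def)

lemma area_fun_ratio_mult: "area_fun_ratio w x y * area_fun y = f x (w x + y)"
  using area_fun_pos[of y] by (simp add: area_fun_ratio_def)

text \<open>The constant \<open>C\<close> pays for moving the base point \<open>y\<close> away from \<open>z\<close>: the gap \<open>area_fun z - area_tangent y z\<close>
  is bounded below, in proportion to \<open>area_fun z\<close>, unless \<open>y\<close> and \<open>z\<close> have almost the same direction on
  the hemisphere, in which case \<open>area_fun_ratio\<close> hardly changes.\<close>

lemma tangent_majorant: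
  assumes w: "continuous_on \<Omega> w" and K: "compact K" "K \<subseteq> \<Omega>" and \<eta>: "0 < \<eta>"
  shows "\<exists>C\<ge>M. \<forall>x\<in>K. \<forall>y z. area_fun_ratio w x y \<le> C \<and>
    f x (w x + z) \<le> area_fun_ratio w x y * area_tangent y z + \<eta> * area_fun z + C * (area_fun z - area_tangent y z)"
proof -
  obtain \<delta> where \<delta>: "0 < \<delta>"
    "\<And>x y z. x \<in> K \<Longrightarrow> 1 - area_tangent y z / area_fun z < \<delta> \<Longrightarrow> \<bar>area_fun_ratio w x y - area_fun_ratio w x z\<bar> < \<eta>"
    using area_fun_ratio_uniform[OF assms] by blast
  obtain \<Gamma> where \<Gamma>: "M \<le> \<Gamma>" "\<And>x y. x \<in> K \<Longrightarrow> area_fun_ratio w x y \<le> \<Gamma>"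
    using area_fun_ratio_bound[OF w K] by blast
  \<comment> \<open>The first entry settles \<open>1 - q < \<delta>\<close>, where \<open>C\<close>
    must dominate the ratio at \<open>y\<close>. The second gives
    \<open>C * (1 - q) \<ge> 2 * \<Gamma>\<close> elsewhere, enough for the ratios at
    \<open>y\<close> and \<open>z\<close> together even if \<open>q\<close> is near
    \<open>-1\<close>.\<close>
  define C where "C = max \<Gamma> (2 * \<Gamma> / \<delta>)"
  have C: "\<Gamma> \<le> C" "2 * \<Gamma> \<le> C * \<delta>" using \<delta>(1) by (auto simp: C_def max_def field_simps)
  have "f x (w x + z) \<le> area_fun_ratio w x y * area_tangent y z + \<eta> * area_fun z + C * (area_fun z - area_tangent y z)" if x: "x \<in> K" for x y z
  proof -
    define q where "q = area_tangent y z / area_fun z"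
    have q: "-1 \<le> q" "q \<le> 1" using abs_area_tangent_le[of y z] area_fun_pos[of z] by (auto simp: q_def divide_simps abs_le_iff)
    have g0: "0 \<le> area_fun_ratio w x y" using x K(2) by (intro area_fun_ratio_nonneg) auto
    have "area_fun_ratio w x z \<le> area_fun_ratio w x y * q + \<eta> + C * (1 - q)"
    proof (cases "1 - q < \<delta>")
      case True
      then have "area_fun_ratio w x z \<le> area_fun_ratio w x y + \<eta>" using \<delta>(2)[OF x, of y z] by (auto simp: q_def)
      moreover have "area_fun_ratio w x y * (1 - q) \<le> C * (1 - q)"
        using \<Gamma>(2)[OF x, of y] C(1) q(2) by (intro mult_right_mono) auto
      ultimately show ?thesis by (simp add: algebra_simps)
    next
      case False
      have "C * \<delta> \<le> C * (1 - q)" using False C(1) \<Gamma>(1) M by (intro mult_left_mono) auto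
      moreover have "area_fun_ratio w x y * (-1) \<le> area_fun_ratio w x y * q" using g0 q(1) by (intro mult_left_mono)
      ultimately show ?thesis using \<Gamma>(2)[OF x, of y] \<Gamma>(2)[OF x, of z] C(2) \<eta> by linarith
    qed
    then have "area_fun_ratio w x z * area_fun z \<le> (area_fun_ratio w x y * q + \<eta> + C * (1 - q)) * area_fun z"
      using area_fun_pos[of z] by (intro mult_right_mono) auto
    moreover have "q * area_fun z = area_tangent y z" using area_fun_pos[of z] by (simp add: q_def)
    then have "(area_fun_ratio w x y * q + \<eta> + C * (1 - q)) * area_fun z
        = area_fun_ratio w x y * area_tangent y z + \<eta> * area_fun z + C * (area_fun z - area_tangent y z)"
      by (simp add: algebra_simps)
    ultimately show ?thesis by (simp add: area_fun_ratio_mult)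
  qed
  moreover have "area_fun_ratio w x y \<le> C" if "x \<in> K" for x y using \<Gamma>(2)[OF that, of y] C(1) by linarith
  moreover have "M \<le> C" using \<Gamma>(1) C(1) by linarith
  ultimately show ?thesis by blast
qed

lemma area_fun_ray_tendsto:
  fixes p :: 'b
  assumes "norm p = 1"
  shows "(\<lambda>n. area_fun (real n *\<^sub>R p) / real n) \<longlonglongrightarrow> 1"
proof (rule tendsto_sandwich[OF _ _ tendsto_const])
  have "(\<lambda>n. 1 / real n + 1) \<longlonglongrightarrow> 0 + 1" by (intro tendsto_intros lim_const_over_n)
  then show "(\<lambda>n. 1 / real n + 1) \<longlonglongrightarrow> 1" by simp
  show "eventually (\<lambda>n. 1 \<le> area_fun (real n *\<^sub>R p) / real n) sequentially"
    using eventually_gt_at_top[of 0]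
    by eventually_elim (use norm_le_area_fun[of "real _ *\<^sub>R p"] assms in \<open>simp add: pos_le_divide_eq\<close>)
  show "eventually (\<lambda>n. area_fun (real n *\<^sub>R p) / real n \<le> 1 / real n + 1) sequentially"
    using eventually_gt_at_top[of 0]
    by eventually_elim (use area_fun_le[of "real _ *\<^sub>R p"] assms in \<open>simp add: divide_simps\<close>)
qed

text \<open>\<Phi> blends \<open>(C + \<eta>) (area_fun - 1)\<close> outside the cutoff with
  \<open>(C + \<eta>) area_fun - f\<close> inside; the \<open>- 1\<close> keeps its integral finite
  along the sequence when \<Omega> has infinite measure. In the inner part \<Psi> has
  \<open>C\<close> in place of \<open>C + \<eta>\<close>, the level that the tangents are sure to
  reach.\<close>

lemma upper_lsc:
  fixes \<nu> :: "'a set \<Rightarrow> 'b"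
  assumes \<nu>: "\<nu> \<in> radon_measures \<Omega>" and v: "\<And>j. v j \<in> L1 \<Omega>"
    and conv: "weak_star \<Omega> (\<lambda>j. leb_measure \<Omega> (v j)) \<nu>"
    and w: "continuous_on \<Omega> w" and \<eta>: "0 < \<eta>" and CM: "M \<le> C"
    and C: "\<And>x y z. x \<in> \<Omega> \<Longrightarrow> depth \<Omega> x \<le> real n + 1 \<Longrightarrow> area_fun_ratio w x y \<le> C \<and>
      f x (w x + z) \<le> area_fun_ratio w x y * area_tangent y z + \<eta> * area_fun z + C * (area_fun z - area_tangent y z)"
  defines "\<theta> \<equiv> cutoff \<Omega> n" and "p \<equiv> polar \<Omega> (sing_part \<Omega> \<nu>)" and "a \<equiv> ac_density \<Omega> \<nu>"
  shows "(\<integral>\<^sup>+x. ennreal ((1 - \<theta> x) * (C + \<eta>) * (area_fun (a x) - 1) + \<theta> x * (C * area_fun (a x) - f x (w x + a x))) \<partial>leb_on \<Omega>)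
      + (\<integral>\<^sup>+x. ennreal ((1 - \<theta> x) * (C + \<eta>) + \<theta> x * (C - recession f x (p x))) \<partial>tv \<Omega> (sing_part \<Omega> \<nu>))
    \<le> liminf (\<lambda>j. \<integral>\<^sup>+x. ennreal ((1 - \<theta> x) * (C + \<eta>) * (area_fun (v j x) - 1) + \<theta> x * ((C + \<eta>) * area_fun (v j x) - f x (w x + v j x))) \<partial>leb_on \<Omega>)"
proof -
  have C0: "0 < C" using CM M by linarith
  have \<theta>: "0 \<le> \<theta> x" "\<theta> x \<le> 1" for x by (simp_all add: \<theta>_def cutoff_bounds)
  have \<theta>0: "depth \<Omega> x \<le> real n + 1" if "\<theta> x \<noteq> 0" for x
    using that cutoff_eq_0[of n \<Omega> x] by (force simp: \<theta>_def)
  have \<theta>c: "continuous_on \<Omega> \<theta>" unfolding \<theta>_def by (rule continuous_cutoff[OF \<Omega>])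
  obtain d :: "nat \<Rightarrow> 'b" where d: "\<And>X. open X \<Longrightarrow> X \<noteq> {} \<Longrightarrow> \<exists>n. d n \<in> X" by (erule dense_sequence)
  define \<Phi> where "\<Phi> x z = (1 - \<theta> x) * (C + \<eta>) * (area_fun z - 1) + \<theta> x * ((C + \<eta>) * area_fun z - f x (w x + z))" for x z
  define \<Psi> where "\<Psi> x z = (1 - \<theta> x) * (C + \<eta>) * (area_fun z - 1) + \<theta> x * (C * area_fun z - f x (w x + z))" for x z
  \<comment> \<open>\<open>A\<close> and \<open>B\<close> are offset and slope of the blend in which
    \<open>area_fun\<close> is replaced by its tangent at \<open>y\<close> and the inner integrand
    by \<open>(C - area_fun_ratio w x y) * area_tangent y z\<close>. The extra
    \<open>cutoff \<Omega> m\<close> on the outer part makes the offset integrable.\<close>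
  define A where "A m y x = cutoff \<Omega> m x * ((1 - \<theta> x) * (C + \<eta>)) * (inverse (area_fun y) - 1)
      + \<theta> x * (C - area_fun_ratio w x y) * inverse (area_fun y)" for m and y :: 'b and x
  define B where "B m y x = (cutoff \<Omega> m x * ((1 - \<theta> x) * (C + \<eta>)) + \<theta> x * (C - area_fun_ratio w x y)) *\<^sub>R (y /\<^sub>R area_fun y)" for m y x
  have AB: "A m y x + B m y x \<bullet> z = cutoff \<Omega> m x * ((1 - \<theta> x) * (C + \<eta>)) * (area_tangent y z - 1) + \<theta> x * (C - area_fun_ratio w x y) * area_tangent y z" for m y x z
    by (simp add: A_def B_def area_tangent_def algebra_simps divide_inverse)
  have ratio: "\<bar>\<theta> x * (C - area_fun_ratio w x y)\<bar> \<le> \<theta> x * C" if x: "x \<in> \<Omega>" for x y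
  proof (cases "\<theta> x = 0")
    case False
    then have "area_fun_ratio w x y \<le> C" using C[OF x \<theta>0] by blast
    then have "\<bar>C - area_fun_ratio w x y\<bar> \<le> C" using area_fun_ratio_nonneg[OF x, of w y] by linarith
    then have "\<theta> x * \<bar>C - area_fun_ratio w x y\<bar> \<le> \<theta> x * C" using \<theta>(1) by (intro mult_left_mono)
    then show ?thesis using \<theta>(1)[of x] by (simp add: abs_mult)
  qed simp
  have \<theta>m: "\<theta> \<in> borel_measurable (leb_on \<Omega>)" by (rule borel_measurable_continuous_borel_on[OF \<theta>c sets_leb_on])
  have rc: "continuous_on \<Omega> (\<lambda>x. area_fun_ratio w x y)" for y
    unfolding area_fun_ratio_def using area_fun_pos[of y] by (intro continuous_intros f_continuous w) auto
  have minor: "affine_minorant \<Omega> \<Phi> (A m y) (B m y)" for m y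
    unfolding affine_minorant_def
  proof (intro conjI ballI allI)
    have Ac: "continuous_on \<Omega> (A m y)" unfolding A_def[abs_def]
      by (intro continuous_intros continuous_cutoff[OF \<Omega>] \<theta>c rc)
    have inv: "0 < inverse (area_fun y)" "inverse (area_fun y) \<le> 1" using area_fun_ge_1[of y] area_fun_pos[of y] by (auto simp: inverse_le_1_iff)
    show "integrable (leb_on \<Omega>) (A m y)"
    proof (rule Bochner_Integration.integrable_bound)
      show "integrable (leb_on \<Omega>) (\<lambda>x. cutoff \<Omega> m x * (C + \<eta>) + \<theta> x * C)"
        unfolding \<theta>_def using integrable_cutoff[OF \<Omega>] by auto
      show "A m y \<in> borel_measurable (leb_on \<Omega>)" by (rule borel_measurable_continuous_borel_on[OF Ac sets_leb_on])
      show "AE x in leb_on \<Omega>. norm (A m y x) \<le> norm (cutoff \<Omega> m x * (C + \<eta>) + \<theta> x * C)"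
      proof (rule AE_I2)
        fix x assume "x \<in> space (leb_on \<Omega>)"
        then have x: "x \<in> \<Omega>" by (simp add: space_leb_on)
        have "\<bar>cutoff \<Omega> m x * ((1 - \<theta> x) * (C + \<eta>)) * (inverse (area_fun y) - 1)\<bar> \<le> cutoff \<Omega> m x * (C + \<eta>)"
        proof -
          have "\<bar>cutoff \<Omega> m x * ((1 - \<theta> x) * (C + \<eta>)) * (inverse (area_fun y) - 1)\<bar>
              = (cutoff \<Omega> m x * (C + \<eta>)) * ((1 - \<theta> x) * (1 - inverse (area_fun y)))"
            using \<theta>[of x] inv C0 \<eta> cutoff_bounds[of \<Omega> m x] by (simp add: abs_mult)
          also have "\<dots> \<le> (cutoff \<Omega> m x * (C + \<eta>)) * 1"
            using \<theta>[of x] inv C0 \<eta> cutoff_bounds[of \<Omega> m x] by (intro mult_left_mono mult_le_one) auto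
          finally show ?thesis by simp
        qed
        moreover have "\<bar>\<theta> x * (C - area_fun_ratio w x y) * inverse (area_fun y)\<bar> \<le> \<theta> x * C * 1"
          unfolding abs_mult[of _ "inverse (area_fun y)"] using ratio[OF x, of y] inv \<theta>(1)[of x] C0
          by (intro mult_mono) auto
        ultimately have "\<bar>A m y x\<bar> \<le> cutoff \<Omega> m x * (C + \<eta>) + \<theta> x * C"
          unfolding A_def by linarith
        then show "norm (A m y x) \<le> norm (cutoff \<Omega> m x * (C + \<eta>) + \<theta> x * C)" by simp
      qed
    qed
    show "continuous_on \<Omega> (B m y)" unfolding B_def[abs_def]
      by (intro continuous_intros continuous_cutoff[OF \<Omega>] \<theta>c rc)
    show "bounded (B m y ` \<Omega>)"
    proof (rule boundedI[of _ "(C + \<eta>) + C"])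
      fix b assume "b \<in> B m y ` \<Omega>"
      then obtain x where x: "x \<in> \<Omega>" "b = B m y x" by blast
      let ?c = "cutoff \<Omega> m x * ((1 - \<theta> x) * (C + \<eta>))"
      have n1: "norm (y /\<^sub>R area_fun y) \<le> 1" using norm_le_area_fun[of y] area_fun_pos[of y] by (simp add: field_simps)
      have "0 \<le> ?c" using \<theta>[of x] C0 \<eta> cutoff_bounds[of \<Omega> m x] by simp
      moreover have "?c \<le> C + \<eta>" using \<theta>[of x] C0 \<eta> cutoff_bounds[of \<Omega> m x]
        by (intro mult_left_le_one_le[THEN order_trans] mult_left_le_one_le mult_nonneg_nonneg) auto
      moreover have "\<bar>\<theta> x * (C - area_fun_ratio w x y)\<bar> \<le> C"
        using ratio[OF x(1), of y] mult_right_mono[OF \<theta>(2)[of x], of C] C0 by linarith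
      ultimately have "\<bar>?c + \<theta> x * (C - area_fun_ratio w x y)\<bar> \<le> (C + \<eta>) + C" by linarith
      then have "\<bar>?c + \<theta> x * (C - area_fun_ratio w x y)\<bar> * norm (y /\<^sub>R area_fun y) \<le> ((C + \<eta>) + C) * 1"
        using n1 C0 \<eta> by (intro mult_mono) auto
      then show "norm b \<le> (C + \<eta>) + C" unfolding x(2) B_def norm_scaleR[of "_ + _"] by simp
    qed
    fix x z assume x: "x \<in> \<Omega>"
    have "cutoff \<Omega> m x * ((1 - \<theta> x) * (C + \<eta>)) * (area_tangent y z - 1) \<le> (1 - \<theta> x) * (C + \<eta>) * (area_fun z - 1)"
    proof -
      have "cutoff \<Omega> m x * (area_tangent y z - 1) \<le> cutoff \<Omega> m x * (area_fun z - 1)"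
        using area_tangent_le[of y z] cutoff_bounds[of \<Omega> m x] by (intro mult_left_mono) auto
      also have "\<dots> \<le> area_fun z - 1" using area_fun_ge_1[of z] cutoff_bounds[of \<Omega> m x] by (intro mult_left_le_one_le) auto
      finally have "(1 - \<theta> x) * (C + \<eta>) * (cutoff \<Omega> m x * (area_tangent y z - 1)) \<le> (1 - \<theta> x) * (C + \<eta>) * (area_fun z - 1)"
        using \<theta>[of x] C0 \<eta> by (intro mult_left_mono) auto
      then show ?thesis by (simp add: mult_ac)
    qed
    moreover have "\<theta> x * (C - area_fun_ratio w x y) * area_tangent y z \<le> \<theta> x * ((C + \<eta>) * area_fun z - f x (w x + z))"
    proof (cases "\<theta> x = 0")
      case False
      then have "f x (w x + z) \<le> area_fun_ratio w x y * area_tangent y z + \<eta> * area_fun z + C * (area_fun z - area_tangent y z)"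
        using C[OF x \<theta>0] by blast
      then have "(C - area_fun_ratio w x y) * area_tangent y z \<le> (C + \<eta>) * area_fun z - f x (w x + z)" by (simp add: algebra_simps)
      then show ?thesis using \<theta>(1)[of x] unfolding mult.assoc by (intro mult_left_mono)
    qed simp
    ultimately show "A m y x + B m y x \<bullet> z \<le> \<Phi> x z" unfolding AB \<Phi>_def by (rule add_mono)
  qed
  define \<alpha> where "\<alpha> k = A (fst (prod_decode k)) (d (snd (prod_decode k)))" for k
  define \<beta> where "\<beta> k = B (fst (prod_decode k)) (d (snd (prod_decode k)))" for k
  have \<Phi>0: "0 \<le> \<Phi> x z" if x: "x \<in> \<Omega>" for x z
  proof -
    have "0 \<le> (1 - \<theta> x) * (C + \<eta>) * (area_fun z - 1)" using \<theta>[of x] C0 \<eta> area_fun_ge_1[of z] by simp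
    moreover have "0 \<le> \<theta> x * ((C + \<eta>) * area_fun z - f x (w x + z))"
    proof (cases "\<theta> x = 0")
      case False
      then have "area_fun_ratio w x z \<le> C" using C[OF x \<theta>0] by blast
      then have "area_fun_ratio w x z * area_fun z \<le> (C + \<eta>) * area_fun z" using \<eta> area_fun_pos[of z] by (intro mult_right_mono) auto
      then show ?thesis using \<theta>(1)[of x] by (simp add: area_fun_ratio_mult)
    qed simp
    ultimately show ?thesis by (simp add: \<Phi>_def)
  qed
  have dense: "\<exists>k. r < \<alpha> k x + \<beta> k x \<bullet> z" if x: "x \<in> \<Omega>" and r: "r < \<Psi> x z" for x z r
  proof -
    obtain m where m: "depth \<Omega> x \<le> real m" using real_arch_simple by blast
    then have m1: "cutoff \<Omega> m x = 1" by (rule cutoff_eq_1)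
    \<comment> \<open>At \<open>y = z\<close> this is exactly \<open>\<Psi> x z\<close>. Continuity
      in \<open>y\<close> carries the strict inequality to some \<open>d i\<close> of the dense
      sequence, so that countably many tangents suffice.\<close>
    define h where "h y = (1 - \<theta> x) * (C + \<eta>) * (area_tangent y z - 1) + \<theta> x * (C - area_fun_ratio w x y) * area_tangent y z" for y
    have ne: "area_fun y \<noteq> 0" for y :: 'b using area_fun_pos[of y] by simp
    have "continuous_on UNIV h" unfolding h_def area_tangent_def area_fun_ratio_def
      using x by (intro continuous_intros f_continuous) (auto simp: ne)
    then have "open {y. r < h y}" by (intro open_Collect_less continuous_intros)
    moreover have "h z = \<Psi> x z"
      unfolding h_def \<Psi>_def area_tangent_self by (simp add: left_diff_distrib mult.assoc area_fun_ratio_mult)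
    then have "z \<in> {y. r < h y}" using r by simp
    then have "{y. r < h y} \<noteq> {}" by blast
    ultimately obtain i where i: "r < h (d i)" using d by blast
    then show ?thesis
      by (intro exI[of _ "prod_encode (m, i)"]) (simp add: \<alpha>_def \<beta>_def AB m1 h_def)
  qed
  have rec: "(\<lambda>k. \<Psi> x (real k *\<^sub>R p x) / real k) \<longlonglongrightarrow> (1 - \<theta> x) * (C + \<eta>) + \<theta> x * (C - recession f x (p x))"
    if x: "x \<in> \<Omega>" and px: "norm (p x) = 1" for x
  proof -
    have 1: "(\<lambda>k. area_fun (real k *\<^sub>R p x) / real k) \<longlonglongrightarrow> 1" by (rule area_fun_ray_tendsto[OF px])
    have 2: "(\<lambda>k. f x (w x + real k *\<^sub>R p x) / real k) \<longlonglongrightarrow> recession f x (p x)"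
    proof (rule recession_sequentially[OF x tendsto_const x filterlim_real_sequentially])
      have "(\<lambda>k. inverse (real k) *\<^sub>R w x + p x) \<longlonglongrightarrow> 0 *\<^sub>R w x + p x"
        by (intro tendsto_intros lim_inverse_n)
      moreover have "eventually (\<lambda>k. inverse (real k) *\<^sub>R w x + p x = (w x + real k *\<^sub>R p x) /\<^sub>R real k) sequentially"
        using eventually_gt_at_top[of 0] by eventually_elim (simp add: scaleR_add_right)
      ultimately show "(\<lambda>k. (w x + real k *\<^sub>R p x) /\<^sub>R real k) \<longlonglongrightarrow> p x"
        using Lim_transform_eventually by fastforce
    qed
    have "(\<lambda>k. (1 - \<theta> x) * (C + \<eta>) * (area_fun (real k *\<^sub>R p x) / real k - 1 / real k)
         + \<theta> x * (C * (area_fun (real k *\<^sub>R p x) / real k) - f x (w x + real k *\<^sub>R p x) / real k))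
        \<longlonglongrightarrow> (1 - \<theta> x) * (C + \<eta>) * (1 - 0) + \<theta> x * (C * 1 - recession f x (p x))"
      by (intro tendsto_intros 1 2 lim_const_over_n)
    moreover have "\<Psi> x (real k *\<^sub>R p x) / real k = (1 - \<theta> x) * (C + \<eta>) * (area_fun (real k *\<^sub>R p x) / real k - 1 / real k)
         + \<theta> x * (C * (area_fun (real k *\<^sub>R p x) / real k) - f x (w x + real k *\<^sub>R p x) / real k)" for k
      by (simp add: \<Psi>_def divide_inverse algebra_simps)
    ultimately show ?thesis by simp
  qed
  have ab: "affine_minorant \<Omega> \<Phi> (\<alpha> k) (\<beta> k)" for k unfolding \<alpha>_def \<beta>_def by (rule minor)
  show ?thesis
    using lsc_weak_star[where \<Phi> = \<Phi> and \<alpha> = \<alpha> and \<beta> = \<beta>, OF \<Omega> \<nu> \<Phi>0 ab v conv dense rec[unfolded p_def]]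
    unfolding \<Phi>_def \<Psi>_def a_def p_def .
qed

end

section \<open>The relaxation formula\<close>

lemma integrable_area_fun_excess:
  assumes "integrable L (u :: 'a \<Rightarrow> 'b::euclidean_space)"
  shows "integrable L (\<lambda>x. area_fun (u x) - 1)"
proof (rule Bochner_Integration.integrable_bound)
  show "integrable L (\<lambda>x. norm (u x))" using assms by simp
  show "(\<lambda>x. area_fun (u x) - 1) \<in> borel_measurable L"
    using borel_measurable_area_fun[of u L] assms by simp
  show "AE x in L. norm (area_fun (u x) - 1) \<le> norm (norm (u x))"
  proof (rule AE_I2)
    fix x show "norm (area_fun (u x) - 1) \<le> norm (norm (u x))"
      using area_fun_ge_1[of "u x"] area_fun_le[of "u x"] by simp
  qed
qed

lemma nn_integral_area_fun_excess:
  assumes "integrable L (u :: 'a \<Rightarrow> 'b::euclidean_space)"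
  shows "(\<integral>\<^sup>+x. ennreal (sqrt (1 + (norm (u x))\<^sup>2) - 1) \<partial>L) = ennreal (\<integral>x. area_fun (u x) - 1 \<partial>L)"
  unfolding area_fun_def[symmetric]
  by (intro nn_integral_eq_integral integrable_area_fun_excess assms) (simp add: area_fun_ge_1)

lemma nn_integral_area_fun:
  assumes "integrable L (u :: 'a \<Rightarrow> 'b::euclidean_space)"
  shows "(\<integral>\<^sup>+x. ennreal (sqrt (1 + (norm (u x))\<^sup>2)) \<partial>L) = ennreal (\<integral>x. area_fun (u x) - 1 \<partial>L) + emeasure L (space L)"
proof -
  have [measurable]: "(\<lambda>x. area_fun (u x)) \<in> borel_measurable L" using borel_measurable_area_fun[of u L] assms by simp
  have "(\<integral>\<^sup>+x. ennreal (sqrt (1 + (norm (u x))\<^sup>2)) \<partial>L) = (\<integral>\<^sup>+x. ennreal (area_fun (u x) - 1) + 1 \<partial>L)"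
  proof (intro nn_integral_cong)
    fix x
    have "ennreal (area_fun (u x) - 1) + ennreal 1 = ennreal ((area_fun (u x) - 1) + 1)"
      using area_fun_ge_1[of "u x"] by (intro ennreal_plus[symmetric]) auto
    then show "ennreal (sqrt (1 + (norm (u x))\<^sup>2)) = ennreal (area_fun (u x) - 1) + 1" by (simp add: area_fun_def)
  qed
  also have "\<dots> = (\<integral>\<^sup>+x. ennreal (area_fun (u x) - 1) \<partial>L) + (\<integral>\<^sup>+x. 1 \<partial>L)" by (intro nn_integral_add) auto
  finally show ?thesis using nn_integral_area_fun_excess[OF assms] by (simp add: area_fun_def)
qed

text \<open>Area-strict convergence carries information through the areas if \<Omega> has finite
  measure and through the excesses otherwise. Subtracting the measure of \<Omega> in the finite case
  brings both to the same real quantity.\<close>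

lemma area_strict_excess:
  fixes \<nu> :: "'a::euclidean_space set \<Rightarrow> 'b::euclidean_space"
  assumes \<Omega>: "open \<Omega>" and \<nu>: "\<nu> \<in> radon_measures \<Omega>" and v: "\<And>j. v j \<in> L1 \<Omega>"
    and conv: "area_strict \<Omega> (\<lambda>j. leb_measure \<Omega> (v j)) \<nu>"
  shows "(\<lambda>j. \<integral>x. area_fun (v j x) - 1 \<partial>leb_on \<Omega>) \<longlonglongrightarrow>
    (\<integral>x. area_fun (ac_density \<Omega> \<nu> x) - 1 \<partial>leb_on \<Omega>) + measure (tv \<Omega> (sing_part \<Omega> \<nu>)) \<Omega>"
proof -
  let ?L = "leb_on \<Omega>" and ?S = "tv \<Omega> (sing_part \<Omega> \<nu>)"
  define X where "X u = (\<integral>x. area_fun (u x) - 1 \<partial>?L)" for u :: "'a \<Rightarrow> 'b"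
  have X0: "0 \<le> X u" for u unfolding X_def by (rule Bochner_Integration.integral_nonneg) (simp add: area_fun_ge_1)
  interpret S: finite_measure ?S by (rule finite_tv[OF radon_sing_part[OF \<nu> \<Omega>]])
  have vi: "integrable ?L (v j)" for j using v by (simp add: L1_def)
  note ai = integrable_ac_density[OF \<nu> \<Omega>]
  have ex: "area_excess \<Omega> (leb_measure \<Omega> (v j)) = ennreal (X (v j))" for j
    unfolding area_excess_leb[OF \<Omega> v] X_def by (rule nn_integral_area_fun_excess[OF vi])
  have ex\<nu>: "area_excess \<Omega> \<nu> = ennreal (X (ac_density \<Omega> \<nu>) + measure ?S \<Omega>)"
    unfolding area_excess_def nn_integral_area_fun_excess[OF ai] X_def[symmetric] S.emeasure_eq_measure
    using X0 by (simp add: ennreal_plus)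
  show ?thesis
  proof (cases "emeasure lborel \<Omega> = \<infinity>")
    case True
    then have "(\<lambda>j. ennreal (X (v j))) \<longlonglongrightarrow> ennreal (X (ac_density \<Omega> \<nu>) + measure ?S \<Omega>)"
      using conv by (simp add: area_strict_def ex ex\<nu>)
    then show ?thesis unfolding X_def[symmetric] using X0 by (subst (asm) tendsto_ennreal_iff) auto
  next
    case False
    define m where "m = measure lborel \<Omega>"
    have m: "emeasure ?L \<Omega> = ennreal m"
      using False unfolding emeasure_leb_on[OF \<Omega> top_in_borel_on] m_def by (intro emeasure_eq_ennreal_measure) auto
    have ar: "area \<Omega> (leb_measure \<Omega> (v j)) \<Omega> = ennreal (X (v j) + m)" for j
      unfolding area_leb[OF \<Omega> v] nn_integral_area_fun[OF vi] X_def[symmetric]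
      using X0 m by (simp add: space_leb_on ennreal_plus m_def)
    have "(\<integral>\<^sup>+x\<in>\<Omega>. ennreal (sqrt (1 + (norm (ac_density \<Omega> \<nu> x))\<^sup>2)) \<partial>?L) = (\<integral>\<^sup>+x. ennreal (sqrt (1 + (norm (ac_density \<Omega> \<nu> x))\<^sup>2)) \<partial>?L)"
      by (intro nn_integral_cong) (simp add: space_leb_on)
    then have ar\<nu>: "area \<Omega> \<nu> \<Omega> = ennreal (X (ac_density \<Omega> \<nu>) + m + measure ?S \<Omega>)"
      unfolding area_def nn_integral_area_fun[OF ai] X_def[symmetric] S.emeasure_eq_measure
      using X0 m by (simp add: space_leb_on ennreal_plus m_def nn_integral_area_fun[OF ai] X_def[symmetric])
    have "(\<lambda>j. ennreal (X (v j) + m)) \<longlonglongrightarrow> ennreal (X (ac_density \<Omega> \<nu>) + m + measure ?S \<Omega>)"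
      using conv by (simp add: area_strict_def ar ar\<nu>)
    then have "(\<lambda>j. X (v j) + m) \<longlonglongrightarrow> X (ac_density \<Omega> \<nu>) + m + measure ?S \<Omega>"
      using X0 by (subst (asm) tendsto_ennreal_iff) (auto simp: m_def)
    from tendsto_diff[OF this tendsto_const[of m]] show ?thesis unfolding X_def[symmetric] by (simp add: algebra_simps)
  qed
qed

context convex_integrand
begin

text \<open>Semicontinuity is turned around: the integral of \<open>P\<close> is \<open>D\<close>
  times the area excess plus a constant minus the integral of \<open>\<theta> f\<close>. As the
  excess converges, a lower bound for the former is an upper bound for the latter. The subtraction
  requires finite integrals, hence the first claim.\<close>

lemma local_upper:
  fixes \<nu> :: "'a set \<Rightarrow> 'b" and n :: nat
  assumes \<nu>: "\<nu> \<in> radon_measures \<Omega>" and v: "\<And>j. v j \<in> L1 \<Omega>"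
    and conv: "area_strict \<Omega> (\<lambda>j. leb_measure \<Omega> (v j)) \<nu>"
    and w: "continuous_on \<Omega> w" and \<epsilon>: "0 < \<epsilon>"
  defines "\<theta> \<equiv> cutoff \<Omega> n" and "p \<equiv> polar \<Omega> (sing_part \<Omega> \<nu>)" and "a \<equiv> ac_density \<Omega> \<nu>"
  shows "\<And>z. integrable (leb_on \<Omega>) z \<Longrightarrow> integrable (leb_on \<Omega>) (\<lambda>x. \<theta> x * f x (w x + z x))"
    and "eventually (\<lambda>j. (\<integral>x. \<theta> x * f x (w x + v j x) \<partial>leb_on \<Omega>)
      \<le> (\<integral>x. \<theta> x * f x (w x + a x) \<partial>leb_on \<Omega>) + (\<integral>x. \<theta> x * recession f x (p x) \<partial>tv \<Omega> (sing_part \<Omega> \<nu>)) + \<epsilon>) sequentially"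
proof -
  let ?L = "leb_on \<Omega>" and ?S = "tv \<Omega> (sing_part \<Omega> \<nu>)" and ?K = "{x \<in> \<Omega>. depth \<Omega> x \<le> real n + 1}"
  interpret S: finite_measure ?S by (rule finite_tv[OF radon_sing_part[OF \<nu> \<Omega>]])
  have K: "compact ?K" "?K \<subseteq> \<Omega>" using compact_depth_le[OF \<Omega>] by auto
  have \<theta>: "0 \<le> \<theta> x" "\<theta> x \<le> 1" for x by (simp_all add: \<theta>_def cutoff_bounds)
  have \<theta>0: "depth \<Omega> x \<le> real n + 1" if "\<theta> x \<noteq> 0" for x
    using that cutoff_eq_0[of n \<Omega> x] by (force simp: \<theta>_def)
  have \<theta>m: "\<theta> \<in> borel_measurable L" if "sets L = borel_on \<Omega>" for L
    unfolding \<theta>_def by (rule measurable_cutoff[OF \<Omega> that])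
  have i\<theta>: "integrable ?L \<theta>" unfolding \<theta>_def by (rule integrable_cutoff[OF \<Omega>])
  note ai = integrable_ac_density[OF \<nu> \<Omega>, folded a_def]
  have wm: "w \<in> borel_measurable ?L" by (rule borel_measurable_continuous_borel_on[OF w sets_leb_on])
  have i\<theta>h: "integrable ?L (\<lambda>x. \<theta> x * area_fun (z x))" if "integrable ?L z" for z :: "'a \<Rightarrow> 'b"
  proof -
    have "integrable ?L (\<lambda>x. \<theta> x * (area_fun (z x) - 1) + \<theta> x)"
      unfolding \<theta>_def using integrable_cutoff_mult(1)[OF \<Omega> sets_leb_on integrable_area_fun_excess[OF that]] integrable_cutoff[OF \<Omega>]
      by (rule Bochner_Integration.integrable_add)
    then show ?thesis by (simp add: right_diff_distrib)
  qed
  \<comment> \<open>This bound does not involve \<eta>, which is fixed only later; it serves for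
    integrability.\<close>
  obtain C\<^sub>1 where C\<^sub>1: "M \<le> C\<^sub>1" "\<And>x y. x \<in> ?K \<Longrightarrow> area_fun_ratio w x y \<le> C\<^sub>1"
    using area_fun_ratio_bound[OF w K] by blast
  have f_le: "\<theta> x * f x (w x + z) \<le> B * (\<theta> x * area_fun z)"
    if "x \<in> \<Omega>" and B: "\<And>x y. x \<in> ?K \<Longrightarrow> area_fun_ratio w x y \<le> B" for x z B
  proof (cases "\<theta> x = 0")
    case False
    then have "area_fun_ratio w x z \<le> B" using \<theta>0[OF False] that by blast
    then have "area_fun_ratio w x z * area_fun z \<le> B * area_fun z" using area_fun_pos[of z] by (intro mult_right_mono) auto
    then have "\<theta> x * f x (w x + z) \<le> \<theta> x * (B * area_fun z)" using \<theta>(1)[of x] by (intro mult_left_mono) (auto simp: area_fun_ratio_mult)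
    then show ?thesis by (simp add: mult_ac)
  qed simp
  show i\<theta>f: "integrable ?L (\<lambda>x. \<theta> x * f x (w x + z x))" if z: "integrable ?L z" for z
  proof (rule Bochner_Integration.integrable_bound)
    show "integrable ?L (\<lambda>x. C\<^sub>1 * (\<theta> x * area_fun (z x)))" using i\<theta>h[OF z] by simp
    have "(\<lambda>x. w x + z x) \<in> borel_measurable ?L" using wm z by simp
    then show "(\<lambda>x. \<theta> x * f x (w x + z x)) \<in> borel_measurable ?L"
      by (intro borel_measurable_times \<theta>m f_measurable) (auto simp: sets_leb_on)
    show "AE x in ?L. norm (\<theta> x * f x (w x + z x)) \<le> norm (C\<^sub>1 * (\<theta> x * area_fun (z x)))"
    proof (rule AE_I2)
      fix x assume "x \<in> space ?L"
      then have x: "x \<in> \<Omega>" by (simp add: space_leb_on)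
      have "0 \<le> \<theta> x * f x (w x + z x)" using \<theta>(1)[of x] f_nonneg[OF x] by simp
      then show "norm (\<theta> x * f x (w x + z x)) \<le> norm (C\<^sub>1 * (\<theta> x * area_fun (z x)))"
        using f_le[OF x C\<^sub>1(2), of "z x"] by simp
    qed
  qed
  have pm: "p \<in> borel_measurable ?S" unfolding p_def using integrable_polar[OF radon_sing_part[OF \<nu> \<Omega>]] by simp
  have np: "AE x in ?S. norm (p x) = 1" unfolding p_def by (rule norm_polar[OF radon_sing_part[OF \<nu> \<Omega>]])
  have rp: "AE x in ?S. 0 \<le> recession f x (p x) \<and> recession f x (p x) \<le> M"
    using np AE_space
  proof eventually_elim
    case (elim x)
    then have x: "x \<in> \<Omega>" by (simp add: space_tv)
    show ?case using recession_nonneg[OF x, of "p x"] recession_le[OF x, of "p x"] elim(1) by simp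
  qed
  have i\<theta>S: "integrable ?S \<theta>"
    by (rule S.integrable_const_bound[where B = 1]) (auto simp: \<theta> \<theta>m[OF sets_tv])
  have i\<theta>r: "integrable ?S (\<lambda>x. \<theta> x * recession f x (p x))"
  proof (rule S.integrable_const_bound[where B = M])
    show "(\<lambda>x. \<theta> x * recession f x (p x)) \<in> borel_measurable ?S"
      by (intro borel_measurable_times \<theta>m recession_measurable sets_tv pm)
    show "AE x in ?S. norm (\<theta> x * recession f x (p x)) \<le> M"
      using rp
    proof eventually_elim
      case (elim x)
      have "\<theta> x * recession f x (p x) \<le> recession f x (p x)" using \<theta>[of x] elim by (intro mult_left_le_one_le) auto
      then show ?case using elim \<theta>(1)[of x] by simp
    qed
  qed
  define I where "I z = (\<integral>x. \<theta> x * f x (w x + z x) \<partial>?L)" for z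
  define X where "X z = (\<integral>x. area_fun (z x) - 1 \<partial>?L)" for z :: "'a \<Rightarrow> 'b"
  define Z where "Z = (\<integral>x. \<theta> x * area_fun (a x) \<partial>?L) + (\<integral>x. \<theta> x \<partial>?S)"
  define R where "R = (\<integral>x. \<theta> x * recession f x (p x) \<partial>?S)"
  define T where "T = (\<integral>x. \<theta> x \<partial>?L)"
  have "0 \<le> \<theta> x * area_fun (a x)" for x using \<theta>(1)[of x] area_fun_pos[of "a x"] by simp
  then have Z0: "0 \<le> Z" unfolding Z_def
    by (intro add_nonneg_nonneg Bochner_Integration.integral_nonneg \<theta>(1))
  \<comment> \<open>\<open>Z\<close> is the area of the limit weighted by the cutoff, and
    \<open>\<eta> * Z\<close> is what the tangents lose. A third of \<epsilon> is reserved for it,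
    the others for the lower limit and for the convergence of the excess.\<close>
  define \<eta> where "\<eta> = \<epsilon> / (3 * (Z + 1))"
  have \<eta>: "0 < \<eta>" "\<eta> * Z \<le> \<epsilon> / 3" using \<epsilon> Z0 by (auto simp: \<eta>_def field_simps)
  obtain C where C: "M \<le> C" "\<And>x y z. x \<in> ?K \<Longrightarrow> area_fun_ratio w x y \<le> C \<and>
    f x (w x + z) \<le> area_fun_ratio w x y * area_tangent y z + \<eta> * area_fun z + C * (area_fun z - area_tangent y z)"
    using tangent_majorant[OF w K \<eta>(1)] by blast
  define D where "D = C + \<eta>"
  have D: "0 < D" using C(1) M \<eta>(1) by (simp add: D_def)
  have vi: "integrable ?L (v j)" for j using v by (simp add: L1_def)
  define P where "P x z = (1 - \<theta> x) * (C + \<eta>) * (area_fun z - 1) + \<theta> x * ((C + \<eta>) * area_fun z - f x (w x + z))" for x z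
  define Q where "Q x z = (1 - \<theta> x) * (C + \<eta>) * (area_fun z - 1) + \<theta> x * (C * area_fun z - f x (w x + z))" for x z
  define Q' where "Q' x = (1 - \<theta> x) * (C + \<eta>) + \<theta> x * (C - recession f x (p x))" for x
  \<comment> \<open>In this form the area enters with the constant factor \<open>D\<close> and
    without the cutoff, so that the convergence of the total excess applies without being
    localised.\<close>
  have Peq: "P x z = D * (area_fun z - 1) + D * \<theta> x - \<theta> x * f x (w x + z)" for x z
    by (simp add: P_def D_def algebra_simps)
  have Qeq: "Q x z = D * (area_fun z - 1) + D * \<theta> x - \<theta> x * f x (w x + z) - \<eta> * (\<theta> x * area_fun z)" for x z
    by (simp add: Q_def D_def algebra_simps)
  have Q'eq: "Q' x = D - \<eta> * \<theta> x - \<theta> x * recession f x (p x)" for x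
    by (simp add: Q'_def D_def algebra_simps)
  have Q0: "0 \<le> Q x z" if x: "x \<in> \<Omega>" for x z
  proof -
    have "0 \<le> (1 - \<theta> x) * (C + \<eta>) * (area_fun z - 1)"
      using \<theta>(2)[of x] C(1) M \<eta>(1) area_fun_ge_1[of z] by simp
    then show ?thesis using f_le[OF x, of C z] C(2) by (simp add: Q_def algebra_simps)
  qed
  have P0: "0 \<le> P x z" if x: "x \<in> \<Omega>" for x z
  proof -
    have "Q x z \<le> P x z" using \<eta>(1) \<theta>(1)[of x] area_fun_pos[of z] by (simp add: Peq Qeq)
    then show ?thesis using Q0[OF x, of z] by linarith
  qed
  note ih = integrable_area_fun_excess[of ?L]
  have iP: "integrable ?L (\<lambda>x. P x (z x))" and IP: "(\<integral>x. P x (z x) \<partial>?L) = D * X z + D * T - I z"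
    if z: "integrable ?L z" for z
    using ih[OF z] i\<theta> i\<theta>f[OF z] unfolding Peq X_def T_def I_def by simp_all
  have iQ: "integrable ?L (\<lambda>x. Q x (a x))"
    and IQ: "(\<integral>x. Q x (a x) \<partial>?L) = D * X a + D * T - I a - \<eta> * (\<integral>x. \<theta> x * area_fun (a x) \<partial>?L)"
    using ih[OF ai] i\<theta> i\<theta>f[OF ai] i\<theta>h[OF ai] unfolding Qeq X_def T_def I_def by simp_all
  have iQ': "integrable ?S Q'" and IQ': "(\<integral>x. Q' x \<partial>?S) = D * measure ?S \<Omega> - \<eta> * (\<integral>x. \<theta> x \<partial>?S) - R"
    using i\<theta>S i\<theta>r unfolding Q'eq[abs_def] R_def by (simp_all add: space_tv)
  have Q'0: "AE x in ?S. 0 \<le> Q' x"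
    using rp
  proof eventually_elim
    case (elim x)
    have "0 \<le> (1 - \<theta> x) * (C + \<eta>)" using \<theta>(2)[of x] C(1) M \<eta>(1) by simp
    moreover have "0 \<le> \<theta> x * (C - recession f x (p x))" using \<theta>(1)[of x] C(1) elim by simp
    ultimately show ?case by (simp add: Q'_def)
  qed
  define B where "B = (\<integral>x. Q x (a x) \<partial>?L) + (\<integral>x. Q' x \<partial>?S)"
  have "(\<integral>\<^sup>+x. ennreal (Q x (a x)) \<partial>?L) + (\<integral>\<^sup>+x. ennreal (Q' x) \<partial>?S) \<le> liminf (\<lambda>j. \<integral>\<^sup>+x. ennreal (P x (v j x)) \<partial>?L)"
    unfolding P_def Q_def Q'_def \<theta>_def p_def a_def
    by (rule upper_lsc[OF \<nu> v _ w \<eta>(1) C(1)]) (use conv C(2) in \<open>auto simp: area_strict_def\<close>)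
  also have "(\<integral>\<^sup>+x. ennreal (Q x (a x)) \<partial>?L) = ennreal (\<integral>x. Q x (a x) \<partial>?L)"
    by (intro nn_integral_eq_integral iQ AE_I2 Q0) (simp add: space_leb_on)
  also have "(\<integral>\<^sup>+x. ennreal (Q' x) \<partial>?S) = ennreal (\<integral>x. Q' x \<partial>?S)"
    by (intro nn_integral_eq_integral iQ' Q'0)
  also have "ennreal (\<integral>x. Q x (a x) \<partial>?L) + ennreal (\<integral>x. Q' x \<partial>?S) = ennreal B"
    unfolding B_def
    by (intro ennreal_plus[symmetric] integral_nonneg_AE Q'0 AE_I2 Q0) (simp add: space_leb_on)
  also have "(\<lambda>j. \<integral>\<^sup>+x. ennreal (P x (v j x)) \<partial>?L) = (\<lambda>j. ennreal (\<integral>x. P x (v j x) \<partial>?L))"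
    by (intro ext nn_integral_eq_integral iP vi AE_I2 P0) (simp add: space_leb_on)
  finally have lsc: "ennreal B \<le> liminf (\<lambda>j. ennreal (\<integral>x. P x (v j x) \<partial>?L))" .
  have Pn: "0 \<le> (\<integral>x. P x (v j x) \<partial>?L)" for j
    by (intro integral_nonneg_AE AE_I2 P0) (simp add: space_leb_on)
  \<comment> \<open>For a negative bound the claim is trivial, whereas \<open>ennreal\<close> would
    truncate it; otherwise a number strictly below the lower limit is eventually exceeded.\<close>
  have ev1: "eventually (\<lambda>j. B - \<epsilon> / 3 < (\<integral>x. P x (v j x) \<partial>?L)) sequentially"
  proof (cases "B - \<epsilon> / 3 < 0")
    case True
    then show ?thesis using Pn by (intro always_eventually allI) (rule less_le_trans)
  next
    case False
    then have "ennreal (B - \<epsilon> / 3) < ennreal B" using \<epsilon> by (intro ennreal_lessI) auto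
    also note lsc
    finally have "eventually (\<lambda>j. ennreal (B - \<epsilon> / 3) < ennreal (\<integral>x. P x (v j x) \<partial>?L)) sequentially"
      by (rule less_LiminfD)
    then show ?thesis by eventually_elim (use False in \<open>simp add: ennreal_less_iff\<close>)
  qed
  have "(\<lambda>j. X (v j)) \<longlonglongrightarrow> X a + measure ?S \<Omega>"
    using area_strict_excess[OF \<Omega> \<nu> v conv] unfolding X_def a_def .
  then have "(\<lambda>j. D * X (v j)) \<longlonglongrightarrow> D * (X a + measure ?S \<Omega>)" by (intro tendsto_intros)
  then have ev2: "eventually (\<lambda>j. D * X (v j) < D * (X a + measure ?S \<Omega>) + \<epsilon> / 3) sequentially"
    using \<epsilon> by (intro order_tendstoD) auto
  have "eventually (\<lambda>j. I (v j) \<le> I a + R + \<epsilon>) sequentially"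
    using ev1 ev2
  proof eventually_elim
    case (elim j)
    have "\<eta> * Z = \<eta> * (\<integral>x. \<theta> x * area_fun (a x) \<partial>?L) + \<eta> * (\<integral>x. \<theta> x \<partial>?S)" by (simp add: Z_def distrib_left)
    then show ?case
      using elim \<eta>(2) unfolding IP[OF vi] B_def IQ IQ' distrib_left by linarith
  qed
  then show "eventually (\<lambda>j. (\<integral>x. \<theta> x * f x (w x + v j x) \<partial>?L)
      \<le> (\<integral>x. \<theta> x * f x (w x + a x) \<partial>?L) + (\<integral>x. \<theta> x * recession f x (p x) \<partial>?S) + \<epsilon>) sequentially"
    unfolding I_def R_def .
qed

text \<open>The absolutely continuous term can be infinite when \<Omega> has infinite measure, and
  then the claim is trivial. Otherwise \<open>local_upper\<close> is used inside the cutoff with a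
  continuous \<open>w\<close> for \<open>u\<^sub>0\<close>. Outside, \<open>f\<close> at
  \<open>u\<^sub>0 + v j\<close> is compared with \<open>f\<close> at \<open>u\<^sub>0\<close> plus
  the limit density by the Lipschitz bound, and tightness makes the difference small.\<close>

lemma upper_bound:
  fixes \<nu> :: "'a set \<Rightarrow> 'b"
  assumes \<nu>: "\<nu> \<in> radon_measures \<Omega>" and v: "\<And>j. v j \<in> L1 \<Omega>"
    and conv: "area_strict \<Omega> (\<lambda>j. leb_measure \<Omega> (v j)) \<nu>" and u\<^sub>0: "u\<^sub>0 \<in> L1 \<Omega>"
  shows "liminf (\<lambda>j. functional \<Omega> f (\<lambda>x. u\<^sub>0 x + v j x))
    \<le> (\<integral>\<^sup>+x. ennreal (f x (u\<^sub>0 x + ac_density \<Omega> \<nu> x)) \<partial>leb_on \<Omega>)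
      + (\<integral>\<^sup>+x. ennreal (recession f x (polar \<Omega> (sing_part \<Omega> \<nu>) x)) \<partial>tv \<Omega> (sing_part \<Omega> \<nu>))" (is "_ \<le> ?F + ?R")
proof (cases "?F = \<infinity>")
  case True
  then show ?thesis by simp
next
  case False
  let ?L = "leb_on \<Omega>" and ?S = "tv \<Omega> (sing_part \<Omega> \<nu>)" and ?a = "ac_density \<Omega> \<nu>" and ?p = "polar \<Omega> (sing_part \<Omega> \<nu>)"
  interpret S: finite_measure ?S by (rule finite_tv[OF radon_sing_part[OF \<nu> \<Omega>]])
  note ai = integrable_ac_density[OF \<nu> \<Omega>]
  have vi: "integrable ?L (v j)" for j using v by (simp add: L1_def)
  have ui: "integrable ?L u\<^sub>0" using u\<^sub>0 by (simp add: L1_def)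
  have ws: "weak_star \<Omega> (\<lambda>j. leb_measure \<Omega> (v j)) \<nu>" using conv by (simp add: area_strict_def)
  have fm: "(\<lambda>x. f x (u\<^sub>0 x + ?a x)) \<in> borel_measurable ?L"
    using ui ai by (intro f_measurable sets_leb_on) simp
  have f0: "0 \<le> f x z" if "x \<in> space ?L" for x z using that f_nonneg by (simp add: space_leb_on)
  have iF: "integrable ?L (\<lambda>x. f x (u\<^sub>0 x + ?a x))"
    using False f0 by (intro integrableI_nonneg fm AE_I2) (auto simp: less_top)
  define F where "F = (\<integral>x. f x (u\<^sub>0 x + ?a x) \<partial>?L)"
  have F: "?F = ennreal F" unfolding F_def by (intro nn_integral_eq_integral iF AE_I2 f0)
  have pm: "?p \<in> borel_measurable ?S" using integrable_polar[OF radon_sing_part[OF \<nu> \<Omega>]] by simp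
  have rp: "AE x in ?S. 0 \<le> recession f x (?p x) \<and> recession f x (?p x) \<le> M"
    using norm_polar[OF radon_sing_part[OF \<nu> \<Omega>]] AE_space
  proof eventually_elim
    case (elim x)
    then have x: "x \<in> \<Omega>" by (simp add: space_tv)
    show ?case using recession_nonneg[OF x, of "?p x"] recession_le[OF x, of "?p x"] elim(1) by simp
  qed
  have r0: "AE x in ?S. 0 \<le> recession f x (?p x)" using rp by eventually_elim simp
  have iR: "integrable ?S (\<lambda>x. recession f x (?p x))"
  proof (rule S.integrable_const_bound[where B = M])
    show "AE x in ?S. norm (recession f x (?p x)) \<le> M" using rp by eventually_elim simp
  qed (rule recession_measurable[OF sets_tv pm])
  define R where "R = (\<integral>x. recession f x (?p x) \<partial>?S)"
  have R: "?R = ennreal R" unfolding R_def by (intro nn_integral_eq_integral iR r0)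
  have F0: "0 \<le> F" unfolding F_def by (intro integral_nonneg_AE AE_I2 f0)
  have R0: "0 \<le> R" unfolding R_def by (rule integral_nonneg_AE[OF r0])
  \<comment> \<open>The error consists of \<epsilon> from \<open>local_upper\<close>,
    \<open>M * \<epsilon>\<close> for each of the two exchanges of \<open>u\<^sub>0\<close> and
    \<open>w\<close>, and \<open>M * \<epsilon>\<close> for each of the tails of \<open>v j\<close>
    and of the limit density.\<close>
  have main: "eventually (\<lambda>j. functional \<Omega> f (\<lambda>x. u\<^sub>0 x + v j x) \<le> ennreal (F + R + (1 + 4 * M) * \<epsilon>)) sequentially"
    if \<epsilon>: "0 < \<epsilon>" for \<epsilon>
  proof -
    obtain n\<^sub>1 where n1: "eventually (\<lambda>j. (\<integral>x. (1 - cutoff \<Omega> n\<^sub>1 x) * norm (v j x) \<partial>?L) \<le> \<epsilon>) sequentially"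
      using weak_star_tight[OF \<Omega> \<nu> v ws \<epsilon>] by blast
    have "(\<lambda>n. \<integral>x. (1 - cutoff \<Omega> n x) * norm (?a x) \<partial>?L) \<longlonglongrightarrow> 0"
      by (rule cutoff_tail_tendsto[OF \<Omega> sets_leb_on]) (use ai in simp)
    then have "eventually (\<lambda>n. (\<integral>x. (1 - cutoff \<Omega> n x) * norm (?a x) \<partial>?L) < \<epsilon>) sequentially"
      using \<epsilon> by (intro order_tendstoD) auto
    \<comment> \<open>Enlarging \<open>n\<close> preserves the tightness estimate, as
      \<open>1 - cutoff\<close> decreases in \<open>n\<close>.\<close>
    then have "eventually (\<lambda>n. n\<^sub>1 \<le> n \<and> (\<integral>x. (1 - cutoff \<Omega> n x) * norm (?a x) \<partial>?L) < \<epsilon>) sequentially"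
      using eventually_ge_at_top[of n\<^sub>1] by eventually_elim simp
    then obtain n where n: "n\<^sub>1 \<le> n" "(\<integral>x. (1 - cutoff \<Omega> n x) * norm (?a x) \<partial>?L) < \<epsilon>"
      by (auto simp: eventually_sequentially)
    define \<theta> where "\<theta> = cutoff \<Omega> n"
    have \<theta>: "0 \<le> \<theta> x" "\<theta> x \<le> 1" for x by (simp_all add: \<theta>_def cutoff_bounds)
    have i\<theta>: "integrable L g \<Longrightarrow> integrable L (\<lambda>x. \<theta> x * g x)" "integrable L g \<Longrightarrow> integrable L (\<lambda>x. (1 - \<theta> x) * g x)"
      if "sets L = borel_on \<Omega>" for L and g :: "'a \<Rightarrow> real"
      unfolding \<theta>_def using integrable_cutoff_mult[OF \<Omega> that] by auto
    obtain w where w: "continuous_on UNIV w" "integrable ?L w" "(\<integral>x. norm (u\<^sub>0 x - w x) \<partial>?L) < \<epsilon>"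
      using continuous_dense_L1[OF \<Omega> ui \<epsilon>] by blast
    have wc: "continuous_on \<Omega> w" using w(1) continuous_on_subset by blast
    note \<theta>f = local_upper(1)[OF \<nu> v conv wc \<epsilon>, of _ n, folded \<theta>_def]
    have iv: "integrable ?L (\<lambda>x. (1 - \<theta> x) * norm (z x))" if "integrable ?L z" for z :: "'a \<Rightarrow> 'b"
      by (rule i\<theta>(2)[OF sets_leb_on]) (use that in simp)
    have d: "integrable ?L (\<lambda>x. norm (u\<^sub>0 x - w x))" using ui w(2) by simp
    have le1: "(\<integral>x. \<theta> x * f x (w x + ?a x) \<partial>?L) \<le> (\<integral>x. \<theta> x * f x (u\<^sub>0 x + ?a x) \<partial>?L) + M * \<epsilon>"
    proof -
      have "(\<integral>x. \<theta> x * f x (w x + ?a x) \<partial>?L) \<le> (\<integral>x. \<theta> x * f x (u\<^sub>0 x + ?a x) + M * norm (u\<^sub>0 x - w x) \<partial>?L)"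
      proof (rule integral_mono)
        show "integrable ?L (\<lambda>x. \<theta> x * f x (w x + ?a x))" by (rule \<theta>f[OF ai])
        show "integrable ?L (\<lambda>x. \<theta> x * f x (u\<^sub>0 x + ?a x) + M * norm (u\<^sub>0 x - w x))"
          using i\<theta>(1)[OF sets_leb_on iF] d by simp
        fix x assume "x \<in> space ?L"
        then have x: "x \<in> \<Omega>" by (simp add: space_leb_on)
        have "\<theta> x * f x (w x + ?a x) \<le> \<theta> x * (f x (u\<^sub>0 x + ?a x) + M * norm (u\<^sub>0 x - w x))"
          using f_lipschitz1[OF x, of "w x + ?a x" "u\<^sub>0 x + ?a x"] \<theta>(1)[of x]
          by (intro mult_left_mono) (auto simp: norm_minus_commute)
        also have "\<dots> \<le> \<theta> x * f x (u\<^sub>0 x + ?a x) + M * norm (u\<^sub>0 x - w x)"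
          using \<theta>[of x] M unfolding distrib_left by (intro add_left_mono mult_left_le_one_le) auto
        finally show "\<theta> x * f x (w x + ?a x) \<le> \<theta> x * f x (u\<^sub>0 x + ?a x) + M * norm (u\<^sub>0 x - w x)" .
      qed
      also have "\<dots> = (\<integral>x. \<theta> x * f x (u\<^sub>0 x + ?a x) \<partial>?L) + M * (\<integral>x. norm (u\<^sub>0 x - w x) \<partial>?L)"
        using i\<theta>(1)[OF sets_leb_on iF] d by simp
      also have "\<dots> \<le> (\<integral>x. \<theta> x * f x (u\<^sub>0 x + ?a x) \<partial>?L) + M * \<epsilon>" using w(3) M by simp
      finally show ?thesis .
    qed
    have le2: "(\<integral>x. \<theta> x * recession f x (?p x) \<partial>?S) \<le> R"
      unfolding R_def
    proof (rule integral_mono_AE)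
      show "AE x in ?S. \<theta> x * recession f x (?p x) \<le> recession f x (?p x)"
        using r0 by eventually_elim (use \<theta> in \<open>simp add: mult_left_le_one_le\<close>)
    qed (use iR i\<theta>(1)[OF sets_tv] in auto)
    have sum: "(\<integral>x. \<theta> x * f x (u\<^sub>0 x + ?a x) \<partial>?L) + (\<integral>x. (1 - \<theta> x) * f x (u\<^sub>0 x + ?a x) \<partial>?L) = F"
      unfolding F_def
      by (subst Bochner_Integration.integral_add[symmetric])
        (auto simp: algebra_simps iF i\<theta>[OF sets_leb_on] intro!: i\<theta>[OF sets_leb_on] Bochner_Integration.integral_cong)
    show ?thesis
      using n1 local_upper(2)[OF \<nu> v conv wc \<epsilon>, of n, folded \<theta>_def]
    proof eventually_elim
      case (elim j)
      let ?ub = "\<lambda>x. \<theta> x * f x (w x + v j x) + M * norm (u\<^sub>0 x - w x)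
         + ((1 - \<theta> x) * f x (u\<^sub>0 x + ?a x) + M * ((1 - \<theta> x) * norm (v j x) + (1 - \<theta> x) * norm (?a x)))"
      note ints = \<theta>f[OF vi[of j]] d i\<theta>(2)[OF sets_leb_on iF] iv[OF vi[of j]] iv[OF ai]
      have iub: "integrable ?L ?ub" using ints by simp
      have pt: "f x (u\<^sub>0 x + v j x) \<le> ?ub x" if x: "x \<in> \<Omega>" for x
      proof -
        have 1: "\<theta> x * f x (u\<^sub>0 x + v j x) \<le> \<theta> x * f x (w x + v j x) + M * norm (u\<^sub>0 x - w x)"
        proof -
          have "\<theta> x * f x (u\<^sub>0 x + v j x) \<le> \<theta> x * (f x (w x + v j x) + M * norm (u\<^sub>0 x - w x))"
            using f_lipschitz1[OF x, of "u\<^sub>0 x + v j x" "w x + v j x"] \<theta>(1)[of x] by (intro mult_left_mono) auto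
          also have "\<dots> \<le> \<theta> x * f x (w x + v j x) + M * norm (u\<^sub>0 x - w x)"
            using \<theta>[of x] M unfolding distrib_left by (intro add_left_mono mult_left_le_one_le) auto
          finally show ?thesis .
        qed
        have 2: "(1 - \<theta> x) * f x (u\<^sub>0 x + v j x) \<le> (1 - \<theta> x) * f x (u\<^sub>0 x + ?a x) + M * ((1 - \<theta> x) * norm (v j x) + (1 - \<theta> x) * norm (?a x))"
        proof -
          have "f x (u\<^sub>0 x + v j x) \<le> f x (u\<^sub>0 x + ?a x) + M * norm (v j x - ?a x)"
            using f_lipschitz1[OF x, of "u\<^sub>0 x + v j x" "u\<^sub>0 x + ?a x"] by simp
          also have "\<dots> \<le> f x (u\<^sub>0 x + ?a x) + M * (norm (v j x) + norm (?a x))"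
            using M by (intro add_left_mono mult_left_mono norm_triangle_ineq4) auto
          finally have "(1 - \<theta> x) * f x (u\<^sub>0 x + v j x) \<le> (1 - \<theta> x) * (f x (u\<^sub>0 x + ?a x) + M * (norm (v j x) + norm (?a x)))"
            using \<theta>(2)[of x] by (intro mult_left_mono) auto
          then show ?thesis by (simp add: algebra_simps)
        qed
        have "f x (u\<^sub>0 x + v j x) = \<theta> x * f x (u\<^sub>0 x + v j x) + (1 - \<theta> x) * f x (u\<^sub>0 x + v j x)"
          by (simp add: algebra_simps)
        then show ?thesis using 1 2 by linarith
      qed
      have "functional \<Omega> f (\<lambda>x. u\<^sub>0 x + v j x) \<le> (\<integral>\<^sup>+x. ennreal (?ub x) \<partial>?L)"
        unfolding functional_def by (intro nn_integral_mono ennreal_leI pt) (simp add: space_leb_on)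
      also have "\<dots> = ennreal (\<integral>x. ?ub x \<partial>?L)"
      proof (intro nn_integral_eq_integral iub AE_I2)
        fix x assume x: "x \<in> space ?L"
        show "0 \<le> ?ub x" using pt[of x] f0[OF x, of "u\<^sub>0 x + v j x"] x by (simp add: space_leb_on)
      qed
      also have "\<dots> \<le> ennreal (F + R + (1 + 4 * M) * \<epsilon>)"
      proof (rule ennreal_leI)
        have "(\<integral>x. ?ub x \<partial>?L) = (\<integral>x. \<theta> x * f x (w x + v j x) \<partial>?L) + M * (\<integral>x. norm (u\<^sub>0 x - w x) \<partial>?L)
           + ((\<integral>x. (1 - \<theta> x) * f x (u\<^sub>0 x + ?a x) \<partial>?L)
             + M * ((\<integral>x. (1 - \<theta> x) * norm (v j x) \<partial>?L) + (\<integral>x. (1 - \<theta> x) * norm (?a x) \<partial>?L)))"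
          using ints by simp
        moreover have "(\<integral>x. (1 - \<theta> x) * norm (v j x) \<partial>?L) \<le> \<epsilon>"
        proof -
          have "(\<integral>x. (1 - \<theta> x) * norm (v j x) \<partial>?L) \<le> (\<integral>x. (1 - cutoff \<Omega> n\<^sub>1 x) * norm (v j x) \<partial>?L)"
          proof (rule integral_mono)
            show "integrable ?L (\<lambda>x. (1 - cutoff \<Omega> n\<^sub>1 x) * norm (v j x))"
              by (rule integrable_cutoff_mult(2)[OF \<Omega> sets_leb_on]) (use vi in simp)
            show "(1 - \<theta> x) * norm (v j x) \<le> (1 - cutoff \<Omega> n\<^sub>1 x) * norm (v j x)" for x
              using cutoff_mono[OF n(1), of \<Omega> x] by (intro mult_right_mono) (auto simp: \<theta>_def)
          qed (rule iv[OF vi])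
          then show ?thesis using elim(1) by linarith
        qed
        then have "M * ((\<integral>x. (1 - \<theta> x) * norm (v j x) \<partial>?L) + (\<integral>x. (1 - \<theta> x) * norm (?a x) \<partial>?L)) \<le> M * (\<epsilon> + \<epsilon>)"
          using n(2) M unfolding \<theta>_def by (intro mult_left_mono add_mono) auto
        moreover have "M * (\<integral>x. norm (u\<^sub>0 x - w x) \<partial>?L) \<le> M * \<epsilon>" using w(3) M by (intro mult_left_mono) auto
        ultimately show "(\<integral>x. ?ub x \<partial>?L) \<le> F + R + (1 + 4 * M) * \<epsilon>"
          using elim(2) le1 le2 sum by (simp add: algebra_simps)
      qed
      finally show ?case .
    qed
  qed
  have "liminf (\<lambda>j. functional \<Omega> f (\<lambda>x. u\<^sub>0 x + v j x)) \<le> ennreal (F + R) + ennreal e" if e: "0 < e" for e :: real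
  proof -
    have "0 < e / (1 + 4 * M)" using e M by simp
    from main[OF this] have "eventually (\<lambda>j. functional \<Omega> f (\<lambda>x. u\<^sub>0 x + v j x) \<le> ennreal (F + R) + ennreal e) sequentially"
      by eventually_elim (use M e F0 R0 in \<open>simp add: ennreal_plus[symmetric] del: ennreal_plus\<close>)
    then have "liminf (\<lambda>j. functional \<Omega> f (\<lambda>x. u\<^sub>0 x + v j x)) \<le> liminf (\<lambda>j::nat. ennreal (F + R) + ennreal e)"
      by (rule Liminf_mono)
    then show ?thesis by (simp add: Liminf_const)
  qed
  then have "liminf (\<lambda>j. functional \<Omega> f (\<lambda>x. u\<^sub>0 x + v j x)) \<le> ennreal (F + R)" by (rule ennreal_le_epsilon)
  then show ?thesis unfolding F R using F0 R0 by (simp add: ennreal_plus)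
qed

end

section \<open>Recovery sequence and conclusion\<close>

lemma weak_star_add_leb:
  fixes \<nu> :: "'a::euclidean_space set \<Rightarrow> 'b::euclidean_space"
  assumes \<nu>: "\<nu> \<in> radon_measures \<Omega>" and v: "\<And>j. v j \<in> L1 \<Omega>" and u\<^sub>0: "u\<^sub>0 \<in> L1 \<Omega>"
    and conv: "weak_star \<Omega> (\<lambda>j. leb_measure \<Omega> (v j)) \<nu>"
  shows "weak_star \<Omega> (\<lambda>j. leb_measure \<Omega> (\<lambda>x. u\<^sub>0 x + v j x)) (\<lambda>B. leb_measure \<Omega> u\<^sub>0 B + \<nu> B)"
  unfolding weak_star_def
proof (intro allI impI, elim conjE)
  fix \<phi> :: "'a \<Rightarrow> 'b" assume \<phi>: "continuous_on \<Omega> \<phi>" "bounded (\<phi> ` \<Omega>)"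
  note m = borel_measurable_continuous_on_restrict[OF \<phi>(1)]
  have i: "integrable (leb_on \<Omega>) u\<^sub>0" "integrable (leb_on \<Omega>) (v j)" for j using u\<^sub>0 v by (auto simp: L1_def)
  have s: "(\<lambda>x. u\<^sub>0 x + v j x) \<in> L1 \<Omega>" for j using i by (simp add: L1_def)
  have "vec_integral \<Omega> \<phi> (leb_measure \<Omega> (\<lambda>x. u\<^sub>0 x + v j x))
      = (\<integral>x. \<phi> x \<bullet> u\<^sub>0 x \<partial>leb_on \<Omega>) + vec_integral \<Omega> \<phi> (leb_measure \<Omega> (v j))" for j
    unfolding vec_integral_leb[OF s m \<phi>(2)] vec_integral_leb[OF v m \<phi>(2)] inner_add_right
    by (intro Bochner_Integration.integral_add integrable_bounded_inner[OF sets_leb_on _ \<phi>] i)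
  moreover have "(\<lambda>j. vec_integral \<Omega> \<phi> (leb_measure \<Omega> (v j))) \<longlonglongrightarrow> vec_integral \<Omega> \<phi> \<nu>"
    using conv \<phi> by (simp add: weak_star_def)
  ultimately show "(\<lambda>j. vec_integral \<Omega> \<phi> (leb_measure \<Omega> (\<lambda>x. u\<^sub>0 x + v j x)))
      \<longlonglongrightarrow> vec_integral \<Omega> \<phi> (\<lambda>B. leb_measure \<Omega> u\<^sub>0 B + \<nu> B)"
    by (simp add: vec_integral_add_leb[OF \<nu> u\<^sub>0 m \<phi>(2)] tendsto_add)
qed

theorem theorem1p2:
  fixes \<Omega> :: "(real^'d::finite) set"
    and k :: nat
    and A :: "('d, 'N::finite, 'n::finite) pdo_coeffs"
    and u\<^sub>0 :: "real^'d \<Rightarrow> real^'N"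
    and f :: "real^'d \<Rightarrow> real^'N \<Rightarrow> real"
    and M :: real
  assumes "open \<Omega>" and "emeasure lborel (frontier \<Omega>) = 0"
    and "admissible_coeffs \<Omega> k A"
    and H1: "L1_closed \<Omega> (im_pdo \<Omega> k A)"
    and H2: "\<And>\<mu>. \<mu> \<in> ker_meas \<Omega> k A \<Longrightarrow>
      \<exists>u :: nat \<Rightarrow> real^'d \<Rightarrow> real^'N. (\<forall>j. u j \<in> ker_L1 \<Omega> k A) \<and>
        area_strict \<Omega> (\<lambda>j. leb_measure \<Omega> (u j)) \<mu>"
    and "u\<^sub>0 \<in> WA1 \<Omega> k A"
    and "\<And>x z. x \<in> \<Omega> \<Longrightarrow> f x z \<ge> 0"
    and "continuous_on (\<Omega> \<times> UNIV) (\<lambda>(x, z). f x z)"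
    and "\<And>x. x \<in> \<Omega> \<Longrightarrow> convex_on UNIV (f x)"
    and "M > 0"
    and "\<And>x z. x \<in> \<Omega> \<Longrightarrow> 1 / M * (norm z - 1) \<le> \<bar>f x z\<bar> \<and> \<bar>f x z\<bar> \<le> M * (1 + norm z)"
    and "\<exists>\<omega>. modulus_of_continuity \<omega> \<and>
      (\<forall>x\<in>\<Omega>. \<forall>y\<in>\<Omega>. \<forall>z. \<bar>f x z - f y z\<bar> \<le> \<omega> (norm (x - y)) * (1 + norm z))"
  shows "\<forall>\<mu>. (\<exists>\<nu>\<in>ker_meas \<Omega> k A. \<mu> = (\<lambda>B. leb_measure \<Omega> u\<^sub>0 B + \<nu> B)) \<longrightarrow>
    relaxation \<Omega> k A u\<^sub>0 f \<mu> =
      (\<integral>\<^sup>+x. ennreal (f x (ac_density \<Omega> \<mu> x)) \<partial>leb_on \<Omega>)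
      + (\<integral>\<^sup>+x. ennreal (recession f x (polar \<Omega> (sing_part \<Omega> \<mu>) x)) \<partial>tv \<Omega> (sing_part \<Omega> \<mu>))"
proof (intro allI impI, elim bexE)
  fix \<mu> \<nu> assume \<nu>: "\<nu> \<in> ker_meas \<Omega> k A" and \<mu>: "\<mu> = (\<lambda>B. leb_measure \<Omega> u\<^sub>0 B + \<nu> B)"
  obtain \<omega> where \<omega>: "modulus_of_continuity \<omega>"
    "\<And>x y z. x \<in> \<Omega> \<Longrightarrow> y \<in> \<Omega> \<Longrightarrow> \<bar>f x z - f y z\<bar> \<le> \<omega> (norm (x - y)) * (1 + norm z)"
    using assms(12) by blast
  \<comment> \<open>Nonnegativity of \<open>f\<close> removes the absolute values, and the lower
    growth bound is multiplied by \<open>M\<close>.\<close>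
  interpret convex_integrand \<Omega> f M \<omega>
  proof
    fix x z assume x: "x \<in> \<Omega>"
    show "norm z - 1 \<le> M * f x z"
      using assms(11)[OF x, of z] assms(7)[OF x, of z] assms(10) by (simp add: pos_divide_le_eq mult.commute)
    show "f x z \<le> M * (1 + norm z)" using assms(11)[OF x, of z] by linarith
  qed (use assms \<omega> in auto)
  have u\<^sub>0: "u\<^sub>0 \<in> L1 \<Omega>" using assms(6) by (simp add: WA1_def)
  have \<nu>r: "\<nu> \<in> radon_measures \<Omega>" using \<nu> by (simp add: ker_meas_def)
  have \<mu>r: "\<mu> \<in> radon_measures \<Omega>" unfolding \<mu> by (rule radon_add_measure[OF radon_leb_measure[OF u\<^sub>0] \<nu>r])
  let ?F = "(\<integral>\<^sup>+x. ennreal (f x (ac_density \<Omega> \<mu> x)) \<partial>leb_on \<Omega>)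
      + (\<integral>\<^sup>+x. ennreal (recession f x (polar \<Omega> (sing_part \<Omega> \<mu>) x)) \<partial>tv \<Omega> (sing_part \<Omega> \<mu>))"
  show "relaxation \<Omega> k A u\<^sub>0 f \<mu> = ?F"
  proof (rule antisym)
    obtain v where v: "\<And>j. v j \<in> ker_L1 \<Omega> k A" "area_strict \<Omega> (\<lambda>j. leb_measure \<Omega> (v j)) \<nu>"
      using H2[OF \<nu>] by blast
    have vL: "v j \<in> L1 \<Omega>" for j using v(1)[of j] by (simp add: ker_L1_def)
    have "weak_star \<Omega> (\<lambda>j. leb_measure \<Omega> (\<lambda>x. u\<^sub>0 x + v j x)) \<mu>"
      unfolding \<mu> using v(2) by (intro weak_star_add_leb \<nu>r vL u\<^sub>0) (simp add: area_strict_def)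
    then have "relaxation \<Omega> k A u\<^sub>0 f \<mu> \<le> liminf (\<lambda>j. functional \<Omega> f (\<lambda>x. u\<^sub>0 x + v j x))"
      unfolding relaxation_def using v(1) by (intro Inf_lower CollectI exI[of _ "\<lambda>j x. u\<^sub>0 x + v j x"]) auto
    also have "\<dots> \<le> (\<integral>\<^sup>+x. ennreal (f x (u\<^sub>0 x + ac_density \<Omega> \<nu> x)) \<partial>leb_on \<Omega>)
        + (\<integral>\<^sup>+x. ennreal (recession f x (polar \<Omega> (sing_part \<Omega> \<nu>) x)) \<partial>tv \<Omega> (sing_part \<Omega> \<nu>))"
      by (rule upper_bound[OF \<nu>r vL v(2) u\<^sub>0])
    \<comment> \<open>The bound so far is expressed through \<nu>. Adding \<open>u\<^sub>0\<close>
      shifts the density almost everywhere and leaves the singular part unchanged, which turns it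
      into the formula for \<mu>.\<close>
    also have "(\<integral>\<^sup>+x. ennreal (f x (u\<^sub>0 x + ac_density \<Omega> \<nu> x)) \<partial>leb_on \<Omega>) = (\<integral>\<^sup>+x. ennreal (f x (ac_density \<Omega> \<mu> x)) \<partial>leb_on \<Omega>)"
      using ac_density_add_leb[OF \<nu>r assms(1) u\<^sub>0] unfolding \<mu>
      by (intro nn_integral_cong_AE) (auto elim!: eventually_mono)
    also have "sing_part \<Omega> \<nu> = sing_part \<Omega> \<mu>" unfolding \<mu> by (rule sing_part_add_leb[OF \<nu>r assms(1), symmetric])
    finally show "relaxation \<Omega> k A u\<^sub>0 f \<mu> \<le> ?F" .
    show "?F \<le> relaxation \<Omega> k A u\<^sub>0 f \<mu>"
      unfolding relaxation_def
    proof (rule Inf_greatest, clarify)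
      fix u :: "nat \<Rightarrow> real^'d \<Rightarrow> real^'N"
      assume u: "\<forall>j. \<exists>v\<in>ker_L1 \<Omega> k A. u j = (\<lambda>x. u\<^sub>0 x + v x)" and c: "weak_star \<Omega> (\<lambda>j. leb_measure \<Omega> (u j)) \<mu>"
      have "u j \<in> L1 \<Omega>" for j
      proof -
        obtain v where "v \<in> ker_L1 \<Omega> k A" "u j = (\<lambda>x. u\<^sub>0 x + v x)" using u by blast
        then show ?thesis using u\<^sub>0 by (simp add: ker_L1_def L1_def)
      qed
      then show "?F \<le> liminf (\<lambda>j. functional \<Omega> f (u j))" by (rule lower_bound[OF \<mu>r _ c])
    qed
  qed
qed

end
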